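(* Let $w\in L^1_W(\Omega)$ and let $\{(h,\tau_h)\}_h$ be a family of admissible mesh pairs such that $\frac{\tau_h}{h}\to0$ as $h\searrow0$. Then $$\operatorname{TV}(w)\ge\limsup_{h\searrow0}\operatorname{TV}^h\big(R^W_{P0^{\tau_h}}(w)\big).$$
   Context: Setting. $\Omega\subset\mathbb{R}^d$, $d\in\{1,2,3\}$, is a bounded Lipschitz domain that is a finite union of bounded intervals ($d=1$), axis-aligned squares ($d=2$) or axis-aligned cubes ($d=3$). $W\subset\mathbb{Z}$ is a finite nonempty set. $\|\cdot\|$ is the Euclidean norm and $\|\phi\|_{L^\infty(\Omega;\mathbb{R}^d)}=\operatorname{ess\,sup}_{x\in\Omega}\|\phi(x)\|$. For $w\in L^1(\Omega)$, $\operatorname{TV}(w)=\sup\{\int_\Omega w\,\operatorname{div}\phi\,dx : \phi\in C^1_c(\Omega;\mathbb{R}^d),\ \sup_{x}\|\phi(x)\|\le 1\}\in[0,\infty]$; $L^1_W(\Omega)=\{w\in L^1(\Omega): w(x)\in W \text{ for a.a. } x\in\Omega\}$. Meshes. A mesh of $\Omega$ of size $\tau>0$ is a conforming finite element mesh $\mathcal{Q}_\tau$: a finite collection of intervals / axis-aligned squares / axis-aligned cubes of side length $\tau$ with pairwise disjoint interiors, whose union is $\Omega$ up to a Lebesgue null set, and such that two distinct closed cells intersect in the empty set or a common face. A pair $(h,\tau_h)$ with $h>0$ and $\tau_h\in(0,h]$ is an admissible mesh pair if there are given a mesh $\mathcal{Q}_h$ of size $h$ (the TV mesh) and a mesh $\mathcal{Q}_{\tau_h}$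 of size $\tau_h$ (the input mesh) such that every cell of $\mathcal{Q}_h$ is a union of cells of $\mathcal{Q}_{\tau_h}$. Families are indexed by $h$ in a set of positive numbers accumulating at $0$. Discretized total variation. For a cell $Q$, $RT0^h(Q)$ is the space of maps $Q\to\mathbb{R}^d$, $x\mapsto (a_i+c_ix_i)_{i=1}^d$ with $a,c\in\mathbb{R}^d$. $RT0^h=\{\phi\in H(\operatorname{div};\Omega):\phi|_Q\in RT0^h(Q)\ \forall Q\in\mathcal{Q}_h\}$, and $RT0^h_0=\{\phi\in RT0^h:(\phi\cdot n)|_{\partial\Omega}\equiv0\}$ with $n$ the outer unit normal of $\Omega$. For $w\in L^1(\Omega)$, $\operatorname{TV}^h(w)=\sup\{\int_\Omega w\operatorname{div}\phi\,dx:\phi\in RT0^h_0,\ \|\phi\|_{L^\infty(\Omega;\mathbb{R}^d)}\le1\}$. Rounding operator. For $w\in L^1_W(\Omega)$ and a mesh $\mathcal{Q}_\tau$, $R^W_{P0^\tau}(w)$ is the function that is constant on each cell $Q\in\mathcal{Q}_\tau$ with value the minimizer of $\big|\frac1{|Q|}\int_Q w\,dx-\omega\big|$ over all $\omega\in W$ with $|\{x\in Q:w(x)=\omega\}|>0$ (the smallest minimizer if it is not unique). *)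

theory Defs
  imports "HOL-Analysis.Analysis" "HOL-Probability.Essential_Supremum"
begin

text \<open>Functions on \<open>\<Omega>\<close> are represented by functions on the whole space, of which only the
  values almost everywhere on \<open>\<Omega>\<close> matter.\<close>

subsection \<open>Domains\<close>

text \<open>Near each boundary point, \<open>\<Omega>\<close> is the strict subgraph of a Lipschitz function on the
  hyperplane orthogonal to some direction \<open>\<nu>\<close>.\<close>

definition lipschitz_boundary :: "(real^'d) set \<Rightarrow> bool" where
  "lipschitz_boundary \<Omega> \<longleftrightarrow>
     (\<forall>x\<in>frontier \<Omega>. \<exists>r>0. \<exists>\<nu> L \<gamma>. norm \<nu> = 1 \<and> L-lipschitz_on {z. z \<bullet> \<nu> = 0} \<gamma> \<and>
        (\<forall>y\<in>ball x r. y \<in> \<Omega> \<longleftrightarrow> y \<bullet> \<nu> < \<gamma> (y - (y \<bullet> \<nu>) *\<^sub>R \<nu>)))"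

definition bounded_lipschitz_domain :: "(real^'d) set \<Rightarrow> bool" where
  "bounded_lipschitz_domain \<Omega> \<longleftrightarrow>
     \<Omega> \<noteq> {} \<and> open \<Omega> \<and> connected \<Omega> \<and> bounded \<Omega> \<and> lipschitz_boundary \<Omega>"

definition cube :: "real^'d \<Rightarrow> real \<Rightarrow> (real^'d) set" where
  "cube a s = cbox a (a + vec s)"

text \<open>An open set is not literally a union of closed cubes, so unions are taken up to
  Lebesgue null sets.\<close>

definition tiles :: "(real^'d) set set \<Rightarrow> (real^'d) set \<Rightarrow> bool" where
  "tiles \<C> \<Omega> \<longleftrightarrow> finite \<C> \<and> (\<Union>\<C> - \<Omega>) \<union> (\<Omega> - \<Union>\<C>) \<in> null_sets lebesgue"

definition finite_union_of_cubes :: "(real^'d) set \<Rightarrow> bool" where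
  "finite_union_of_cubes \<Omega> \<longleftrightarrow> (\<exists>\<C>. (\<forall>C\<in>\<C>. \<exists>a s. 0 < s \<and> C = cube a s) \<and> tiles \<C> \<Omega>)"

text \<open>The normal is characterised by \<open>\<Omega>\<close> having a tangent half-space at \<open>x\<close>. For a finite
  union of cubes it exists exactly at the points in the relative interior of flat parts
  of the boundary, hence at almost every boundary point with respect to surface measure.\<close>

definition outer_unit_normal :: "(real^'d) set \<Rightarrow> real^'d \<Rightarrow> real^'d \<Rightarrow> bool" where
  "outer_unit_normal \<Omega> x n \<longleftrightarrow> norm n = 1 \<and>
     (\<forall>\<epsilon>>0. \<exists>r>0. \<forall>y\<in>ball x r.
        ((y - x) \<bullet> n < - \<epsilon> * norm (y - x) \<longrightarrow> y \<in> \<Omega>) \<and>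
        ((y - x) \<bullet> n > \<epsilon> * norm (y - x) \<longrightarrow> y \<notin> \<Omega>))"

subsection \<open>Meshes\<close>

text \<open>The empty set is a face of every convex set, so the last condition includes the case
  of disjoint cells.\<close>

definition mesh :: "(real^'d) set \<Rightarrow> real \<Rightarrow> (real^'d) set set \<Rightarrow> bool" where
  "mesh \<Omega> \<tau> \<Q> \<longleftrightarrow> 0 < \<tau> \<and> (\<forall>Q\<in>\<Q>. \<exists>a. Q = cube a \<tau>) \<and> tiles \<Q> \<Omega> \<and>
     (\<forall>Q\<in>\<Q>. \<forall>Q'\<in>\<Q>. Q \<noteq> Q' \<longrightarrow>
        interior Q \<inter> interior Q' = {} \<and> (Q \<inter> Q') face_of Q \<and> (Q \<inter> Q') face_of Q')"

text \<open>\<open>\<Q>\<close> is the TV mesh and \<open>\<P>\<close> the input mesh.\<close>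

definition admissible_mesh_pair ::
  "(real^'d) set \<Rightarrow> real \<Rightarrow> real \<Rightarrow> (real^'d) set set \<Rightarrow> (real^'d) set set \<Rightarrow> bool" where
  "admissible_mesh_pair \<Omega> h \<tau> \<Q> \<P> \<longleftrightarrow> 0 < h \<and> 0 < \<tau> \<and> \<tau> \<le> h \<and> mesh \<Omega> h \<Q> \<and> mesh \<Omega> \<tau> \<P> \<and>
     (\<forall>Q\<in>\<Q>. \<exists>\<S>\<subseteq>\<P>. Q = \<Union>\<S>)"

subsection \<open>Function spaces\<close>

definition L1 :: "(real^'d) set \<Rightarrow> (real^'d \<Rightarrow> real) set" where
  "L1 \<Omega> = {w. integrable (lebesgue_on \<Omega>) w}"

definition L1W :: "int set \<Rightarrow> (real^'d) set \<Rightarrow> (real^'d \<Rightarrow> real) set" where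
  "L1W W \<Omega> = {w \<in> L1 \<Omega>. AE x in lebesgue_on \<Omega>. w x \<in> real_of_int ` W}"

definition L2 :: "(real^'d) set \<Rightarrow> (real^'d \<Rightarrow> 'b::euclidean_space) set" where
  "L2 \<Omega> = {f \<in> borel_measurable (lebesgue_on \<Omega>).
      integrable (lebesgue_on \<Omega>) (\<lambda>x. (norm (f x))\<^sup>2)}"

text \<open>Elements of \<open>C1c \<Omega>\<close> are extended by zero to the whole space.\<close>

definition C1c :: "(real^'d) set \<Rightarrow> (real^'d \<Rightarrow> 'b::euclidean_space) set" where
  "C1c \<Omega> = {f. (\<exists>f' :: real^'d \<Rightarrow> (real^'d) \<Rightarrow>\<^sub>L 'b.
        (\<forall>x. (f has_derivative blinfun_apply (f' x)) (at x)) \<and> continuous_on UNIV f') \<and>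
      compact (closure {x. f x \<noteq> 0}) \<and> closure {x. f x \<noteq> 0} \<subseteq> \<Omega>}"

definition divergence :: "(real^'d \<Rightarrow> real^'d) \<Rightarrow> real^'d \<Rightarrow> real" where
  "divergence \<phi> x = (\<Sum>i\<in>UNIV. frechet_derivative \<phi> (at x) (axis i 1) $ i)"

text \<open>In the first integral, \<open>frechet_derivative \<psi> (at x) (\<phi> x)\<close> is the scalar product of \<open>\<phi> x\<close>
  and the gradient of \<open>\<psi>\<close> at \<open>x\<close>. By mollification, \<open>C\<^sup>1\<close> test functions define the same
  weak divergence as smooth ones.\<close>

definition has_L2_weak_divergence ::
  "(real^'d) set \<Rightarrow> (real^'d \<Rightarrow> real^'d) \<Rightarrow> (real^'d \<Rightarrow> real) \<Rightarrow> bool" where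
  "has_L2_weak_divergence \<Omega> \<phi> g \<longleftrightarrow> g \<in> L2 \<Omega> \<and>
     (\<forall>\<psi>\<in>C1c \<Omega>. (LINT x|lebesgue_on \<Omega>. frechet_derivative \<psi> (at x) (\<phi> x)) =
                  - (LINT x|lebesgue_on \<Omega>. g x * (\<psi> x :: real)))"

definition Hdiv :: "(real^'d) set \<Rightarrow> (real^'d \<Rightarrow> real^'d) set" where
  "Hdiv \<Omega> = {\<phi> \<in> L2 \<Omega>. \<exists>g. has_L2_weak_divergence \<Omega> \<phi> g}"

subsection \<open>Total variation\<close>

definition TV :: "(real^'d) set \<Rightarrow> (real^'d \<Rightarrow> real) \<Rightarrow> ereal" where
  "TV \<Omega> w = (SUP \<phi>\<in>{\<phi> \<in> C1c \<Omega>. \<forall>x. norm (\<phi> x) \<le> 1}.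
               ereal (LINT x|lebesgue_on \<Omega>. w x * divergence \<phi> x))"

definition rt0_poly :: "real^'d \<Rightarrow> real^'d \<Rightarrow> real^'d \<Rightarrow> real^'d" where
  "rt0_poly a c x = (\<chi> i. a $ i + c $ i * x $ i)"

definition coincides_on ::
  "(real^'d) set \<Rightarrow> (real^'d \<Rightarrow> real^'d) \<Rightarrow> (real^'d \<Rightarrow> real^'d) \<Rightarrow> bool" where
  "coincides_on Q \<phi> p \<longleftrightarrow> (AE x in lebesgue_on Q. \<phi> x = p x)"

definition RT0 :: "(real^'d) set \<Rightarrow> (real^'d) set set \<Rightarrow> (real^'d \<Rightarrow> real^'d) set" where
  "RT0 \<Omega> \<Q> = {\<phi> \<in> Hdiv \<Omega>. \<forall>Q\<in>\<Q>. \<exists>a c. coincides_on Q \<phi> (rt0_poly a c)}"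

text \<open>The trace of \<open>\<phi>\<close> on the part of the boundary adjacent to a cell \<open>Q\<close> is that of the
  polynomial (unique, since \<open>Q\<close> has positive measure) that coincides with \<open>\<phi>\<close> on \<open>Q\<close>.\<close>

definition RT0_0 :: "(real^'d) set \<Rightarrow> (real^'d) set set \<Rightarrow> (real^'d \<Rightarrow> real^'d) set" where
  "RT0_0 \<Omega> \<Q> = {\<phi> \<in> RT0 \<Omega> \<Q>.
     \<forall>Q\<in>\<Q>. \<forall>a c. coincides_on Q \<phi> (rt0_poly a c) \<longrightarrow>
       (\<forall>x\<in>Q \<inter> frontier \<Omega>. \<forall>n. outer_unit_normal \<Omega> x n \<longrightarrow> rt0_poly a c x \<bullet> n = 0)}"

definition TVh :: "(real^'d) set \<Rightarrow> (real^'d) set set \<Rightarrow> (real^'d \<Rightarrow> real) \<Rightarrow> ereal" where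
  "TVh \<Omega> \<Q> w = Sup {ereal (LINT x|lebesgue_on \<Omega>. w x * g x) | \<phi> g.
      \<phi> \<in> RT0_0 \<Omega> \<Q> \<and> esssup (lebesgue_on \<Omega>) (\<lambda>x. ereal (norm (\<phi> x))) \<le> 1 \<and>
      has_L2_weak_divergence \<Omega> \<phi> g}"

subsection \<open>Rounding\<close>

definition cell_mean :: "(real^'d \<Rightarrow> real) \<Rightarrow> (real^'d) set \<Rightarrow> real" where
  "cell_mean w Q = (LINT x|lebesgue_on Q. w x) / measure lebesgue Q"

definition cell_values :: "int set \<Rightarrow> (real^'d \<Rightarrow> real) \<Rightarrow> (real^'d) set \<Rightarrow> int set" where
  "cell_values W w Q = {\<omega>\<in>W. emeasure lebesgue {x\<in>Q. w x = real_of_int \<omega>} > 0}"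

definition rounded_value :: "int set \<Rightarrow> (real^'d \<Rightarrow> real) \<Rightarrow> (real^'d) set \<Rightarrow> int" where
  "rounded_value W w Q =
     Min {\<omega>. is_arg_min (\<lambda>\<omega>. \<bar>cell_mean w Q - real_of_int \<omega>\<bar>) (\<lambda>\<omega>. \<omega> \<in> cell_values W w Q) \<omega>}"

text \<open>This representative is zero on the cell boundaries, which form a null set.\<close>

definition rounding ::
  "int set \<Rightarrow> (real^'d) set set \<Rightarrow> (real^'d \<Rightarrow> real) \<Rightarrow> real^'d \<Rightarrow> real" where
  "rounding W \<P> w x = (\<Sum>Q\<in>\<P>. real_of_int (rounded_value W w Q) * indicator (interior Q) x)"

end

theory Submission
  imports Defs
begin

text \<open>If \<open>\<phi>\<close> is an admissible field for \<open>TV\<^sup>h\<close> with divergence \<open>g\<close>, and \<open>R\<close> is the rounded function, then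
  \<open>\<integral> R g = \<integral> w g + \<integral> (R - w) g\<close>. The first integral is at most \<open>TV(w)\<close>: since the normal component
  of \<open>\<phi>\<close> vanishes on the boundary facets, and sets of codimension two have zero capacity, \<open>\<phi>\<close> can be
  cut off near the boundary at a vanishing cost and then mollified, without increasing its sup norm.
  For the second one, \<open>g\<close> is constant on each cell and bounded by \<open>2d/h\<close>, because \<open>\<phi>\<close> is
  bounded by 1, while \<open>R - w\<close> has \<open>L\<^sup>1\<close> norm \<open>O(\<tau> TV(w))\<close> by a Poincare inequality on the cells of
  the input mesh. Hence \<open>TV\<^sup>h(R) \<le> (1 + C \<tau>/h) TV(w)\<close>.\<close>

subsection \<open>Calculus of \<open>C\<^sup>1\<close> functions and cutoffs\<close>

text \<open>Both variations are suprema over test fields, so each estimate has to end in an explicit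
  field that is \<open>C1\<close>, compactly supported in \<Omega> and bounded by 1 pointwise. A
  field of \<open>TVh\<close> misses this twice: its tangential components jump between cells, and
  only its normal component vanishes at the boundary. A domain made of cubes need not be
  star-shaped, so the field cannot simply be squeezed inward by a dilation; multiplying it by a
  cutoff works instead, at the price of the cutoff gradient. That price tends to zero only if two
  widths are decoupled: first a width \<open>e\<close> around the codimension-two skeleton, then,
  with \<open>e\<close> fixed, a much smaller width \<delta> at the facets. The Poincare inequality
  is dual as well: the sign of \<open>w\<close> minus its cell mean is, up to a constant and a small
  error, written as the divergence of a field of norm at most the dimension times the side length.
  Boundedness of \<open>w\<close>, which comes from finiteness of \<open>W\<close>, controls the
  cutoff error and allows dominated convergence. Only one derivative is ever taken, so profiles made
  from squared positive parts serve as cutoffs and mollifiers.\<close>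

definition C1 :: "('a::euclidean_space \<Rightarrow> 'b::real_normed_vector) \<Rightarrow> ('a \<Rightarrow> 'a \<Rightarrow> 'b) \<Rightarrow> bool" where
  "C1 f D \<longleftrightarrow> (\<forall>x. (f has_derivative D x) (at x)) \<and> (\<forall>v. continuous_on UNIV (\<lambda>x. D x v))"

lemma C1D:
  assumes "C1 f D"
  shows "(f has_derivative D x) (at x)" "continuous_on UNIV (\<lambda>x. D x v)" "bounded_linear (D x)"
    "continuous_on S f"
  using assms unfolding C1_def
  by (auto intro: has_derivative_bounded_linear has_derivative_continuous continuous_at_imp_continuous_on)

lemma C1_frechet: "C1 f D \<Longrightarrow> frechet_derivative f (at x) = D x"
  using frechet_derivative_at C1D(1) by metis

lemma C1_const: "C1 (\<lambda>x. c) (\<lambda>x v. 0)"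
  by (auto simp: C1_def)

lemma C1_add: "C1 f D \<Longrightarrow> C1 g E \<Longrightarrow> C1 (\<lambda>x. f x + g x) (\<lambda>x v. D x v + E x v)"
  unfolding C1_def by (auto intro!: derivative_intros continuous_intros)

lemma C1_diff: "C1 f D \<Longrightarrow> C1 g E \<Longrightarrow> C1 (\<lambda>x. f x - g x) (\<lambda>x v. D x v - E x v)"
  unfolding C1_def by (auto intro!: derivative_intros continuous_intros)

lemma C1_sum: "(\<And>i. i \<in> I \<Longrightarrow> C1 (f i) (D i)) \<Longrightarrow> C1 (\<lambda>x. \<Sum>i\<in>I. f i x) (\<lambda>x v. \<Sum>i\<in>I. D i x v)"
  unfolding C1_def by (auto intro!: derivative_intros continuous_intros)

lemma C1_mult:
  fixes f g :: "'a::euclidean_space \<Rightarrow> real"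
  assumes "C1 f D" "C1 g E"
  shows "C1 (\<lambda>x. f x * g x) (\<lambda>x v. f x * E x v + D x v * g x)"
  using assms C1D(4)[OF assms(1)] C1D(4)[OF assms(2)] unfolding C1_def
  by (auto intro!: derivative_intros continuous_intros)

lemma C1_scaleR_left: "C1 f D \<Longrightarrow> C1 (\<lambda>x. f x *\<^sub>R c) (\<lambda>x v. D x v *\<^sub>R c)"
  unfolding C1_def by (auto intro!: derivative_intros continuous_intros)

lemma C1_cmult:
  fixes f :: "'a::euclidean_space \<Rightarrow> real"
  shows "C1 f D \<Longrightarrow> C1 (\<lambda>x. c * f x) (\<lambda>x v. c * D x v)"
  unfolding C1_def by (auto intro!: derivative_intros continuous_intros)

lemma C1_prod:
  fixes f :: "'i \<Rightarrow> 'a::euclidean_space \<Rightarrow> real"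
  assumes "\<And>i. i \<in> I \<Longrightarrow> C1 (f i) (D i)"
  shows "C1 (\<lambda>x. \<Prod>i\<in>I. f i x) (\<lambda>x v. \<Sum>i\<in>I. D i x v * (\<Prod>j\<in>I - {i}. f j x))"
  unfolding C1_def
proof (intro conjI allI)
  fix x
  show "((\<lambda>x. \<Prod>i\<in>I. f i x) has_derivative (\<lambda>v. \<Sum>i\<in>I. D i x v * (\<Prod>j\<in>I - {i}. f j x))) (at x)"
    using assms by (intro has_derivative_prod) (auto simp: C1_def)
next
  fix v
  show "continuous_on UNIV (\<lambda>x. \<Sum>i\<in>I. D i x v * (\<Prod>j\<in>I - {i}. f j x))"
    using assms by (intro continuous_intros) (auto intro: C1D)
qed

lemma C1_comp_coord:
  fixes k :: "real \<Rightarrow> real"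
  assumes "\<And>t. (k has_real_derivative k' t) (at t)" "continuous_on UNIV k'"
  shows "C1 (\<lambda>x::real^'n. k (x $ i)) (\<lambda>x v. k' (x $ i) * v $ i)"
  unfolding C1_def
proof (intro conjI allI)
  fix x :: "real^'n"
  have "((\<lambda>x::real^'n. x $ i) has_derivative (\<lambda>v. v $ i)) (at x)"
    by (intro bounded_linear_imp_has_derivative bounded_linear_vec_nth)
  from has_derivative_compose[OF this, of k "(*) (k' (x $ i))"] assms(1)
  show "((\<lambda>x. k (x $ i)) has_derivative (\<lambda>v. k' (x $ i) * v $ i)) (at x)"
    by (auto simp: has_field_derivative_def)
next
  fix v :: "real^'n"
  show "continuous_on UNIV (\<lambda>x. k' (x $ i) * v $ i)"
    by (intro continuous_intros continuous_on_compose2[OF assms(2)]) auto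
qed

lemma C1_coord: "C1 (\<lambda>x::real^'n. x $ i) (\<lambda>x v. v $ i)"
  using C1_comp_coord[of "\<lambda>t. t" "\<lambda>t. 1"] by auto

text \<open>\<open>C1\<close> asks for continuity of each directional derivative only. In finite
  dimension this already gives continuity in operator norm, the form in which \<open>C1c\<close>
  wants the derivative.\<close>

lemma C1_blinfun:
  fixes f :: "'a::euclidean_space \<Rightarrow> 'b::real_normed_vector"
  assumes "C1 f D"
  shows "\<exists>f'. (\<forall>x. blinfun_apply (f' x) = D x) \<and> continuous_on UNIV f'"
proof (intro exI conjI allI)
  show *: "blinfun_apply (Blinfun (D x)) = D x" for x
    using C1D(3)[OF assms] by (rule bounded_linear_Blinfun_apply)
  show "continuous_on UNIV (\<lambda>x. Blinfun (D x))"
    using C1D(2)[OF assms] * by (intro continuous_on_blinfun_componentwise) auto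
qed

lemma C1_imp_C1c:
  fixes f :: "real^'n \<Rightarrow> 'b::euclidean_space"
  assumes "C1 f D" "compact K" "K \<subseteq> \<Omega>" "\<And>x. x \<notin> K \<Longrightarrow> f x = 0"
  shows "f \<in> C1c \<Omega>"
proof -
  obtain f' where f': "\<And>x. blinfun_apply (f' x) = D x" "continuous_on UNIV f'"
    using C1_blinfun[OF assms(1)] by auto
  have cl: "closure {x. f x \<noteq> 0} \<subseteq> K"
    using assms(2,4) by (intro closure_minimal) (auto intro: compact_imp_closed)
  then have co: "compact (closure {x. f x \<noteq> 0})"
    using assms(2) by (meson bounded_subset closed_closure compact_eq_bounded_closed)
  have "\<exists>f' :: real^'n \<Rightarrow> (real^'n) \<Rightarrow>\<^sub>L 'b.
        (\<forall>x. (f has_derivative blinfun_apply (f' x)) (at x)) \<and> continuous_on UNIV f'"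
    using C1D(1)[OF assms(1)] f' by (intro exI[of _ f']) simp
  with cl co assms(3) show ?thesis unfolding C1c_def by blast
qed

lemma C1c_imp_C1:
  assumes "f \<in> C1c \<Omega>"
  shows "C1 f (\<lambda>x. frechet_derivative f (at x))"
proof -
  from assms obtain f' where f': "\<And>x. (f has_derivative blinfun_apply (f' x)) (at x)" "continuous_on UNIV f'"
    unfolding C1c_def by blast
  have c: "C1 f (\<lambda>x. blinfun_apply (f' x))"
    unfolding C1_def using f' by (auto intro!: continuous_intros)
  then show ?thesis using C1_frechet[OF c] by simp
qed

text \<open>Differentiation under the integral sign. Averages along coordinate lines and
  mollifications are both of this kind; the compact box of integration makes the Leibniz rule
  applicable without a dominating function.\<close>

lemma C1_param:
  fixes f :: "'a::euclidean_space \<Rightarrow> 'b::euclidean_space \<Rightarrow> real"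
  assumes d: "\<And>x t. ((\<lambda>x. f x t) has_derivative D x t) (at x)"
    and D: "\<And>v. continuous_on (UNIV \<times> cbox a b) (\<lambda>(x,t). D x t v)"
    and f: "\<And>x. continuous_on (cbox a b) (f x)"
  shows "C1 (\<lambda>x. integral (cbox a b) (f x)) (\<lambda>x v. integral (cbox a b) (\<lambda>t. D x t v))"
proof -
  define fx where "fx x t = Blinfun (D x t)" for x t
  have fx: "blinfun_apply (fx x t) = D x t" for x t
    unfolding fx_def using d has_derivative_bounded_linear by (blast intro: bounded_linear_Blinfun_apply)
  have cfx: "continuous_on (UNIV \<times> cbox a b) (\<lambda>(x,t). fx x t)"
    using D by (intro continuous_on_blinfun_componentwise) (simp add: split_beta fx)
  have ifx: "fx x integrable_on cbox a b" for x
  proof (rule integrable_continuous)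
    have "continuous_on (cbox a b) (\<lambda>t. (\<lambda>(x,t). fx x t) (x, t))"
      by (rule continuous_on_compose2[OF cfx]) (auto intro!: continuous_intros)
    then show "continuous_on (cbox a b) (fx x)" by simp
  qed
  have ev: "blinfun_apply (integral (cbox a b) (fx x)) v = integral (cbox a b) (\<lambda>t. D x t v)" for x v
    using integral_linear[OF ifx, of "\<lambda>h. blinfun_apply h v"]
    by (auto simp: o_def fx bounded_linear_intros intro: blinfun.bounded_linear_left)
  have der: "((\<lambda>x. integral (cbox a b) (f x)) has_derivative integral (cbox a b) (fx x)) (at x)" for x
    using leibniz_rule[of UNIV a b f fx x] d f cfx by (auto simp: fx intro: integrable_continuous)
  show ?thesis
    unfolding C1_def
  proof (intro conjI allI)
    fix x
    show "((\<lambda>x. integral (cbox a b) (f x)) has_derivative (\<lambda>v. integral (cbox a b) (\<lambda>t. D x t v))) (at x)"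
      using der[of x] by (simp add: ev[symmetric])
  next
    fix v
    show "continuous_on UNIV (\<lambda>x. integral (cbox a b) (\<lambda>t. D x t v))"
      by (rule integral_continuous_on_param) (rule D)
  qed
qed

section \<open>Cutoff functions of one variable\<close>

definition posq :: "real \<Rightarrow> real" where "posq t = (max 0 t)\<^sup>2"

lemma posq_deriv: "(posq has_real_derivative 2 * max 0 t) (at t)"
proof (cases "t = 0")
  case True
  have "((\<lambda>h. posq h / h) \<longlongrightarrow> 0) (at 0)"
  proof (rule Lim_null_comparison)
    show "((\<lambda>h. \<bar>h\<bar>) \<longlongrightarrow> 0) (at (0::real))"
      by (auto intro!: tendsto_eq_intros)
    show "\<forall>\<^sub>F h in at 0. norm (posq h / h) \<le> \<bar>h\<bar>"
      by (auto simp: eventually_at_filter posq_def power2_eq_square max_def)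
  qed
  then show ?thesis using True by (simp add: DERIV_def posq_def)
next
  case False
  show ?thesis
  proof (cases "t > 0")
    case True
    have "((\<lambda>t. t\<^sup>2) has_real_derivative 2 * t) (at t)"
      by (auto intro!: derivative_eq_intros)
    moreover have "\<forall>\<^sub>F s in nhds t. s\<^sup>2 = posq s"
      using eventually_nhds_in_open[of "{0<..}" t] True by (auto elim!: eventually_mono simp: posq_def)
    ultimately show ?thesis using True
      by (subst DERIV_cong_ev[OF refl _ refl, of _ "\<lambda>t. t\<^sup>2"]) (auto elim: eventually_mono)
  next
    case f: False
    with False have n: "t < 0" by simp
    have "((\<lambda>t. 0) has_real_derivative 0) (at t)" by simp
    moreover have "\<forall>\<^sub>F s in nhds t. posq s = 0"
      using eventually_nhds_in_open[of "{..<0}" t] n by (auto elim!: eventually_mono simp: posq_def)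
    ultimately show ?thesis using n
      by (subst DERIV_cong_ev[OF refl _ refl, of _ "\<lambda>t. 0"]) auto
  qed
qed

text \<open>The quadratic spline with knots 0, 1/2 and 1: \<open>2 * t^2\<close> up to 1/2, then
  \<open>1 - 2 * (1 - t)^2\<close>. Its derivative is the tent of height 2.\<close>

definition smoothstep :: "real \<Rightarrow> real" where
  "smoothstep t = 2 * posq t - 4 * posq (t - 1/2) + 2 * posq (t - 1)"

definition smoothstep' :: "real \<Rightarrow> real" where
  "smoothstep' t = 4 * max 0 t - 8 * max 0 (t - 1/2) + 4 * max 0 (t - 1)"

lemma smoothstep_deriv: "(smoothstep has_real_derivative smoothstep' t) (at t)"
  unfolding smoothstep_def [abs_def] smoothstep'_def
  by (rule derivative_eq_intros DERIV_chain'[OF _ posq_deriv] refl | simp)+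

lemma smoothstep:
  "0 \<le> smoothstep t" "smoothstep t \<le> 1" "t \<le> 0 \<Longrightarrow> smoothstep t = 0" "t \<ge> 1 \<Longrightarrow> smoothstep t = 1"
  "t \<le> 0 \<Longrightarrow> smoothstep' t = 0" "t \<ge> 1 \<Longrightarrow> smoothstep' t = 0" "\<bar>smoothstep' t\<bar> \<le> 2"
proof -
  consider "t \<le> 0" | "0 \<le> t" "t \<le> 1/2" | "1/2 \<le> t" "t \<le> 1" | "t \<ge> 1" by linarith
  then have "0 \<le> smoothstep t \<and> smoothstep t \<le> 1"
  proof cases
    case 2
    then have "smoothstep t = 2 * t\<^sup>2" by (simp add: smoothstep_def posq_def)
    moreover have "t\<^sup>2 \<le> (1/2)\<^sup>2" using 2 by (intro power_mono) auto
    ultimately show ?thesis by (simp add: power2_eq_square)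
  next
    case 3
    then have "smoothstep t = 1 - 2 * (1 - t)\<^sup>2"
      by (simp add: smoothstep_def posq_def power2_eq_square algebra_simps)
    moreover have "(1 - t)\<^sup>2 \<le> (1/2)\<^sup>2" using 3 by (intro power_mono) auto
    ultimately show ?thesis by (simp add: power2_eq_square)
  qed (auto simp: smoothstep_def posq_def power2_eq_square algebra_simps)
  then show "0 \<le> smoothstep t" "smoothstep t \<le> 1" by auto
  show "t \<le> 0 \<Longrightarrow> smoothstep t = 0" "t \<le> 0 \<Longrightarrow> smoothstep' t = 0"
    by (auto simp: smoothstep_def smoothstep'_def posq_def)
  show "smoothstep t = 1" if "t \<ge> 1"
    using that by (simp add: smoothstep_def posq_def power2_eq_square algebra_simps)
  show "smoothstep' t = 0" if "t \<ge> 1"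
    using that by (simp add: smoothstep'_def)
  show "\<bar>smoothstep' t\<bar> \<le> 2"
    unfolding smoothstep'_def max_def by (simp split: if_splits)
qed

lemma smoothstep'_cont: "continuous_on S smoothstep'"
  unfolding smoothstep'_def[abs_def] by (intro continuous_intros)

text \<open>\<open>bump a b e\<close> vanishes outside \<open>[a + e, b - e]\<close> and equals 1 on \<open>[a + 2e, b - 2e]\<close>.\<close>

definition bump :: "real \<Rightarrow> real \<Rightarrow> real \<Rightarrow> real \<Rightarrow> real" where
  "bump a b e t = smoothstep ((t - a) / e - 1) * smoothstep ((b - t) / e - 1)"

definition bump' :: "real \<Rightarrow> real \<Rightarrow> real \<Rightarrow> real \<Rightarrow> real" where
  "bump' a b e t = (smoothstep' ((t - a) / e - 1) * smoothstep ((b - t) / e - 1)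
     - smoothstep ((t - a) / e - 1) * smoothstep' ((b - t) / e - 1)) / e"

lemma bump_deriv: "(bump a b e has_real_derivative bump' a b e t) (at t)"
proof -
  have 1: "((\<lambda>t. smoothstep ((t - a) / e - 1)) has_real_derivative smoothstep' ((t - a) / e - 1) * (1 / e)) (at t)"
    by (rule DERIV_chain2[OF smoothstep_deriv]) (auto intro!: derivative_eq_intros simp: divide_inverse)
  have 2: "((\<lambda>t. smoothstep ((b - t) / e - 1)) has_real_derivative smoothstep' ((b - t) / e - 1) * (- 1 / e)) (at t)"
    by (rule DERIV_chain2[OF smoothstep_deriv]) (auto intro!: derivative_eq_intros simp: divide_inverse)
  show ?thesis
    using DERIV_mult[OF 1 2] unfolding bump_def[abs_def] bump'_def
    by (simp add: diff_divide_distrib mult.commute)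
qed

lemma bump'_cont: "continuous_on S (bump' a b e)"
  unfolding bump'_def[abs_def] divide_inverse
  by (intro continuous_intros continuous_on_compose2[OF smoothstep'_cont]
      continuous_on_compose2[OF continuous_at_imp_continuous_on, of UNIV smoothstep])
    (auto intro: DERIV_isCont smoothstep_deriv)

lemma bump_bounds: "0 \<le> bump a b e t" "bump a b e t \<le> 1"
  using smoothstep(1,2) by (auto simp: bump_def intro!: mult_le_one)

lemma bump_zero:
  assumes "e > 0" "t \<le> a + e \<or> t \<ge> b - e"
  shows "bump a b e t = 0" "bump' a b e t = 0"
  using assms by (auto simp: bump_def bump'_def smoothstep(3,5) field_simps)

lemma bump_one:
  assumes "e > 0" "a + 2 * e \<le> t" "t \<le> b - 2 * e"
  shows "bump a b e t = 1" "bump' a b e t = 0"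
  using assms by (auto simp: bump_def bump'_def smoothstep(4,6) field_simps)

text \<open>The two flanks are not assumed to be disjoint, so both slopes, at most 2 each before the
  division by \<open>e\<close>, are added.\<close>

lemma bump'_bound: assumes "e > 0" shows "\<bar>bump' a b e t\<bar> \<le> 4 / e"
proof -
  have "\<bar>smoothstep' u * smoothstep v\<bar> \<le> 2 * 1" for u v
    unfolding abs_mult using smoothstep(1,2)[of v] smoothstep(7)[of u] by (intro mult_mono) auto
  note b = this[of "(t - a) / e - 1" "(b - t) / e - 1"] this[of "(b - t) / e - 1" "(t - a) / e - 1"]
  have "\<bar>smoothstep' ((t - a) / e - 1) * smoothstep ((b - t) / e - 1)
     - smoothstep ((t - a) / e - 1) * smoothstep' ((b - t) / e - 1)\<bar> \<le> 4"
    using b by (simp only: mult.commute[of "smoothstep ((t - a) / e - 1)"])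
  from divide_right_mono[OF this, of e] show ?thesis using assms unfolding bump'_def abs_divide
    by simp
qed

lemma C1_bump: "C1 (\<lambda>x::real^'n. bump a b e (x $ i)) (\<lambda>x v. bump' a b e (x $ i) * v $ i)"
  by (intro C1_comp_coord bump_deriv bump'_cont)

subsection \<open>Integrals of derivatives and density of test functions\<close>

lemma integrable_lebesgue_bounded_support:
  fixes f :: "'a::euclidean_space \<Rightarrow> real"
  assumes "f \<in> borel_measurable lebesgue" "bounded K" "\<And>x. x \<notin> K \<Longrightarrow> f x = 0" "\<And>x. x \<in> K \<Longrightarrow> \<bar>f x\<bar> \<le> B"
  shows "integrable lebesgue f"
proof -
  obtain c where c: "K \<subseteq> cbox (-c) c" using bounded_subset_cbox_symmetric[OF assms(2)] by blast
  have "integrable lebesgue (\<lambda>x. \<bar>B\<bar> * indicator (cbox (-c) c) x)"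
    by (intro integrable_mult_right integrable_real_indicator) (use emeasure_bounded_finite[of "cbox (-c) c"] in auto)
  then show ?thesis
  proof (rule Bochner_Integration.integrable_bound)
    show "AE x in lebesgue. norm (f x) \<le> norm (\<bar>B\<bar> * indicator (cbox (- c) c) x)"
    proof (rule AE_I2)
      fix x :: 'a
      show "norm (f x) \<le> norm (\<bar>B\<bar> * indicator (cbox (- c) c) x)"
        using assms(3,4)[of x] c by (cases "x \<in> K") (auto simp: indicator_def subset_iff)
    qed
  qed fact
qed

lemma continuous_imp_measurable_lebesgue:
  fixes f :: "'a::euclidean_space \<Rightarrow> 'b::{real_normed_vector,second_countable_topology}"
  shows "continuous_on UNIV f \<Longrightarrow> f \<in> borel_measurable lebesgue"
  by (intro measurable_completion) (simp add: borel_measurable_continuous_onI)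

lemma lebesgue_integral_shift:
  fixes f :: "'a::euclidean_space \<Rightarrow> real"
  assumes "continuous_on UNIV f"
  shows "(LINT x|lebesgue. f (x + c)) = (LINT x|lebesgue. f x)"
proof -
  have m: "f \<in> borel_measurable borel" using assms by (rule borel_measurable_continuous_onI)
  have "(LINT x|lborel. f x) = (LINT x|distr lborel borel ((+) c). f x)"
    by (simp add: lborel_distr_plus)
  also have "\<dots> = (LINT x|lborel. f (c + x))"
    by (rule integral_distr) (use m in auto)
  finally show ?thesis
    using m by (simp add: integral_completion add.commute)
qed

definition ep :: "nat \<Rightarrow> real" where "ep n = 1 / real (n + 1)"

lemma ep: "0 < ep n" "ep n \<le> 1" "ep \<longlonglongrightarrow> 0"
  using LIMSEQ_Suc[OF lim_1_over_n] by (auto simp: ep_def[abs_def])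

lemma C1_has_real_derivative_line:
  assumes "C1 f D"
  shows "((\<lambda>t. f (x + t *\<^sub>R v)) has_real_derivative D (x + t *\<^sub>R v) v) (at t)"
proof -
  have "((\<lambda>t. x + t *\<^sub>R v) has_derivative (\<lambda>t. t *\<^sub>R v)) (at t)"
    by (auto intro!: derivative_eq_intros)
  from has_derivative_compose[OF this C1D(1)[OF assms]]
  show ?thesis unfolding has_field_derivative_def
    using linear_simps(5)[OF C1D(3)[OF assms]] by (simp add: mult.commute[of _ "D _ v"] mult_commute_abs)
qed

text \<open>Difference quotients along \<open>v\<close> have integral zero by translation invariance
  of Lebesgue measure, and dominated convergence passes to the derivative. This is the divergence
  theorem for compact support, obtained without Fubini.\<close>

lemma integral_directional_derivative_eq_0:
  fixes F :: "'a::euclidean_space \<Rightarrow> real"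
  assumes F: "C1 F D" and K: "compact K" "\<And>x. x \<notin> K \<Longrightarrow> F x = 0"
  shows "integrable lebesgue (\<lambda>x. D x v)" "(LINT x|lebesgue. D x v) = 0"
proof -
  obtain R where R: "K \<subseteq> cball 0 R" using compact_imp_bounded[OF K(1)] by (auto simp: bounded_iff subset_iff)
  \<comment> \<open>Step lengths are at most 1, so all difference quotients vanish outside this
    ball. The mean value point is at most another \<open>norm v\<close> away, hence the radius
    \<open>R + 2 * norm v\<close> for the bound \<open>B\<close>.\<close>
  define S where "S = cball (0::'a) (R + norm v)"
  have "compact (cball (0::'a) (R + 2 * norm v))" by simp
  then have "bounded ((\<lambda>x. D x v) ` cball 0 (R + 2 * norm v))"
    using C1D(2)[OF F, of v] by (intro compact_imp_bounded compact_continuous_image) (auto intro: continuous_on_subset)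
  then obtain B where B: "\<And>y. norm y \<le> R + 2 * norm v \<Longrightarrow> \<bar>D y v\<bar> \<le> B"
    unfolding bounded_iff by (metis imageI mem_cball_0 real_norm_def)
  define s where "s = ep"
  have s: "0 < s n" "s n \<le> 1" for n by (auto simp: s_def ep)
  define d where "d n x = (F (x + s n *\<^sub>R v) - F x) / s n" for n x
  have cF: "continuous_on UNIV F" using C1D(4)[OF F] by simp
  have cd: "continuous_on UNIV (d n)" for n
    unfolding d_def divide_inverse by (intro continuous_intros continuous_on_compose2[OF cF]) auto
  have md: "d n \<in> borel_measurable lebesgue" for n by (rule continuous_imp_measurable_lebesgue[OF cd])
  have mD: "(\<lambda>x. D x v) \<in> borel_measurable lebesgue" by (rule continuous_imp_measurable_lebesgue[OF C1D(2)[OF F]])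
  have bd: "norm (d n x) \<le> B * indicator S x" for n x
  proof (cases "x \<in> S")
    case True
    then have x: "norm x \<le> R + norm v" by (simp add: S_def)
    obtain t where t: "0 < t" "t < s n" "F (x + s n *\<^sub>R v) - F (x + 0 *\<^sub>R v) = (s n - 0) * D (x + t *\<^sub>R v) v"
      using MVT2[of 0 "s n" "\<lambda>t. F (x + t *\<^sub>R v)" "\<lambda>t. D (x + t *\<^sub>R v) v"] s(1)
        C1_has_real_derivative_line[OF F] by blast
    have "norm (x + t *\<^sub>R v) \<le> norm x + \<bar>t\<bar> * norm v" using norm_triangle_ineq[of x "t *\<^sub>R v"] by simp
    also have "\<dots> \<le> R + norm v + 1 * norm v"
      using x t s[of n] by (intro add_mono mult_right_mono) auto
    finally have "\<bar>D (x + t *\<^sub>R v) v\<bar> \<le> B" by (intro B) auto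
    then show ?thesis using t(3) s(1)[of n] True by (simp add: d_def)
  next
    case False
    then have x: "norm x > R + norm v" by (simp add: S_def)
    have "norm (x + s n *\<^sub>R v) > R"
    proof -
      have "norm x \<le> norm (x + s n *\<^sub>R v) + norm (s n *\<^sub>R v)" using norm_triangle_ineq4[of "x + s n *\<^sub>R v" "s n *\<^sub>R v"] by simp
      moreover have "norm (s n *\<^sub>R v) \<le> norm v" using s[of n] by (simp add: mult_left_le_one_le)
      ultimately show ?thesis using x by linarith
    qed
    moreover have "norm x > R" using x norm_ge_zero[of v] by linarith
    ultimately have "x \<notin> K" "x + s n *\<^sub>R v \<notin> K" using R by (auto simp: subset_iff)
    then show ?thesis using K(2) False by (simp add: d_def)
  qed
  have iS: "integrable lebesgue (\<lambda>x. B * indicator S x)"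
    unfolding S_def by (intro integrable_mult_right integrable_real_indicator)
      (use emeasure_bounded_finite[of "cball 0 (R + norm v)"] in auto)
  have lim: "(\<lambda>n. d n x) \<longlonglongrightarrow> D x v" for x
  proof -
    have "((\<lambda>h. (F (x + (0 + h) *\<^sub>R v) - F (x + 0 *\<^sub>R v)) / h) \<longlongrightarrow> D (x + 0 *\<^sub>R v) v) (at 0)"
      using C1_has_real_derivative_line[OF F, of x v 0] unfolding DERIV_def .
    moreover have "filterlim s (at 0) sequentially"
      unfolding filterlim_at using s(1) ep(3)
      by (auto simp: s_def ep less_imp_neq[OF ep(1), symmetric] intro!: always_eventually)
    ultimately show ?thesis
      unfolding d_def by (auto dest: filterlim_compose)
  qed
  have iD: "integrable lebesgue (\<lambda>x. D x v)"
    by (rule integrable_dominated_convergence[OF mD md iS AE_I2 AE_I2]) (use bd lim in auto)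
  have l: "(\<lambda>n. LINT x|lebesgue. d n x) \<longlonglongrightarrow> (LINT x|lebesgue. D x v)"
    by (rule integral_dominated_convergence[OF mD md iS AE_I2 AE_I2]) (use bd lim in auto)
  have iF: "integrable lebesgue F"
  proof -
    have "bounded (F ` K)" using cF K(1) by (intro compact_imp_bounded compact_continuous_image) (auto intro: continuous_on_subset)
    then obtain b where "\<And>x. x \<in> K \<Longrightarrow> \<bar>F x\<bar> \<le> b" by (auto simp: bounded_iff)
    then show ?thesis
      using K(2) compact_imp_bounded[OF K(1)]
      by (intro integrable_lebesgue_bounded_support[OF continuous_imp_measurable_lebesgue[OF cF], of K b]) auto
  qed
  have iF': "integrable lebesgue (\<lambda>x. F (x + c))" for c
  proof -
    have cF': "continuous_on UNIV (\<lambda>x. F (x + c))" by (intro continuous_on_compose2[OF cF] continuous_intros) auto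
    have "bounded (F ` K)" using cF K(1) by (intro compact_imp_bounded compact_continuous_image) (auto intro: continuous_on_subset)
    then obtain b where "\<And>x. x \<in> K \<Longrightarrow> \<bar>F x\<bar> \<le> b" by (auto simp: bounded_iff)
    moreover have "bounded ((\<lambda>x. x - c) ` K)" using compact_imp_bounded[OF K(1)] bounded_translation_minus by blast
    ultimately show ?thesis
    proof (intro integrable_lebesgue_bounded_support[OF continuous_imp_measurable_lebesgue[OF cF'], of "(\<lambda>x. x - c) ` K" b])
      show "F (x + c) = 0" if "x \<notin> (\<lambda>x. x - c) ` K" for x
        using that K(2)[of "x + c"] by (metis add_diff_cancel_right' imageI)
    qed auto
  qed
  have "(LINT x|lebesgue. d n x) = 0" for n
    unfolding d_def using iF iF' lebesgue_integral_shift[OF cF, of "s n *\<^sub>R v"] by simp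
  then show "(LINT x|lebesgue. D x v) = 0" using l by (simp add: LIMSEQ_const_iff)
  show "integrable lebesgue (\<lambda>x. D x v)" by fact
qed

section \<open>Polynomial approximation and the fundamental lemma of the calculus of
  variations\<close>

lemma real_polynomial_function_C1:
  fixes p :: "'a::euclidean_space \<Rightarrow> real"
  assumes "real_polynomial_function p"
  shows "\<exists>D. C1 p D"
  using assms
proof (induction p rule: real_polynomial_function.induct)
  case (linear f)
  then have "C1 f (\<lambda>x. f)" by (auto simp: C1_def intro: bounded_linear_imp_has_derivative)
  then show ?case by blast
qed (blast intro: C1_const C1_add C1_mult)+

text \<open>A measurable function is an almost everywhere limit of continuous ones; these are
  clipped to \<open>[-1, 1]\<close> and replaced by polynomials through Stone-Weierstrass. The
  purpose is to approximate sign functions by \<open>C1\<close> functions that obey the same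
  bound.\<close>

lemma AE_approx_polynomial:
  fixes s :: "'a::euclidean_space \<Rightarrow> real"
  assumes s: "s \<in> borel_measurable lebesgue" "\<And>x. \<bar>s x\<bar> \<le> 1" and K: "compact K"
  obtains q where "\<And>n::nat. real_polynomial_function (q n)" "\<And>n x. x \<in> K \<Longrightarrow> \<bar>q n x\<bar> \<le> 1"
    "AE x in lebesgue. x \<in> K \<longrightarrow> (\<lambda>n. q n x) \<longlonglongrightarrow> s x"
proof -
  have "s measurable_on UNIV" using s(1) by (rule lebesgue_measurable_imp_measurable_on) auto
  then obtain N g where N: "negligible N" and g: "\<And>n. continuous_on UNIV (g n)"
    and lim: "\<And>x. x \<notin> N \<Longrightarrow> (\<lambda>n. g n x) \<longlonglongrightarrow> s x"
    unfolding measurable_on_def by auto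
  define e where "e = ep"
  have e: "0 < e n" "e n \<le> 1" for n by (auto simp: e_def ep)
  have le: "e \<longlonglongrightarrow> 0" unfolding e_def by (rule ep)
  \<comment> \<open>The factor \<open>1 - e n\<close> leaves room for the Stone-Weierstrass error
    \<open>e n\<close>, so that the polynomials still respect the bound 1.\<close>
  define h where "h n x = (1 - e n) * max (-1) (min 1 (g n x))" for n x
  have hc: "continuous_on K (h n)" for n
    unfolding h_def using g[of n] by (intro continuous_intros) (auto intro: continuous_on_subset)
  have "\<exists>q. real_polynomial_function q \<and> (\<forall>x\<in>K. \<bar>h n x - q x\<bar> < e n)" for n
    by (rule Stone_Weierstrass_real_polynomial_function[OF K hc e(1), of n n]) blast
  then obtain q where q: "\<And>n. real_polynomial_function (q n)" "\<And>n x. x \<in> K \<Longrightarrow> \<bar>h n x - q n x\<bar> < e n"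
    unfolding choice_iff[symmetric] by metis
  show ?thesis
  proof
    show "real_polynomial_function (q n)" for n by fact
    show "\<bar>q n x\<bar> \<le> 1" if "x \<in> K" for n x
    proof -
      have "\<bar>h n x\<bar> \<le> (1 - e n) * 1" unfolding h_def abs_mult using e(2)[of n]
        by (intro mult_mono) auto
      then show ?thesis using q(2)[OF that, of n] by (simp add: abs_le_iff abs_less_iff)
    qed
    show "AE x in lebesgue. x \<in> K \<longrightarrow> (\<lambda>n. q n x) \<longlonglongrightarrow> s x"
    proof (rule AE_I'[of N])
      show "N \<in> null_sets lebesgue" using N by (simp add: negligible_iff_null_sets)
      have "(\<lambda>n. q n x) \<longlonglongrightarrow> s x" if "x \<notin> N" "x \<in> K" for x
      proof -
        have "(\<lambda>n. h n x) \<longlonglongrightarrow> (1 - 0) * max (-1) (min 1 (s x))"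
          unfolding h_def using lim[OF that(1)] le by (intro tendsto_intros)
        then have 1: "(\<lambda>n. h n x) \<longlonglongrightarrow> s x" using s(2)[of x] by (auto simp: max_def min_def abs_le_iff)
        have "(\<lambda>n. h n x - q n x) \<longlonglongrightarrow> 0"
          by (rule Lim_null_comparison[OF _ le]) (use q(2)[OF that(2)] in \<open>auto intro!: always_eventually less_imp_le\<close>)
        from tendsto_diff[OF 1 this] show ?thesis by simp
      qed
      then show "{x \<in> space lebesgue. \<not> (x \<in> K \<longrightarrow> (\<lambda>n. q n x) \<longlonglongrightarrow> s x)} \<subseteq> N" by auto
    qed
  qed
qed

definition boxcut :: "real^'n \<Rightarrow> real^'n \<Rightarrow> real \<Rightarrow> real^'n \<Rightarrow> real" where
  "boxcut a b e x = (\<Prod>i\<in>UNIV. bump (a $ i) (b $ i) e (x $ i))"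

definition boxcut' :: "real^'n \<Rightarrow> real^'n \<Rightarrow> real \<Rightarrow> real^'n \<Rightarrow> real^'n \<Rightarrow> real" where
  "boxcut' a b e x v = (\<Sum>i\<in>UNIV. bump' (a $ i) (b $ i) e (x $ i) * v $ i
      * (\<Prod>j\<in>UNIV - {i}. bump (a $ j) (b $ j) e (x $ j)))"

lemma C1_boxcut: "C1 (boxcut a b e) (boxcut' a b e)"
  unfolding boxcut_def[abs_def] boxcut'_def[abs_def] by (intro C1_prod C1_bump)

lemma boxcut_bounds: "0 \<le> boxcut a b e x" "boxcut a b e x \<le> 1"
  unfolding boxcut_def by (auto intro!: prod_nonneg prod_le_1 bump_bounds)

lemma boxcut_support:
  assumes "e > 0" "x \<notin> cbox (a + vec e) (b - vec e)"
  shows "boxcut a b e x = 0" "boxcut' a b e x v = 0"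
proof -
  obtain i where i: "x $ i < a $ i + e \<or> x $ i > b $ i - e"
    using assms(2) by (auto simp: mem_box_cart not_le)
  then have z: "bump (a $ i) (b $ i) e (x $ i) = 0" "bump' (a $ i) (b $ i) e (x $ i) = 0"
    using assms(1) by (auto intro!: bump_zero)
  then show "boxcut a b e x = 0" by (auto simp: boxcut_def intro!: prod_zero)
  show "boxcut' a b e x v = 0"
    unfolding boxcut'_def
  proof (rule sum.neutral, intro ballI)
    fix k
    show "bump' (a $ k) (b $ k) e (x $ k) * v $ k * (\<Prod>j\<in>UNIV - {k}. bump (a $ j) (b $ j) e (x $ j)) = 0"
      using z by (cases "k = i") (auto intro!: prod_zero)
  qed
qed

lemma boxcut_cbox_subset: "e > 0 \<Longrightarrow> cbox (a + vec e) (b - vec e) \<subseteq> box a (b::real^'n)"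
proof
  fix x :: "real^'n" assume "e > 0" "x \<in> cbox (a + vec e) (b - vec e)"
  then have "a $ i + e \<le> x $ i" "x $ i \<le> b $ i - e" for i by (simp_all add: mem_box_cart)
  with \<open>e > 0\<close> have "a $ i < x $ i \<and> x $ i < b $ i" for i
    by (meson add_strict_increasing2 diff_less_eq le_less_trans less_add_same_cancel1 less_le_trans)
  then show "x \<in> box a b" by (simp add: mem_box_cart)
qed

text \<open>Every point of the open box leaves the transition layer for good, so cut-off quantities
  eventually equal the uncut ones and pointwise convergence is immediate.\<close>

lemma boxcut_eventually:
  assumes "x \<in> box a b"
  shows "\<forall>\<^sub>F n in sequentially. boxcut a b (ep n) x = 1 \<and> (\<forall>v. boxcut' a b (ep n) x v = 0)"
proof -
  have "\<forall>\<^sub>F n in sequentially. \<forall>i\<in>UNIV. 2 * (ep n) \<le> min (x $ i - a $ i) (b $ i - x $ i)"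
  proof (rule eventually_ball_finite)
    show "\<forall>i\<in>UNIV. \<forall>\<^sub>F n in sequentially. 2 * (ep n) \<le> min (x $ i - a $ i) (b $ i - x $ i)"
    proof
      fix i
      have "(\<lambda>n. 2 * (ep n)) \<longlonglongrightarrow> 2 * 0"
        using ep(3) by (intro tendsto_intros)
      moreover have "min (x $ i - a $ i) (b $ i - x $ i) > 2 * 0" using assms by (simp add: mem_box_cart)
      ultimately have "\<forall>\<^sub>F n in sequentially. 2 * (ep n) < min (x $ i - a $ i) (b $ i - x $ i)"
        by (rule order_tendstoD(2))
      then show "\<forall>\<^sub>F n in sequentially. 2 * (ep n) \<le> min (x $ i - a $ i) (b $ i - x $ i)"
        by (rule eventually_mono) (rule less_imp_le)
    qed
  qed simp
  then show ?thesis
  proof (rule eventually_mono)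
    fix n assume *: "\<forall>i\<in>UNIV. 2 * (ep n) \<le> min (x $ i - a $ i) (b $ i - x $ i)"
    have b: "bump (a $ i) (b $ i) (ep n) (x $ i) = 1" "bump' (a $ i) (b $ i) (ep n) (x $ i) = 0" for i
      using bspec[OF *, of i] by (auto intro!: bump_one simp: ep)
    then show "boxcut a b (ep n) x = 1 \<and> (\<forall>v. boxcut' a b (ep n) x v = 0)"
      unfolding boxcut_def boxcut'_def by simp
  qed
qed

lemma AE_box_of_cbox: "AE x in lebesgue. x \<in> cbox a b \<longrightarrow> x \<in> box a (b::'a::euclidean_space)"
proof (rule AE_I'[of "cbox a b - box a b"])
  show "cbox a b - box a b \<in> null_sets lebesgue"
    using negligible_frontier_interval[of a b] by (simp add: negligible_iff_null_sets)
qed auto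

text \<open>Testing against \<open>boxcut\<close> times bounded polynomials that tend to
  \<open>sgn u\<close> gives, in the limit, the integral of \<open>\<bar>u\<bar>\<close> over the
  box. This serves to identify the weak divergence of an RT0 field on a cell.\<close>

lemma AE_eq_0_if_orthogonal_C1c:
  fixes u :: "real^'n \<Rightarrow> real"
  assumes u: "integrable lebesgue u" and o: "\<And>\<psi>. \<psi> \<in> C1c (box a b) \<Longrightarrow> (LINT x|lebesgue. u x * \<psi> x) = 0"
  shows "AE x in lebesgue. x \<in> cbox a b \<longrightarrow> u x = 0"
proof -
  define s where "s x = sgn (u x)" for x
  have s: "s \<in> borel_measurable lebesgue" unfolding s_def using u by measurable
  have "\<bar>s x\<bar> \<le> 1" for x by (simp add: s_def sgn_if)
  from AE_approx_polynomial[OF s this compact_cbox[of a b]] obtain q where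
    q: "\<And>n. real_polynomial_function (q n)" "\<And>n x. x \<in> cbox a b \<Longrightarrow> \<bar>q n x\<bar> \<le> 1"
    and lq: "AE x in lebesgue. x \<in> cbox a b \<longrightarrow> (\<lambda>n. q n x) \<longlonglongrightarrow> s x" by blast
  define \<psi> where "\<psi> n x = boxcut a b (ep n) x * q n x" for n x
  note e = ep(1)
  have \<psi>: "\<psi> n \<in> C1c (box a b)" for n
  proof -
    obtain D where D: "C1 (q n) D" using real_polynomial_function_C1[OF q(1)] by blast
    show ?thesis unfolding \<psi>_def
      by (rule C1_imp_C1c[OF C1_mult[OF C1_boxcut D] compact_cbox boxcut_cbox_subset[OF e[of n]]])
        (simp add: boxcut_support(1)[OF e])
  qed
  have b: "\<bar>\<psi> n x\<bar> \<le> 1" for n x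
  proof (cases "x \<in> cbox a b")
    case True
    then show ?thesis unfolding \<psi>_def abs_mult using boxcut_bounds[of a b _ x] q(2)[OF True, of n]
      by (intro mult_le_one) auto
  next
    case False
    have "x \<notin> cbox (a + vec (ep n)) (b - vec (ep n))"
      using boxcut_cbox_subset[OF e[of n], of a b] False box_subset_cbox[of a b] by blast
    then show ?thesis by (simp add: \<psi>_def boxcut_support(1)[OF e])
  qed
  have m: "\<psi> n \<in> borel_measurable lebesgue" for n
    using C1D(4)[OF C1c_imp_C1[OF \<psi>]] by (rule continuous_imp_measurable_lebesgue)
  have "(\<lambda>n. LINT x|lebesgue. u x * \<psi> n x) \<longlonglongrightarrow> (LINT x|lebesgue. \<bar>u x\<bar> * indicator (cbox a b) x)"
  proof (rule integral_dominated_convergence[where w="\<lambda>x. \<bar>u x\<bar>"])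
    show "AE x in lebesgue. (\<lambda>n. u x * \<psi> n x) \<longlonglongrightarrow> \<bar>u x\<bar> * indicator (cbox a b) x"
      using lq AE_box_of_cbox[of a b]
    proof eventually_elim
      case (elim x)
      show ?case
      proof (cases "x \<in> cbox a b")
        case True
        then have "(\<lambda>n. boxcut a b (ep n) x) \<longlonglongrightarrow> 1"
          using elim(2) boxcut_eventually[of x a b] by (intro tendsto_eventually) (auto elim: eventually_mono)
        then have "(\<lambda>n. u x * \<psi> n x) \<longlonglongrightarrow> u x * (1 * s x)"
          unfolding \<psi>_def using elim(1) True by (intro tendsto_intros) auto
        then show ?thesis using True by (simp add: s_def abs_sgn mult.commute)
      next
        case False
        have "x \<notin> cbox (a + vec (ep n)) (b - vec (ep n))" for n
          using boxcut_cbox_subset[OF e[of n], of a b] False box_subset_cbox[of a b] by blast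
        then have "\<psi> n x = 0" for n by (simp add: \<psi>_def boxcut_support(1)[OF e])
        with False show ?thesis by simp
      qed
    qed
    show "AE x in lebesgue. norm (u x * \<psi> n x) \<le> \<bar>u x\<bar>" for n
      using b by (intro AE_I2) (simp add: abs_mult mult_left_le)
    show "(\<lambda>x. \<bar>u x\<bar> * indicator (cbox a b) x) \<in> borel_measurable lebesgue"
      using u by (intro borel_measurable_times borel_measurable_indicator) auto
    show "(\<lambda>x. u x * \<psi> n x) \<in> borel_measurable lebesgue" for n using u m by measurable
    show "integrable lebesgue (\<lambda>x. \<bar>u x\<bar>)" using u by simp
  qed
  then have "(LINT x|lebesgue. \<bar>u x\<bar> * indicator (cbox a b) x) = 0"
    using o[OF \<psi>] by (simp add: LIMSEQ_const_iff)
  moreover have "integrable lebesgue (\<lambda>x. \<bar>u x\<bar> * indicator (cbox a b) x)"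
    using u by (intro integrable_real_mult_indicator) auto
  ultimately have "AE x in lebesgue. \<bar>u x\<bar> * indicator (cbox a b) x = 0"
    by (subst (asm) integral_nonneg_eq_0_iff_AE) auto
  then show ?thesis by (auto elim!: eventually_mono simp: indicator_def)
qed

subsection \<open>A dual Poincare inequality on cubes\<close>

lemma C1_vec:
  fixes g :: "'n::finite \<Rightarrow> 'a::euclidean_space \<Rightarrow> real"
  assumes "\<And>k. C1 (g k) (D k)"
  shows "C1 (\<lambda>x. \<chi> k. g k x) (\<lambda>x v. \<chi> k. D k x v)"
proof -
  have *: "(\<Sum>k\<in>UNIV. h k *\<^sub>R axis k 1) = (\<chi> k. h k)" for h :: "'n \<Rightarrow> real"
    by (subst (2) basis_expansion[symmetric]) (simp add: scalar_mult_eq_scaleR)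
  have "C1 (\<lambda>x. \<Sum>k\<in>UNIV. g k x *\<^sub>R (axis k 1 :: real^'n)) (\<lambda>x v. \<Sum>k\<in>UNIV. D k x v *\<^sub>R axis k 1)"
    by (intro C1_sum C1_scaleR_left assms)
  then show ?thesis unfolding * .
qed

lemma divergence_C1: "C1 \<phi> D \<Longrightarrow> divergence \<phi> x = (\<Sum>i\<in>UNIV. D x (axis i 1) $ i)"
  by (simp add: divergence_def C1_frechet)

lemma divergence_vec:
  assumes "\<And>k. C1 (g k) (D k)"
  shows "divergence (\<lambda>x. \<chi> k. g k x) x = (\<Sum>k\<in>UNIV. D k x (axis k 1))"
  by (simp add: divergence_C1[OF C1_vec[OF assms]])

section \<open>Averages along coordinate lines\<close>

definition upd :: "real^'n \<Rightarrow> 'n \<Rightarrow> real \<Rightarrow> real^'n" where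
  "upd x k t = (\<chi> j. if j = k then t else x $ j)"

lemma upd_nth [simp]: "upd x k t $ j = (if j = k then t else x $ j)"
  by (simp add: upd_def)

lemma upd_upd [simp]: "upd (upd x k s) k t = upd x k t"
  by (simp add: vec_eq_iff)

lemma upd_commute: "j \<noteq> k \<Longrightarrow> upd (upd x j s) k t = upd (upd x k t) j s"
  by (auto simp: vec_eq_iff)

lemma upd_same [simp]: "upd x k (x $ k) = x"
  by (auto simp: vec_eq_iff)

lemma upd_eq: "upd x k t = x + (t - x $ k) *\<^sub>R axis k 1"
  by (auto simp: vec_eq_iff axis_def)

lemma bounded_linear_upd: "bounded_linear (\<lambda>v. upd v k (c * v $ k))"
  unfolding upd_eq by (intro bounded_linear_intros bounded_linear_vec_nth)

lemma upd_affine_has_derivative: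
  "((\<lambda>x. upd x k (a + c * x $ k)) has_derivative (\<lambda>v. upd v k (c * v $ k))) (at x)"
proof -
  have "upd x k (a + c * x $ k) = upd x k (c * x $ k) + a *\<^sub>R axis k 1" for x
    by (auto simp: vec_eq_iff axis_def)
  then have "((\<lambda>x. upd x k (a + c * x $ k)) has_derivative (\<lambda>v. upd v k (c * v $ k) + 0)) (at x)"
    by (simp only:) (intro has_derivative_add bounded_linear_imp_has_derivative[OF bounded_linear_upd] has_derivative_const)
  then show ?thesis by simp
qed

text \<open>The evaluation point is affine in \<open>x $ k\<close> so that one rule covers two
  integrals: \<open>c = 0\<close> gives the average over a full edge, the weight
  \<open>c s = s\<close> the average from the lower face up to \<open>x\<close>.\<close>

lemma C1_coord_integral:
  fixes f :: "real^'n \<Rightarrow> real" and p c :: "real \<Rightarrow> real"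
  assumes f: "C1 f D" and p: "continuous_on UNIV p" and c: "continuous_on UNIV c"
  shows "C1 (\<lambda>x. integral {0..1} (\<lambda>s. f (upd x k (p s + c s * x $ k))))
            (\<lambda>x v. integral {0..1} (\<lambda>s. D (upd x k (p s + c s * x $ k)) (upd v k (c s * v $ k))))"
proof -
  obtain f' where f': "\<And>x. blinfun_apply (f' x) = D x" and cf': "continuous_on UNIV f'"
    using C1_blinfun[OF f] by auto
  have cf: "continuous_on UNIV f" by (rule C1D(4)[OF f])
  show ?thesis
    unfolding cbox_interval[symmetric]
  proof (rule C1_param)
    fix x :: "real^'n" and s
    show "((\<lambda>x. f (upd x k (p s + c s * x $ k))) has_derivative (\<lambda>v. D (upd x k (p s + c s * x $ k)) (upd v k (c s * v $ k)))) (at x)"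
      by (rule has_derivative_compose[OF upd_affine_has_derivative C1D(1)[OF f]])
  next
    fix v :: "real^'n"
    have "continuous_on (UNIV \<times> cbox 0 1) (\<lambda>z. blinfun_apply (f' (upd (fst z) k (p (snd z) + c (snd z) * fst z $ k))) (upd v k (c (snd z) * v $ k)))"
      unfolding upd_eq
      by (intro continuous_intros continuous_on_compose2[OF cf'] continuous_on_compose2[OF p] continuous_on_compose2[OF c]) auto
    then show "continuous_on (UNIV \<times> cbox 0 1) (\<lambda>(x, s). D (upd x k (p s + c s * x $ k)) (upd v k (c s * v $ k)))"
      by (simp add: f' split_beta)
  next
    fix x :: "real^'n"
    show "continuous_on (cbox 0 1) (\<lambda>s. f (upd x k (p s + c s * x $ k)))"
      unfolding upd_eq
      by (intro continuous_intros continuous_on_compose2[OF cf] continuous_on_subset[OF p] continuous_on_subset[OF c]) auto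
  qed
qed

lemma cube_cbox: "x \<in> cube a \<tau> \<longleftrightarrow> (\<forall>k. a $ k \<le> x $ k \<and> x $ k \<le> a $ k + \<tau>)"
  by (simp add: cube_def mem_box_cart)

text \<open>The difference of \<open>f\<close> and its average along a coordinate direction has mean zero on each
  line in that direction, so its primitive along these lines vanishes on both end faces of the
  cube. Averaging out one coordinate after the other writes \<open>f\<close> minus a constant as a divergence.\<close>

lemma average_in_direction:
  fixes f :: "real^'n \<Rightarrow> real"
  assumes f: "C1 f D" and b: "\<And>x. x \<in> cube a \<tau> \<Longrightarrow> \<bar>f x\<bar> \<le> 1" and \<tau>: "\<tau> > 0"
  obtains F DF \<psi> D\<psi> where "C1 F DF" "C1 \<psi> D\<psi>" "\<And>x. x \<in> cube a \<tau> \<Longrightarrow> \<bar>F x\<bar> \<le> 1"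
    "\<And>x t. F (upd x k t) = F x"
    "\<And>j x t. (\<And>x t. f (upd x j t) = f x) \<Longrightarrow> F (upd x j t) = F x"
    "\<And>x. D\<psi> x (axis k 1) = f x - F x"
    "\<And>x. x \<in> cube a \<tau> \<Longrightarrow> \<bar>\<psi> x\<bar> \<le> 2 * (x $ k - a $ k)"
    "\<And>x. x \<in> cube a \<tau> \<Longrightarrow> \<bar>\<psi> x\<bar> \<le> 2 * (a $ k + \<tau> - x $ k)"
proof -
  define F where "F x = integral {0..1} (\<lambda>s. f (upd x k ((a $ k + s * \<tau>) + 0 * x $ k)))" for x
  define DF where "DF x v = integral {0..1} (\<lambda>s. D (upd x k ((a $ k + s * \<tau>) + 0 * x $ k)) (upd v k (0 * v $ k)))" for x v
  have F: "C1 F DF"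
    unfolding F_def[abs_def] DF_def[abs_def] by (intro C1_coord_integral f continuous_intros)
  \<comment> \<open>\<open>(x $ k - a $ k) * G x\<close> is the primitive of \<open>f\<close> along
    the line, rescaled to \<open>[0, 1]\<close> so that the domain of integration does not move with
    \<open>x\<close>. Accordingly \<psi> is the primitive of \<open>f - F\<close>.\<close>
  define G where "G x = integral {0..1} (\<lambda>s. f (upd x k ((1 - s) * a $ k + s * x $ k)))" for x
  define DG where "DG x v = integral {0..1} (\<lambda>s. D (upd x k ((1 - s) * a $ k + s * x $ k)) (upd v k (s * v $ k)))" for x v
  have G: "C1 G DG"
    unfolding G_def[abs_def] DG_def[abs_def] by (intro C1_coord_integral f continuous_intros)
  have lin: "C1 (\<lambda>x::real^'n. x $ k - a $ k) (\<lambda>x v. v $ k - 0)"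
    by (intro C1_diff C1_coord C1_const)
  define \<psi> where "\<psi> x = (x $ k - a $ k) * (G x - F x)" for x
  define D\<psi> where "D\<psi> x v = (x $ k - a $ k) * (DG x v - DF x v) + (v $ k - 0) * (G x - F x)" for x v
  have \<psi>: "C1 \<psi> D\<psi>"
    unfolding \<psi>_def[abs_def] D\<psi>_def[abs_def] by (intro C1_mult lin C1_diff G F)
  have cf: "continuous_on UNIV f" by (rule C1D(4)[OF f])
  have bF: "\<bar>F x\<bar> \<le> 1" if "x \<in> cube a \<tau>" for x
  proof -
    have "norm (integral {0..1} (\<lambda>s. f (upd x k ((a $ k + s * \<tau>) + 0 * x $ k)))) \<le> integral {0..1} (\<lambda>s::real. 1::real)"
    proof (rule integral_norm_bound_integral)
      show "(\<lambda>s. f (upd x k ((a $ k + s * \<tau>) + 0 * x $ k))) integrable_on {0..1}"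
        unfolding upd_eq by (intro integrable_continuous_interval continuous_intros continuous_on_compose2[OF cf]) auto
      show "norm (f (upd x k ((a $ k + s * \<tau>) + 0 * x $ k))) \<le> 1" if "s \<in> {0..1}" for s
      proof -
        have "upd x k ((a $ k + s * \<tau>) + 0 * x $ k) \<in> cube a \<tau>"
          using that \<open>x \<in> cube a \<tau>\<close> \<tau> by (auto simp: cube_cbox mult_left_le_one_le)
        then show ?thesis using b by simp
      qed
    qed auto
    then show ?thesis by (simp add: F_def)
  qed
  have Fk: "F (upd x k t) = F x" for x t
    by (simp add: F_def)
  have Fj: "F (upd x j t) = F x" if "\<And>x t. f (upd x j t) = f x" for j x t
  proof (cases "j = k")
    case True then show ?thesis using Fk by simp
  next
    case False
    then show ?thesis using that by (simp add: F_def upd_commute[OF False])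
  qed
  have DFk: "DF x (axis k 1) = 0" for x
  proof -
    have "upd (axis k 1) k 0 = (0::real^'n)" by (auto simp: vec_eq_iff axis_def)
    then show ?thesis using C1D(3)[OF f] by (simp add: DF_def linear_simps)
  qed
  \<comment> \<open>The left side is the derivative of that primitive; the identity is the
    fundamental theorem applied to \<open>s * f (c s)\<close> on \<open>[0, 1]\<close>.\<close>
  have GG: "G x + (x $ k - a $ k) * DG x (axis k 1) = f x" for x
  proof -
    define c where "c s = upd x k ((1 - s) * a $ k + s * x $ k)" for s
    have c': "c s = upd x k (a $ k) + s *\<^sub>R ((x $ k - a $ k) *\<^sub>R axis k 1)" for s
      by (auto simp: vec_eq_iff c_def axis_def algebra_simps)
    have cc: "continuous_on S c" for S unfolding c'[abs_def] by (intro continuous_intros)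
    have u: "upd (axis k 1) k (s * axis k 1 $ k) = s *\<^sub>R (axis k 1 :: real^'n)" for s
      by (auto simp: vec_eq_iff axis_def)
    have Du: "D y (s *\<^sub>R axis k 1) = s * D y (axis k 1)" for y s
      using C1D(3)[OF f, of y] by (simp add: linear_simps)
    have i1: "(\<lambda>s. f (c s)) integrable_on {0..1}"
      by (intro integrable_continuous_interval continuous_on_compose2[OF cf cc]) auto
    have i2: "(\<lambda>s. s * D (c s) (axis k 1)) integrable_on {0..1}"
      by (intro integrable_continuous_interval continuous_intros continuous_on_compose2[OF C1D(2)[OF f] cc]) auto
    have "((\<lambda>s. f (c s) + s * ((x $ k - a $ k) * D (c s) (axis k 1))) has_integral (1 * f (c 1) - 0 * f (c 0))) {0..1}"
    proof (rule fundamental_theorem_of_calculus)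
      fix s :: real
      have "((\<lambda>s. f (c s)) has_real_derivative D (c s) ((x $ k - a $ k) *\<^sub>R axis k 1)) (at s)"
        unfolding c' by (rule C1_has_real_derivative_line[OF f])
      moreover have "D (c s) ((x $ k - a $ k) *\<^sub>R axis k 1) = (x $ k - a $ k) * D (c s) (axis k 1)"
        using C1D(3)[OF f] by (simp add: linear_simps)
      ultimately have "((\<lambda>s. s * f (c s)) has_real_derivative 1 * f (c s) + (x $ k - a $ k) * D (c s) (axis k 1) * s) (at s)"
        by (intro DERIV_mult DERIV_ident) simp
      then show "((\<lambda>s. s * f (c s)) has_vector_derivative f (c s) + s * ((x $ k - a $ k) * D (c s) (axis k 1))) (at s within {0..1})"
        by (auto simp: has_real_derivative_iff_has_vector_derivative algebra_simps intro: has_vector_derivative_at_within)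
    qed auto
    then have "integral {0..1} (\<lambda>s. f (c s) + (x $ k - a $ k) * (s * D (c s) (axis k 1))) = f x"
      by (simp add: c_def algebra_simps integral_unique)
    then have "integral {0..1} (\<lambda>s. f (c s)) + (x $ k - a $ k) * integral {0..1} (\<lambda>s. s * D (c s) (axis k 1)) = f x"
      using i1 i2 by (subst (asm) integral_add) (auto intro: integrable_on_mult_right)
    moreover have "DG x (axis k 1) = integral {0..1} (\<lambda>s. s * D (c s) (axis k 1))"
      unfolding DG_def u Du c_def ..
    ultimately show ?thesis unfolding G_def c_def by simp
  qed
  have D\<psi>: "D\<psi> x (axis k 1) = f x - F x" for x
    using GG[of x] by (simp add: D\<psi>_def DFk algebra_simps)
  have z0: "\<psi> (upd x k (a $ k)) = 0" for x by (simp add: \<psi>_def)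
  have z1: "\<psi> (upd x k (a $ k + \<tau>)) = 0" for x
    by (simp add: \<psi>_def F_def G_def algebra_simps)
  \<comment> \<open>The slope of \<psi> along the line is \<open>f - F\<close>, of size at most 2.
    Together with the zeros at both ends it yields the bounds by the distance to either
    face.\<close>
  have lip: "\<bar>\<psi> (upd x k t) - \<psi> (upd x k s)\<bar> \<le> 2 * (t - s)"
    if x: "x \<in> cube a \<tau>" and st: "a $ k \<le> s" "s \<le> t" "t \<le> a $ k + \<tau>" for x s t
  proof (cases "s = t")
    case False
    with st have st': "s < t" by simp
    have "((\<lambda>t. \<psi> (upd x k t)) has_real_derivative D\<psi> (upd x k r) (axis k 1)) (at r)" for r
    proof -
      have e: "upd x k t = upd x k 0 + t *\<^sub>R axis k 1" for t by (auto simp: vec_eq_iff axis_def)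
      show ?thesis using C1_has_real_derivative_line[OF \<psi>, of "upd x k 0" "axis k 1" r] by (simp only: e[symmetric])
    qed
    then obtain r where r: "s < r" "r < t" "\<psi> (upd x k t) - \<psi> (upd x k s) = (t - s) * D\<psi> (upd x k r) (axis k 1)"
      using MVT2[OF st', of "\<lambda>t. \<psi> (upd x k t)" "\<lambda>r. D\<psi> (upd x k r) (axis k 1)"] by blast
    have "upd x k r \<in> cube a \<tau>" using x st r by (auto simp: cube_cbox)
    from bF[OF this] b[OF this] have "\<bar>D\<psi> (upd x k r) (axis k 1)\<bar> \<le> 2" unfolding D\<psi> by linarith
    then have "\<bar>t - s\<bar> * \<bar>D\<psi> (upd x k r) (axis k 1)\<bar> \<le> (t - s) * 2"
      using st' by (intro mult_mono) auto
    then show ?thesis unfolding r(3) abs_mult by simp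
  qed simp
  show ?thesis
  proof (rule that[OF F \<psi> bF Fk Fj D\<psi>])
    fix x assume x: "x \<in> cube a \<tau>"
    then have xk: "a $ k \<le> x $ k" "x $ k \<le> a $ k + \<tau>" by (auto simp: cube_cbox)
    show "\<bar>\<psi> x\<bar> \<le> 2 * (x $ k - a $ k)"
      using lip[OF x _ xk(1) xk(2)] z0[of x] by simp
    show "\<bar>\<psi> x\<bar> \<le> 2 * (a $ k + \<tau> - x $ k)"
      using lip[OF x xk(1) xk(2)] z1[of x] by simp
  qed
qed

text \<open>Averaging in a new direction keeps the invariance in the earlier ones. After all
  directions the remainder \<open>F\<close> is constant, and \<open>f\<close> minus that constant is
  the divergence of the collected primitives.\<close>

lemma average_in_directions:
  fixes f :: "real^'n \<Rightarrow> real"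
  assumes f: "C1 f D" and b: "\<forall>x\<in>cube a \<tau>. \<bar>f x\<bar> \<le> 1" and \<tau>: "\<tau> > 0" and "finite J"
  shows "\<exists>F DF \<psi> D\<psi>. C1 F DF \<and> (\<forall>k\<in>J. C1 (\<psi> k) (D\<psi> k)) \<and> (\<forall>x\<in>cube a \<tau>. \<bar>F x\<bar> \<le> 1) \<and>
    (\<forall>k\<in>J. \<forall>x t. F (upd x k t) = F x) \<and> (\<forall>x. (\<Sum>k\<in>J. D\<psi> k x (axis k 1)) = f x - F x) \<and>
    (\<forall>k\<in>J. \<forall>x\<in>cube a \<tau>. \<bar>\<psi> k x\<bar> \<le> 2 * (x $ k - a $ k) \<and> \<bar>\<psi> k x\<bar> \<le> 2 * (a $ k + \<tau> - x $ k))"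
  using \<open>finite J\<close>
proof induction
  case empty
  show ?case by (rule exI[of _ f], rule exI[of _ D]) (use f b in auto)
next
  case (insert k J)
  from insert.IH obtain F DF \<psi> D\<psi> where IH: "C1 F DF \<and> (\<forall>k\<in>J. C1 (\<psi> k) (D\<psi> k)) \<and> (\<forall>x\<in>cube a \<tau>. \<bar>F x\<bar> \<le> 1) \<and>
    (\<forall>k\<in>J. \<forall>x t. F (upd x k t) = F x) \<and> (\<forall>x. (\<Sum>k\<in>J. D\<psi> k x (axis k 1)) = f x - F x) \<and>
    (\<forall>k\<in>J. \<forall>x\<in>cube a \<tau>. \<bar>\<psi> k x\<bar> \<le> 2 * (x $ k - a $ k) \<and> \<bar>\<psi> k x\<bar> \<le> 2 * (a $ k + \<tau> - x $ k))"
    by (elim exE) (rule that)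
  then have F: "C1 F DF" and \<psi>: "\<And>k. k \<in> J \<Longrightarrow> C1 (\<psi> k) (D\<psi> k)"
    and bF: "\<And>x. x \<in> cube a \<tau> \<Longrightarrow> \<bar>F x\<bar> \<le> 1"
    and Fk: "\<And>k x t. k \<in> J \<Longrightarrow> F (upd x k t) = F x"
    and D\<psi>: "\<And>x. (\<Sum>k\<in>J. D\<psi> k x (axis k 1)) = f x - F x"
    and b\<psi>: "\<And>k x. k \<in> J \<Longrightarrow> x \<in> cube a \<tau> \<Longrightarrow> \<bar>\<psi> k x\<bar> \<le> 2 * (x $ k - a $ k) \<and> \<bar>\<psi> k x\<bar> \<le> 2 * (a $ k + \<tau> - x $ k)"
    by (-, blast+)
  obtain F' DF' \<psi>' D\<psi>' where F': "C1 F' DF'" "C1 \<psi>' D\<psi>'" "\<And>x. x \<in> cube a \<tau> \<Longrightarrow> \<bar>F' x\<bar> \<le> 1"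
    "\<And>x t. F' (upd x k t) = F' x"
    "\<And>j x t. (\<And>x t. F (upd x j t) = F x) \<Longrightarrow> F' (upd x j t) = F' x"
    "\<And>x. D\<psi>' x (axis k 1) = F x - F' x"
    "\<And>x. x \<in> cube a \<tau> \<Longrightarrow> \<bar>\<psi>' x\<bar> \<le> 2 * (x $ k - a $ k)"
    "\<And>x. x \<in> cube a \<tau> \<Longrightarrow> \<bar>\<psi>' x\<bar> \<le> 2 * (a $ k + \<tau> - x $ k)"
    by (rule average_in_direction[where k=k, OF F bF \<tau>]) blast+
  have kJ: "\<And>j. j \<in> J \<Longrightarrow> j \<noteq> k" using insert by auto
  have s: "(\<Sum>j\<in>J. (D\<psi>(k := D\<psi>')) j x (axis j 1)) = (\<Sum>j\<in>J. D\<psi> j x (axis j 1))" for x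
    using kJ by (intro sum.cong) auto
  show ?case
    apply (rule exI[of _ F'], rule exI[of _ DF'], rule exI[of _ "\<psi>(k := \<psi>')"], rule exI[of _ "D\<psi>(k := D\<psi>')"])
    using F' \<psi> b\<psi> kJ Fk insert(1,2) by (auto simp: s D\<psi>)
qed

lemma upd_invariant_imp_constant:
  assumes "\<And>k x t. F (upd x k t) = F x"
  shows "F x = F (y :: real^'n)"
proof -
  have "finite J \<Longrightarrow> F (\<chi> j. if j \<in> J then y $ j else x $ j) = F x" for J
  proof (induction rule: finite_induct)
    case (insert k J)
    have "(\<chi> j. if j \<in> insert k J then y $ j else x $ j) = upd (\<chi> j. if j \<in> J then y $ j else x $ j) k (y $ k)"
      by (auto simp: vec_eq_iff)
    then show ?case using assms insert by simp
  qed simp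
  from this[of UNIV] show ?thesis by simp
qed

lemma cube_eq: "cube a \<tau> = cbox a (a + vec \<tau>)" by (simp add: cube_def)

text \<open>The field of primitives has vanishing normal component on the faces but no compact
  support inside the cube. The cutoff repairs this while the divergences stay bounded uniformly in
  \<open>n\<close>, as dominated convergence requires. The norm bound rests on
  \<open>\<bar>\<psi> k x\<bar> \<le> \<tau>\<close>, since one of the two faces is within
  \<open>\<tau> / 2\<close>.\<close>

lemma cube_test_fields:
  fixes f :: "real^'n \<Rightarrow> real"
  assumes f: "C1 f D" and b: "\<And>x. x \<in> cube a \<tau> \<Longrightarrow> \<bar>f x\<bar> \<le> 1" and \<tau>: "\<tau> > 0"
  obtains c and \<phi> :: "nat \<Rightarrow> real^'n \<Rightarrow> real^'n" where
    "\<And>n. \<phi> n \<in> C1c (box a (a + vec \<tau>))" "\<And>n x. norm (\<phi> n x) \<le> real CARD('n) * \<tau>"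
    "\<And>n x. \<bar>divergence (\<phi> n) x\<bar> \<le> 2 + 16 * real CARD('n)"
    "\<And>x. x \<in> box a (a + vec \<tau>) \<Longrightarrow> \<forall>\<^sub>F n in sequentially. divergence (\<phi> n) x = f x - c"
    "\<And>n x. x \<notin> box a (a + vec \<tau>) \<Longrightarrow> divergence (\<phi> n) x = 0"
proof -
  have b0: "\<forall>x\<in>cube a \<tau>. \<bar>f x\<bar> \<le> 1" using b by blast
  from average_in_directions[where J=UNIV and a=a, OF f b0 \<tau> finite_class.finite_UNIV]
  obtain F DF \<psi> D\<psi> where *: "C1 F DF \<and> (\<forall>k\<in>UNIV. C1 (\<psi> k) (D\<psi> k)) \<and> (\<forall>x\<in>cube a \<tau>. \<bar>F x\<bar> \<le> 1) \<and>
    (\<forall>k\<in>UNIV. \<forall>x t. F (upd x k t) = F x) \<and> (\<forall>x. (\<Sum>k\<in>UNIV. D\<psi> k x (axis k 1)) = f x - F x) \<and>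
    (\<forall>k\<in>UNIV. \<forall>x\<in>cube a \<tau>. \<bar>\<psi> k x\<bar> \<le> 2 * (x $ k - a $ k) \<and> \<bar>\<psi> k x\<bar> \<le> 2 * (a $ k + \<tau> - x $ k))"
    by (elim exE) (rule that)
  then have F: "C1 F DF" and \<psi>: "\<And>k. C1 (\<psi> k) (D\<psi> k)"
    and bF: "\<And>x. x \<in> cube a \<tau> \<Longrightarrow> \<bar>F x\<bar> \<le> 1"
    and Fk: "\<And>k x t. F (upd x k t) = F x"
    and D\<psi>: "\<And>x. (\<Sum>k\<in>UNIV. D\<psi> k x (axis k 1)) = f x - F x"
    and b\<psi>: "\<And>k x. x \<in> cube a \<tau> \<Longrightarrow> \<bar>\<psi> k x\<bar> \<le> 2 * (x $ k - a $ k) \<and> \<bar>\<psi> k x\<bar> \<le> 2 * (a $ k + \<tau> - x $ k)"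
    by (-, blast+)
  define c where "c = F a"
  have c: "F x = c" for x unfolding c_def by (rule upd_invariant_imp_constant[OF Fk])
  let ?b = "a + vec \<tau>"
  let ?g = "\<lambda>n k x. boxcut a ?b (ep n) x * \<psi> k x"
  let ?D = "\<lambda>n k x v. boxcut a ?b (ep n) x * D\<psi> k x v + boxcut' a ?b (ep n) x v * \<psi> k x"
  define \<phi> where "\<phi> n x = (\<chi> k. ?g n k x)" for n x
  have g: "C1 (?g n k) (?D n k)" for n k by (intro C1_mult C1_boxcut \<psi>)
  have sub: "x \<in> box a ?b \<Longrightarrow> x \<in> cube a \<tau>" for x
    using box_subset_cbox unfolding cube_eq by blast
  have out: "boxcut a ?b (ep n) x = 0" "boxcut' a ?b (ep n) x v = 0" if "x \<notin> box a ?b" for n x v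
    using that boxcut_cbox_subset[OF ep(1)] boxcut_support[OF ep(1)] by blast+
  have div: "divergence (\<phi> n) x = boxcut a ?b (ep n) x * (f x - c) + (\<Sum>k\<in>UNIV. boxcut' a ?b (ep n) x (axis k 1) * \<psi> k x)" for n x
    unfolding \<phi>_def[abs_def] divergence_vec[OF g] by (simp add: sum.distrib flip: sum_distrib_left D\<psi>[unfolded c])
  \<comment> \<open>In the layer of width \<open>2 * ep n\<close> the primitive is at most
    \<open>4 * ep n\<close> and the slope of the cutoff at most \<open>4 / ep n\<close>, so the
    product is at most 16 whatever \<open>n\<close>. Away from that layer the slope in direction
    \<open>k\<close> is zero.\<close>
  have bd: "\<bar>boxcut' a ?b (ep n) x (axis k 1) * \<psi> k x\<bar> \<le> 16" if x: "x \<in> box a ?b" for n x k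
  proof (cases "a $ k + 2 * ep n \<le> x $ k \<and> x $ k \<le> a $ k + \<tau> - 2 * ep n")
    case True
    then have "bump' (a $ k) (?b $ k) (ep n) (x $ k) = 0"
      by (intro bump_one ep) auto
    then have "boxcut' a ?b (ep n) x (axis k 1) = 0"
      unfolding boxcut'_def by (auto intro!: sum.neutral simp: axis_def)
    then show ?thesis by simp
  next
    case False
    have "boxcut' a ?b (ep n) x (axis k 1) = bump' (a $ k) (?b $ k) (ep n) (x $ k) * (\<Prod>j\<in>UNIV - {k}. bump (a $ j) (?b $ j) (ep n) (x $ j))"
      unfolding boxcut'_def by (subst sum.remove[of _ k]) (auto intro!: sum.neutral simp: axis_def)
    also have "\<bar>\<dots>\<bar> \<le> 4 / ep n * 1"
      unfolding abs_mult abs_prod using bump'_bound[OF ep(1)]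
      by (intro mult_mono prod_le_1) (auto simp: bump_bounds ep less_imp_le intro!: prod_nonneg)
    finally have 1: "\<bar>boxcut' a ?b (ep n) x (axis k 1)\<bar> \<le> 4 / ep n" by simp
    have 2: "\<bar>\<psi> k x\<bar> \<le> 4 * ep n" using False b\<psi>[OF sub[OF x], of k] by auto
    have "\<bar>boxcut' a ?b (ep n) x (axis k 1)\<bar> * \<bar>\<psi> k x\<bar> \<le> 4 / ep n * (4 * ep n)"
      using 1 2 by (rule mult_mono) (auto simp: ep less_imp_le)
    then show ?thesis using ep(1)[of n] by (simp add: abs_mult)
  qed
  show ?thesis
  proof (rule that[of \<phi> c])
    fix n
    show "\<phi> n \<in> C1c (box a ?b)"
      unfolding \<phi>_def[abs_def]
      by (rule C1_imp_C1c[OF C1_vec[OF g] compact_cbox boxcut_cbox_subset[OF ep(1)[of n]]])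
        (simp add: boxcut_support(1)[OF ep(1)] vec_eq_iff)
  next
    fix n x
    have "\<bar>?g n k x\<bar> \<le> \<tau>" for k
    proof (cases "x \<in> box a ?b")
      case True
      have "\<bar>\<psi> k x\<bar> \<le> \<tau>" using b\<psi>[OF sub[OF True], of k] by (simp add: abs_if split: if_splits)
      then have "boxcut a ?b (ep n) x * \<bar>\<psi> k x\<bar> \<le> 1 * \<tau>" by (intro mult_mono boxcut_bounds) auto
      then show ?thesis using boxcut_bounds(1)[of a ?b "ep n" x] by (simp add: abs_mult)
    next
      case False
      then show ?thesis using out \<tau> by simp
    qed
    then have "(\<Sum>k\<in>UNIV. \<bar>\<phi> n x $ k\<bar>) \<le> (\<Sum>k\<in>(UNIV::'n set). \<tau>)"
      unfolding \<phi>_def by (intro sum_mono) simp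
    then show "norm (\<phi> n x) \<le> real CARD('n) * \<tau>"
      using norm_le_l1_cart[of "\<phi> n x"] by simp
  next
    fix n x
    show "\<bar>divergence (\<phi> n) x\<bar> \<le> 2 + 16 * real CARD('n)"
    proof (cases "x \<in> box a ?b")
      case True
      have "\<bar>f x - c\<bar> \<le> 2" using bF[OF sub[OF True]] b[OF sub[OF True]] c[of x] by linarith
      then have "boxcut a ?b (ep n) x * \<bar>f x - c\<bar> \<le> 1 * 2" by (intro mult_mono boxcut_bounds) auto
      then have 1: "\<bar>boxcut a ?b (ep n) x * (f x - c)\<bar> \<le> 2"
        using boxcut_bounds(1)[of a ?b "ep n" x] by (simp add: abs_mult)
      have "\<bar>\<Sum>k\<in>UNIV. boxcut' a ?b (ep n) x (axis k 1) * \<psi> k x\<bar> \<le> (\<Sum>k\<in>(UNIV::'n set). 16)"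
        by (rule order.trans[OF sum_abs]) (intro sum_mono bd True)
      then show ?thesis unfolding div using 1 by simp
    next
      case False
      then show ?thesis by (simp add: div out)
    qed
  next
    fix x assume "x \<in> box a ?b"
    from boxcut_eventually[OF this] show "\<forall>\<^sub>F n in sequentially. divergence (\<phi> n) x = f x - c"
      by (rule eventually_mono) (simp add: div)
  next
    fix n x assume "x \<notin> box a ?b"
    then show "divergence (\<phi> n) x = 0" by (simp add: div out)
  qed
qed

lemma divergence_integral_0:
  fixes \<phi> :: "real^'n \<Rightarrow> real^'n"
  assumes "\<phi> \<in> C1c \<Omega>"
  shows "(LINT x|lebesgue. divergence \<phi> x) = 0" "divergence \<phi> \<in> borel_measurable lebesgue"
proof -
  let ?D = "\<lambda>x. frechet_derivative \<phi> (at x)"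
  have C: "C1 \<phi> ?D" by (rule C1c_imp_C1[OF assms])
  define K where "K = closure {x. \<phi> x \<noteq> 0}"
  have K: "compact K" using assms by (auto simp: C1c_def K_def)
  have Ci: "C1 (\<lambda>x. \<phi> x $ i) (\<lambda>x v. ?D x v $ i)" for i
    using C unfolding C1_def
    by (auto intro!: continuous_intros bounded_linear.has_derivative[OF bounded_linear_vec_nth])
  have z: "\<phi> x $ i = 0" if "x \<notin> K" for x i
    using that closure_subset[of "{x. \<phi> x \<noteq> 0}"] unfolding K_def by (metis (mono_tags, lifting) mem_Collect_eq subsetD zero_index)
  have I: "integrable lebesgue (\<lambda>x. ?D x v $ i)" "(LINT x|lebesgue. ?D x v $ i) = 0" for v i
    using integral_directional_derivative_eq_0[OF Ci K z] by auto
  show "(LINT x|lebesgue. divergence \<phi> x) = 0"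
    unfolding divergence_def[abs_def] by (subst Bochner_Integration.integral_sum) (use I in auto)
  show "divergence \<phi> \<in> borel_measurable lebesgue"
    unfolding divergence_def[abs_def] using I(1) by (intro borel_measurable_sum) auto
qed

text \<open>A Poincare inequality in dual form: the field pairs with \<open>w\<close> to nearly the
  L1 deviation of \<open>w\<close> from \<open>m\<close>. Its divergence approximates
  \<open>sgn (w - m)\<close> up to a constant, which is invisible because \<open>w - m\<close> has
  mean zero on the cube.\<close>

lemma cube_poincare:
  fixes w :: "real^'n \<Rightarrow> real"
  assumes w: "integrable lebesgue w" and \<tau>: "\<tau> > 0" and \<kappa>: "\<kappa> > 0"
    and m: "(LINT x|lebesgue. (w x - m) * indicator (cube a \<tau>) x) = 0"
  obtains \<phi> :: "real^'n \<Rightarrow> real^'n" where "\<phi> \<in> C1c (box a (a + vec \<tau>))" "\<And>x. norm (\<phi> x) \<le> real CARD('n) * \<tau>"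
    "\<And>x. x \<notin> box a (a + vec \<tau>) \<Longrightarrow> divergence \<phi> x = 0" "\<And>x. \<bar>divergence \<phi> x\<bar> \<le> 2 + 16 * real CARD('n)"
    "(LINT x|lebesgue. w x * divergence \<phi> x) \<ge> (LINT x|lebesgue. \<bar>w x - m\<bar> * indicator (cube a \<tau>) x) - \<kappa>"
proof -
  let ?Q = "cube a \<tau>" and ?b = "a + vec \<tau>"
  define s where "s x = sgn (w x - m)" for x
  have s: "s \<in> borel_measurable lebesgue" unfolding s_def using w by measurable
  have "\<bar>s x\<bar> \<le> 1" for x by (simp add: s_def sgn_if)
  from AE_approx_polynomial[OF s this compact_cbox[of a ?b]] obtain q where
    q: "\<And>n. real_polynomial_function (q n)" "\<And>n x. x \<in> ?Q \<Longrightarrow> \<bar>q n x\<bar> \<le> 1"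
    and lq: "AE x in lebesgue. x \<in> ?Q \<longrightarrow> (\<lambda>n. q n x) \<longlonglongrightarrow> s x" unfolding cube_eq by blast
  have iQ: "integrable lebesgue (\<lambda>x. indicator ?Q x :: real)"
    using emeasure_bounded_finite[of ?Q] unfolding cube_eq by (intro integrable_real_indicator) auto
  have Qm: "?Q \<in> sets lebesgue" by (simp add: cube_eq)
  have wQ: "integrable lebesgue (\<lambda>x. w x * indicator ?Q x)" using w Qm by (intro integrable_real_mult_indicator)
  have wmQ: "integrable lebesgue (\<lambda>x. (w x - m) * indicator ?Q x)"
    using Bochner_Integration.integrable_diff[OF wQ integrable_mult_right[OF iQ, of m]] by (simp add: algebra_simps)
  have Dq: "\<exists>D. C1 (q n) D" for n by (rule real_polynomial_function_C1[OF q(1)])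
  have qm: "q n \<in> borel_measurable lebesgue" for n
    using Dq[of n] C1D(4) continuous_imp_measurable_lebesgue by blast
  have "(\<lambda>n. LINT x|lebesgue. (w x - m) * indicator ?Q x * q n x) \<longlonglongrightarrow> (LINT x|lebesgue. \<bar>w x - m\<bar> * indicator ?Q x)"
  proof (rule integral_dominated_convergence[where w="\<lambda>x. \<bar>(w x - m) * indicator ?Q x\<bar>"])
    show "(\<lambda>x. \<bar>w x - m\<bar> * indicator ?Q x) \<in> borel_measurable lebesgue"
      using w Qm by (intro borel_measurable_times borel_measurable_indicator) auto
    show "(\<lambda>x. (w x - m) * indicator ?Q x * q n x) \<in> borel_measurable lebesgue" for n
      by (rule borel_measurable_times[OF borel_measurable_integrable[OF wmQ] qm])
    show "integrable lebesgue (\<lambda>x. \<bar>(w x - m) * indicator ?Q x\<bar>)" using wmQ by simp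
    show "AE x in lebesgue. (\<lambda>n. (w x - m) * indicator ?Q x * q n x) \<longlonglongrightarrow> \<bar>w x - m\<bar> * indicator ?Q x"
      using lq
    proof eventually_elim
      case (elim x)
      show ?case
      proof (cases "x \<in> ?Q")
        case True
        then have "(\<lambda>n. (w x - m) * q n x) \<longlonglongrightarrow> (w x - m) * s x"
          using elim by (intro tendsto_intros) auto
        then show ?thesis using True by (simp add: s_def abs_sgn)
      qed simp
    qed
    show "AE x in lebesgue. norm ((w x - m) * indicator ?Q x * q n x) \<le> \<bar>(w x - m) * indicator ?Q x\<bar>" for n
      using q(2) by (intro AE_I2) (auto simp: abs_mult mult_left_le indicator_def)
  qed
  from order_tendstoD(1)[OF this, of "(LINT x|lebesgue. \<bar>w x - m\<bar> * indicator ?Q x) - \<kappa> / 2"] \<kappa>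
  obtain n where n: "(LINT x|lebesgue. (w x - m) * indicator ?Q x * q n x) > (LINT x|lebesgue. \<bar>w x - m\<bar> * indicator ?Q x) - \<kappa> / 2"
    by (auto simp: eventually_sequentially)
  obtain D where D: "C1 (q n) D" using Dq by blast
  obtain c \<phi> where \<phi>: "\<And>n. \<phi> n \<in> C1c (box a ?b)" "\<And>n x. norm (\<phi> n x) \<le> real CARD('n) * \<tau>"
    and bd: "\<And>n x. \<bar>divergence (\<phi> n) x\<bar> \<le> 2 + 16 * real CARD('n)"
    and ev: "\<And>x. x \<in> box a ?b \<Longrightarrow> \<forall>\<^sub>F j in sequentially. divergence (\<phi> j) x = q n x - c"
    and out: "\<And>n x. x \<notin> box a ?b \<Longrightarrow> divergence (\<phi> n) x = 0"
    by (rule cube_test_fields[OF D q(2) \<tau>]) blast+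
  have conv: "(\<lambda>j. LINT x|lebesgue. u x * divergence (\<phi> j) x) \<longlonglongrightarrow> (LINT x|lebesgue. u x * indicator ?Q x * (q n x - c))"
    if u: "integrable lebesgue (\<lambda>x. u x * indicator ?Q x)" "u \<in> borel_measurable lebesgue" for u :: "real^'n \<Rightarrow> real"
  proof (rule integral_dominated_convergence[where w="\<lambda>x. (2 + 16 * real CARD('n)) * \<bar>u x * indicator ?Q x\<bar>"])
    show "(\<lambda>x. u x * indicator ?Q x * (q n x - c)) \<in> borel_measurable lebesgue"
      using u(2) qm Qm by (intro borel_measurable_times borel_measurable_diff borel_measurable_indicator) auto
    show "(\<lambda>x. u x * divergence (\<phi> j) x) \<in> borel_measurable lebesgue" for j
      using u divergence_integral_0(2)[OF \<phi>(1)] by (intro borel_measurable_times) auto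
    show "integrable lebesgue (\<lambda>x. (2 + 16 * real CARD('n)) * \<bar>u x * indicator ?Q x\<bar>)"
      using u by (intro integrable_mult_right integrable_abs)
    show "AE x in lebesgue. (\<lambda>j. u x * divergence (\<phi> j) x) \<longlonglongrightarrow> u x * indicator ?Q x * (q n x - c)"
      using AE_box_of_cbox[of a ?b]
    proof eventually_elim
      case (elim x)
      show ?case
      proof (cases "x \<in> ?Q")
        case True
        then have "(\<lambda>j. u x * divergence (\<phi> j) x) \<longlonglongrightarrow> u x * (q n x - c)"
          using elim ev[of x] by (intro tendsto_intros tendsto_eventually) (auto simp: cube_eq)
        then show ?thesis using True by simp
      next
        case False
        then have "x \<notin> box a ?b" using box_subset_cbox[of a ?b] by (auto simp: cube_eq)
        then show ?thesis using False by (simp add: out)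
      qed
    qed
    show "AE x in lebesgue. norm (u x * divergence (\<phi> j) x) \<le> (2 + 16 * real CARD('n)) * \<bar>u x * indicator ?Q x\<bar>" for j
    proof (rule AE_I2)
      fix x
      show "norm (u x * divergence (\<phi> j) x) \<le> (2 + 16 * real CARD('n)) * \<bar>u x * indicator ?Q x\<bar>"
      proof (cases "x \<in> ?Q")
        case True
        have "\<bar>u x\<bar> * \<bar>divergence (\<phi> j) x\<bar> \<le> \<bar>u x\<bar> * (2 + 16 * real CARD('n))"
          by (intro mult_left_mono bd) auto
        then show ?thesis using True by (simp add: abs_mult mult.commute)
      next
        case False
        then have "x \<notin> box a ?b" using box_subset_cbox[of a ?b] by (auto simp: cube_eq)
        then show ?thesis using False by (simp add: out)
      qed
    qed
  qed
  \<comment> \<open>The value of \<open>c\<close> is never computed: \<open>q n - c\<close> has mean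
    zero on the cube as a limit of integrals of divergences.\<close>
  have qc: "(LINT x|lebesgue. 1 * indicator ?Q x * (q n x - c)) = 0"
    using conv[of "\<lambda>x. 1"] iQ divergence_integral_0(1)[OF \<phi>(1)] by (simp add: LIMSEQ_const_iff)
  have iqQ: "integrable lebesgue (\<lambda>x. u x * indicator ?Q x * q n x)" if u: "integrable lebesgue (\<lambda>x. u x * indicator ?Q x)" for u :: "real^'n \<Rightarrow> real"
  proof (rule Bochner_Integration.integrable_bound[OF u])
    show "AE x in lebesgue. norm (u x * indicator ?Q x * q n x) \<le> norm (u x * indicator ?Q x)"
      using q(2) by (intro AE_I2) (auto simp: abs_mult mult_left_le indicator_def)
    show "(\<lambda>x. u x * indicator ?Q x * q n x) \<in> borel_measurable lebesgue"
      by (rule borel_measurable_times[OF borel_measurable_integrable[OF u] qm])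
  qed
  \<comment> \<open>The split makes both constants drop out: \<open>c\<close> against
    \<open>w - m\<close> by the choice of \<open>m\<close>, and \<open>m\<close> against
    \<open>q n - c\<close> by \<open>qc\<close>.\<close>
  have "(LINT x|lebesgue. w x * indicator ?Q x * (q n x - c))
     = (LINT x|lebesgue. (w x - m) * indicator ?Q x * q n x - c * ((w x - m) * indicator ?Q x) + m * (1 * indicator ?Q x * (q n x - c)))"
    by (intro Bochner_Integration.integral_cong refl) (simp add: algebra_simps)
  also have "\<dots> = (LINT x|lebesgue. (w x - m) * indicator ?Q x * q n x) - c * 0 + m * 0"
  proof -
    have i3: "integrable lebesgue (\<lambda>x. 1 * indicator ?Q x * (q n x - c))"
      using Bochner_Integration.integrable_diff[OF iqQ[of "\<lambda>x. 1"] integrable_mult_right[OF iQ, of c]] iQ by (simp add: algebra_simps)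
    show ?thesis
      using iqQ[OF wmQ] wmQ i3 qc m
      by (subst Bochner_Integration.integral_add Bochner_Integration.integral_diff;
          (intro Bochner_Integration.integrable_diff integrable_mult_right | simp))+
  qed
  finally have "(LINT x|lebesgue. w x * indicator ?Q x * (q n x - c)) > (LINT x|lebesgue. \<bar>w x - m\<bar> * indicator ?Q x) - \<kappa> "
    using n \<kappa> by simp
  from order_tendstoD(1)[OF conv[OF wQ] this] w
  obtain j where j: "(LINT x|lebesgue. w x * divergence (\<phi> j) x) > (LINT x|lebesgue. \<bar>w x - m\<bar> * indicator ?Q x) - \<kappa>"
    by (auto simp: eventually_sequentially)
  show ?thesis
    by (rule that[of "\<phi> j"]) (use \<phi> bd out j in auto)
qed

subsection \<open>Geometry of meshes\<close>

text \<open>Nonempty open sets have positive measure. This converts the condition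
  \<open>tiles\<close>, which holds only up to null sets, into genuine inclusions.\<close>

lemma open_subset_lebesgue_null_empty:
  assumes "open S" "S \<subseteq> N" "N \<in> null_sets lebesgue"
  shows "S = ({} :: ('a::euclidean_space) set)"
  using assms by (meson negligible_iff_null_sets negligible_subset open_not_negligible)

locale tiled_domain =
  fixes \<Omega> :: "(real^'n) set" and h :: real and \<Q> :: "(real^'n) set set"
  assumes domain: "bounded_lipschitz_domain \<Omega>" and mesh: "mesh \<Omega> h \<Q>"
begin

lemma h_pos: "h > 0" and finite_cells: "finite \<Q>"
  and cellE: "Q \<in> \<Q> \<Longrightarrow> \<exists>a. Q = cube a h"
  and null1: "\<Union>\<Q> - \<Omega> \<in> null_sets lebesgue" and null2: "\<Omega> - \<Union>\<Q> \<in> null_sets lebesgue"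
  and interior_disjoint: "Q \<in> \<Q> \<Longrightarrow> Q' \<in> \<Q> \<Longrightarrow> Q \<noteq> Q' \<Longrightarrow> interior Q \<inter> interior Q' = {}"
  and face: "Q \<in> \<Q> \<Longrightarrow> Q' \<in> \<Q> \<Longrightarrow> Q \<noteq> Q' \<Longrightarrow> (Q \<inter> Q') face_of Q"
  using mesh unfolding mesh_def tiles_def
  by (auto simp flip: negligible_iff_null_sets)

lemma open_domain: "open \<Omega>" and bounded_domain: "bounded \<Omega>"
  using domain by (auto simp: bounded_lipschitz_domain_def)

lemma closed_cell: "Q \<in> \<Q> \<Longrightarrow> closed Q"
  using cellE[of Q] by (auto simp: cube_eq)

lemma closed_Union_cells: "\<S> \<subseteq> \<Q> \<Longrightarrow> closed (\<Union>\<S>)"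
  using finite_cells closed_cell by (meson closed_Union finite_subset subsetD)

lemma domain_subset_cells: "\<Omega> \<subseteq> \<Union>\<Q>"
proof -
  have "\<Omega> - \<Union>\<Q> = {}"
    by (rule open_subset_lebesgue_null_empty[OF _ order.refl null2])
      (use open_domain closed_Union_cells[of \<Q>] in auto)
  then show ?thesis by blast
qed

lemma interior_cube: "interior (cube a t) = box a (a + vec t)"
  by (simp add: cube_eq interior_cbox)

text \<open>A neighbourhood of a point of a cell meets the interior of the cell in a nonempty open
  set, which cannot lie in the null set \<open>\<Union>\<Q> - \<Omega>\<close>.\<close>

lemma cells_subset_closure: "Q \<in> \<Q> \<Longrightarrow> Q \<subseteq> closure \<Omega>"
proof
  fix x assume Q: "Q \<in> \<Q>" and x: "x \<in> Q"
  obtain a where a: "Q = cube a h" using cellE[OF Q] by auto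
  have "a + vec (h / 2) \<in> box a (a + vec h)" using h_pos by (simp add: mem_box_cart)
  then have ne: "box a (a + vec h) \<noteq> {}" by blast
  show "x \<in> closure \<Omega>"
    unfolding closure_iff_nhds_not_empty
  proof (intro allI impI)
    fix A V assume V: "V \<subseteq> A" "open V" "x \<in> V"
    have "x \<in> closure (box a (a + vec h))"
      using x unfolding a cube_eq closure_box[OF ne] .
    then have "V \<inter> box a (a + vec h) \<noteq> {}"
      using V closure_iff_nhds_not_empty[of x "box a (a + vec h)"] by (metis Int_commute order.refl)
    moreover have "V \<inter> box a (a + vec h) \<subseteq> \<Union>\<Q> - \<Omega>" if "\<Omega> \<inter> A = {}"
      using that V(1) Q box_subset_cbox[of a "a + vec h"] unfolding a cube_eq by blast
    ultimately show "\<Omega> \<inter> A \<noteq> {}"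
      using open_subset_lebesgue_null_empty[OF _ _ null1, of "V \<inter> box a (a + vec h)"] V(2) by blast
  qed
qed

text \<open>A Lipschitz domain lies on one side of its boundary, so it has no slits.\<close>

lemma interior_cells: "interior (\<Union>\<Q>) = \<Omega>"
proof
  show "\<Omega> \<subseteq> interior (\<Union>\<Q>)"
    using domain_subset_cells open_domain by (simp add: interior_maximal)
  show "interior (\<Union>\<Q>) \<subseteq> \<Omega>"
  proof (rule ccontr)
    assume "\<not> interior (\<Union>\<Q>) \<subseteq> \<Omega>"
    then obtain x where x: "x \<in> interior (\<Union>\<Q>)" "x \<notin> \<Omega>" by blast
    have "x \<in> closure \<Omega>" using x(1) interior_subset cells_subset_closure by blast
    then have "x \<in> frontier \<Omega>" using x(2) open_domain by (simp add: frontier_def interior_open)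
    with domain obtain r \<nu> L \<gamma> where r: "r > 0" and \<nu>: "norm \<nu> = 1"
      and \<gamma>: "L-lipschitz_on {z. z \<bullet> \<nu> = 0} \<gamma>"
      and iff: "\<And>y. y \<in> ball x r \<Longrightarrow> y \<in> \<Omega> \<longleftrightarrow> y \<bullet> \<nu> < \<gamma> (y - (y \<bullet> \<nu>) *\<^sub>R \<nu>)"
      unfolding bounded_lipschitz_domain_def lipschitz_boundary_def by meson
    have \<nu>\<nu>: "\<nu> \<bullet> \<nu> = 1" using \<nu> by (simp add: norm_eq_sqrt_inner)
    \<comment> \<open>The open region strictly above the graph. Near \<open>x\<close> it lies
      outside \<Omega> but inside the cells, hence in a null set; moving \<open>x\<close> upwards
      along \<nu> shows that it is nonempty there, a contradiction.\<close>
    define S where "S = {y. \<gamma> (y - (y \<bullet> \<nu>) *\<^sub>R \<nu>) < y \<bullet> \<nu>}"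
    have "continuous_on UNIV (\<lambda>y. \<gamma> (y - (y \<bullet> \<nu>) *\<^sub>R \<nu>))"
      by (rule continuous_on_compose2[OF lipschitz_on_continuous_on[OF \<gamma>]])
        (auto intro!: continuous_intros simp: inner_diff_left \<nu>\<nu>)
    then have S: "open S" unfolding S_def by (intro open_Collect_less continuous_intros)
    obtain e where e: "e > 0" "ball x e \<subseteq> \<Union>\<Q>" using x(1) by (auto simp: mem_interior)
    define d where "d = min r e / 2"
    have d: "0 < d" "d < r" "d < e" using r e by (auto simp: d_def)
    have "x + d *\<^sub>R \<nu> \<in> S"
    proof -
      have "\<not> x \<bullet> \<nu> < \<gamma> (x - (x \<bullet> \<nu>) *\<^sub>R \<nu>)" using iff[of x] r x(2) by simp
      then show ?thesis using d by (simp add: S_def inner_add_left \<nu>\<nu> algebra_simps)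
    qed
    moreover have "x + d *\<^sub>R \<nu> \<in> ball x r \<inter> ball x e" using d \<nu> by (simp add: dist_norm)
    moreover have "S \<inter> ball x r \<inter> ball x e \<subseteq> \<Union>\<Q> - \<Omega>"
    proof
      fix z assume "z \<in> S \<inter> ball x r \<inter> ball x e"
      then show "z \<in> \<Union>\<Q> - \<Omega>" using e(2) iff[of z] unfolding S_def by (simp add: subset_iff)
    qed
    ultimately show False
      using open_subset_lebesgue_null_empty[OF _ _ null1, of "S \<inter> ball x r \<inter> ball x e"] S by blast
  qed
qed

lemma box_subset_domain: "cube a h \<in> \<Q> \<Longrightarrow> box a (a + vec h) \<subseteq> \<Omega>"
  using interior_mono[of "cube a h" "\<Union>\<Q>"] by (auto simp: interior_cube interior_cells)

lemma AE_in_cell: "AE x in lebesgue. x \<in> \<Omega> \<longleftrightarrow> (\<exists>a. cube a h \<in> \<Q> \<and> x \<in> box a (a + vec h))"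
proof -
  have "AE x in lebesgue. \<forall>Q\<in>\<Q>. x \<in> Q \<longrightarrow> x \<in> interior Q"
  proof (rule AE_finite_allI[OF finite_cells])
    fix Q assume "Q \<in> \<Q>"
    then obtain a where "Q = cube a h" using cellE by blast
    then show "AE x in lebesgue. x \<in> Q \<longrightarrow> x \<in> interior Q"
      using AE_box_of_cbox[of a "a + vec h"] by (simp add: interior_cube) (simp add: cube_eq)
  qed
  then show ?thesis
  proof eventually_elim
    case (elim x)
    show ?case
    proof
      assume "x \<in> \<Omega>"
      then obtain Q where Q: "Q \<in> \<Q>" "x \<in> Q" using domain_subset_cells by blast
      moreover obtain a where "Q = cube a h" using cellE[OF Q(1)] by blast
      ultimately show "\<exists>a. cube a h \<in> \<Q> \<and> x \<in> box a (a + vec h)"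
        using elim interior_cube by blast
    qed (use box_subset_domain in blast)
  qed
qed

section \<open>Interior and boundary facets\<close>

definition facet_point :: "real^'n \<Rightarrow> 'n \<Rightarrow> real \<Rightarrow> real^'n \<Rightarrow> bool" where
  "facet_point a i s x \<longleftrightarrow> cube a h \<in> \<Q> \<and> (s = a $ i \<or> s = a $ i + h) \<and> x $ i = s \<and>
     (\<forall>j. j \<noteq> i \<longrightarrow> a $ j < x $ j \<and> x $ j < a $ j + h)"

lemma facet_point_in: "facet_point a i s x \<Longrightarrow> x \<in> cube a h"
proof -
  assume f: "facet_point a i s x"
  have "a $ k \<le> x $ k \<and> x $ k \<le> a $ k + h" for k
    using f h_pos by (cases "k = i") (auto simp: facet_point_def less_imp_le)
  then show ?thesis by (simp add: cube_cbox)
qed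

text \<open>Conformity at work: the common part of two cells is a face of each, and a face that
  contains a relatively interior point of a facet contains the whole facet.\<close>

lemma facet_subset_neighbour:
  assumes f: "facet_point a i s x" and Q': "Q' \<in> \<Q>" "Q' \<noteq> cube a h" "x \<in> Q'"
    and y: "y \<in> cube a h" "y $ i = s"
  shows "y \<in> Q'"
proof (cases "y = x")
  case False
  let ?Q = "cube a h"
  have Q: "?Q \<in> \<Q>" and xi: "x $ i = s" and xj: "\<And>j. j \<noteq> i \<Longrightarrow> a $ j < x $ j \<and> x $ j < a $ j + h"
    using f by (auto simp: facet_point_def)
  have x: "x \<in> ?Q" by (rule facet_point_in[OF f])
  have "\<forall>\<^sub>F t in at_right 0. \<forall>j\<in>UNIV. j \<noteq> i \<longrightarrow> a $ j < x $ j + t * (x $ j - y $ j) \<and> x $ j + t * (x $ j - y $ j) < a $ j + h"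
  proof (rule eventually_ball_finite)
    show "\<forall>j\<in>UNIV. \<forall>\<^sub>F t in at_right 0. j \<noteq> i \<longrightarrow> a $ j < x $ j + t * (x $ j - y $ j) \<and> x $ j + t * (x $ j - y $ j) < a $ j + h"
    proof
      fix j
      show "\<forall>\<^sub>F t in at_right 0. j \<noteq> i \<longrightarrow> a $ j < x $ j + t * (x $ j - y $ j) \<and> x $ j + t * (x $ j - y $ j) < a $ j + h"
      proof (cases "j = i")
        case False
        have "((\<lambda>t. x $ j + t * (x $ j - y $ j)) \<longlongrightarrow> x $ j + 0 * (x $ j - y $ j)) (at_right 0)"
          by (intro tendsto_intros)
        then have l: "((\<lambda>t. x $ j + t * (x $ j - y $ j)) \<longlongrightarrow> x $ j) (at_right 0)" by simp
        show ?thesis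
          using order_tendstoD(1)[OF l, of "a $ j"] order_tendstoD(2)[OF l, of "a $ j + h"] xj[OF False]
          by (simp add: eventually_conj_iff)
      qed simp
    qed
  qed simp
  then have "\<forall>\<^sub>F t in at_right 0. 0 < t \<and> (\<forall>j. j \<noteq> i \<longrightarrow> a $ j < x $ j + t * (x $ j - y $ j) \<and> x $ j + t * (x $ j - y $ j) < a $ j + h)"
    using eventually_at_right_less[of "0::real"] by eventually_elim auto
  then obtain t where t: "0 < t" "\<And>j. j \<noteq> i \<Longrightarrow> a $ j < x $ j + t * (x $ j - y $ j) \<and> x $ j + t * (x $ j - y $ j) < a $ j + h"
    using eventually_happens[of _ "at_right (0::real)"] trivial_limit_at_right_real by blast
  \<comment> \<open>Prolonging the segment from \<open>y\<close> beyond \<open>x\<close> by a small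
    \<open>t\<close> stays in the facet because \<open>x\<close> is relatively interior. Then
    \<open>x\<close> lies strictly between \<open>y\<close> and \<open>z\<close>, and the face
    property pulls \<open>y\<close> into \<open>Q'\<close>.\<close>
  define z where "z = x + t *\<^sub>R (x - y)"
  have "facet_point a i s z" using f t(2) xi y(2) by (auto simp: facet_point_def z_def)
  then have z: "z \<in> ?Q" by (rule facet_point_in)
  have "x \<in> open_segment y z"
    unfolding in_segment
  proof (intro conjI exI[of _ "1 / (1 + t)"])
    have "z - y = (1 + t) *\<^sub>R (x - y)" by (simp add: z_def algebra_simps)
    then show "y \<noteq> z" using False t(1) by auto
    have "(1 + t) *\<^sub>R ((1 - 1 / (1 + t)) *\<^sub>R y + (1 / (1 + t)) *\<^sub>R z) = (1 + t) *\<^sub>R x"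
      using t(1) by (simp add: scaleR_add_right z_def right_diff_distrib) (simp add: algebra_simps)
    then show "x = (1 - 1 / (1 + t)) *\<^sub>R y + (1 / (1 + t)) *\<^sub>R z"
      using t(1) by simp
  qed (use t in auto)
  then have "y \<in> ?Q \<inter> Q'"
    using face_ofD[OF face[OF Q Q'(1) Q'(2)[symmetric]] _ y(1) z] x Q'(3) by blast
  then show ?thesis by blast
qed (use Q' in simp)

text \<open>A neighbour across the facet is the translate of the cell by \<open>h\<close> along axis
  \<open>i\<close>. The two cells fill a neighbourhood of \<open>x\<close>, so \<open>x\<close> is
  interior to the union of the cells, which is \<Omega> by \<open>interior_cells\<close>.\<close>

lemma facet_neighbour_imp_domain:
  assumes f: "facet_point a i s x" and Q': "Q' \<in> \<Q>" "Q' \<noteq> cube a h" "x \<in> Q'"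
  shows "x \<in> \<Omega>"
proof -
  obtain b where b: "Q' = cube b h" using cellE[OF Q'(1)] by blast
  have s: "s = a $ i \<or> s = a $ i + h" and Q: "cube a h \<in> \<Q>" using f by (auto simp: facet_point_def)
  \<comment> \<open>Two opposite corners of the facet lie in \<open>Q'\<close>, which leaves no
    freedom for the coordinates of \<open>b\<close> other than \<open>i\<close>.\<close>
  have "upd a i s \<in> Q'" "upd (a + vec h) i s \<in> Q'"
    using s h_pos by (auto intro!: facet_subset_neighbour[OF f Q'] simp: cube_cbox)
  then have bj: "b $ j = a $ j" if "j \<noteq> i" for j
    using that unfolding b cube_cbox by (auto dest!: spec[of _ j])
  have bi: "b $ i \<le> s" "s \<le> b $ i + h"
    using Q'(3) f unfolding b cube_cbox facet_point_def by auto
  have "a \<noteq> b" using Q'(2) b by auto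
  then have abi: "a $ i \<noteq> b $ i" using bj by (auto simp: vec_eq_iff) metis
  have "\<bar>a $ i - b $ i\<bar> \<ge> h"
  proof (rule ccontr)
    assume "\<not> \<bar>a $ i - b $ i\<bar> \<ge> h"
    then have "upd (a + vec (h / 2)) i ((a $ i + b $ i + h) / 2) \<in> box a (a + vec h) \<inter> box b (b + vec h)"
      using h_pos bj by (auto simp: mem_box_cart)
    then show False
      using interior_disjoint[OF Q Q'(1) Q'(2)[symmetric]] unfolding b interior_cube by blast
  qed
  with s bi abi have bi': "s = a $ i \<and> b $ i = a $ i - h \<or> s = a $ i + h \<and> b $ i = a $ i + h"
    by linarith
  let ?N = "box (upd a i (s - h)) (upd (a + vec h) i (s + h))"
  have "?N \<subseteq> \<Union>\<Q>"
  proof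
    fix z assume z: "z \<in> ?N"
    have zj: "a $ j < z $ j \<and> z $ j < a $ j + h" if "j \<noteq> i" for j
      using z that by (auto simp: mem_box_cart dest!: spec[of _ j])
    have zi: "s - h < z $ i" "z $ i < s + h" using z by (auto simp: mem_box_cart dest!: spec[of _ i])
    consider "a $ i \<le> z $ i \<and> z $ i \<le> a $ i + h" | "b $ i \<le> z $ i \<and> z $ i \<le> b $ i + h"
      using zi bi' by linarith
    then have "z \<in> cube a h \<or> z \<in> cube b h"
    proof cases
      case 1
      then have "a $ j \<le> z $ j \<and> z $ j \<le> a $ j + h" for j
        using zj[of j] by (cases "j = i") auto
      then show ?thesis by (simp add: cube_cbox)
    next
      case 2
      then have "b $ j \<le> z $ j \<and> z $ j \<le> b $ j + h" for j
        using zj[of j] bj[of j] by (cases "j = i") auto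
      then show ?thesis by (simp add: cube_cbox)
    qed
    then show "z \<in> \<Union>\<Q>" using Q Q'(1) b by blast
  qed
  moreover have "x \<in> ?N" using f h_pos by (auto simp: mem_box_cart facet_point_def)
  ultimately have "x \<in> interior (\<Union>\<Q>)" by (meson interior_maximal open_box subsetD)
  then show ?thesis by (simp add: interior_cells)
qed

definition boundary_facet :: "real^'n \<Rightarrow> 'n \<Rightarrow> real \<Rightarrow> bool" where
  "boundary_facet a i s \<longleftrightarrow> cube a h \<in> \<Q> \<and> (s = a $ i \<or> s = a $ i + h) \<and>
     (\<forall>x Q'. facet_point a i s x \<longrightarrow> Q' \<in> \<Q> \<longrightarrow> x \<in> Q' \<longrightarrow> Q' = cube a h)"

text \<open>A single point decides: a neighbour touching the open facet anywhere would contain all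
  of it, and then \<open>x\<close> would lie in \<Omega>.\<close>

lemma boundary_facetI:
  assumes f: "facet_point a i s x" and x: "x \<notin> \<Omega>"
  shows "boundary_facet a i s"
  unfolding boundary_facet_def
proof (intro conjI allI impI)
  show "cube a h \<in> \<Q>" "s = a $ i \<or> s = a $ i + h" using f by (auto simp: facet_point_def)
  fix y Q' assume y: "facet_point a i s y" "Q' \<in> \<Q>" "y \<in> Q'"
  show "Q' = cube a h"
  proof (rule ccontr)
    assume *: "Q' \<noteq> cube a h"
    have "x \<in> Q'"
      by (rule facet_subset_neighbour[OF y(1,2) * y(3) facet_point_in[OF f]]) (use f in \<open>simp add: facet_point_def\<close>)
    then show False using facet_neighbour_imp_domain[OF f y(2) *] x by blast
  qed
qed

text \<open>Near a point of the open facet no other cell is present, so \<Omega> is locally a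
  half-space. This gives access to the normal condition in \<open>RT0_0\<close>, which speaks only
  of points that have an outer normal.\<close>

lemma boundary_facet_normal:
  assumes B: "boundary_facet a i s" and f: "facet_point a i s y"
  obtains \<sigma> :: real where "\<sigma> \<noteq> 0" "outer_unit_normal \<Omega> y (\<sigma> *\<^sub>R axis i 1)" "y \<in> frontier \<Omega>"
proof -
  have Q: "cube a h \<in> \<Q>" and s: "s = a $ i \<or> s = a $ i + h" and yi: "y $ i = s"
    and yj: "\<And>j. j \<noteq> i \<Longrightarrow> a $ j < y $ j \<and> y $ j < a $ j + h"
    using f by (auto simp: facet_point_def)
  define \<sigma> :: real where "\<sigma> = (if s = a $ i then -1 else 1)"
  have \<sigma>: "\<bar>\<sigma>\<bar> = 1" by (simp add: \<sigma>_def)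
  let ?n = "\<sigma> *\<^sub>R axis i 1 :: real^'n"
  \<comment> \<open>The box reaches one cell beyond the facet on either side; removing the other
    cells leaves an open set in which membership in \<Omega> is decided by the sign of
    \<open>z $ i - s\<close>.\<close>
  let ?N = "box (upd a i (s - h)) (upd (a + vec h) i (s + h)) \<inter> - \<Union>(\<Q> - {cube a h})"
  have "open ?N" by (intro open_Int open_box open_Compl closed_Union_cells) auto
  moreover have "y \<in> ?N"
  proof
    show "y \<in> box (upd a i (s - h)) (upd (a + vec h) i (s + h))"
      using yi yj h_pos by (auto simp: mem_box_cart)
    show "y \<in> - \<Union>(\<Q> - {cube a h})" using B f unfolding boundary_facet_def by blast
  qed
  ultimately obtain r where r: "r > 0" "ball y r \<subseteq> ?N" by (metis open_contains_ball)
  have inner: "(z - y) \<bullet> ?n = \<sigma> * (z $ i - s)" for z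
    by (simp add: inner_axis yi)
  have inside: "z \<in> \<Omega>" if "z \<in> ball y r" "(z - y) \<bullet> ?n < 0" for z
  proof -
    have z: "z \<in> box (upd a i (s - h)) (upd (a + vec h) i (s + h))" using that r by blast
    have "a $ j < z $ j \<and> z $ j < a $ j + h" for j
    proof (cases "j = i")
      case True
      have "s - h < z $ i" "z $ i < s + h" using z by (auto simp: mem_box_cart dest!: spec[of _ i])
      then show ?thesis using True that(2)[unfolded inner] s by (auto simp: \<sigma>_def split: if_splits)
    next
      case False
      then show ?thesis using z by (auto simp: mem_box_cart dest!: spec[of _ j])
    qed
    then have "z \<in> box a (a + vec h)" by (simp add: mem_box_cart)
    then show ?thesis using box_subset_domain[OF Q] by blast
  qed
  have outside: "z \<notin> \<Omega>" if "z \<in> ball y r" "(z - y) \<bullet> ?n > 0" for z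
  proof -
    have "z \<notin> cube a h"
      using that(2)[unfolded inner] s h_pos by (auto simp: \<sigma>_def cube_cbox split: if_splits intro!: exI[of _ i])
    moreover have "z \<notin> \<Union>(\<Q> - {cube a h})" using that(1) r(2) by blast
    ultimately show ?thesis using domain_subset_cells by blast
  qed
  show ?thesis
  proof (rule that[of \<sigma>])
    show "\<sigma> \<noteq> 0" using \<sigma> by auto
    show "outer_unit_normal \<Omega> y ?n"
      unfolding outer_unit_normal_def
    proof (intro conjI allI impI)
      show "norm ?n = 1" using \<sigma> by (simp add: norm_axis_1)
      fix e :: real assume e: "e > 0"
      show "\<exists>r>0. \<forall>z\<in>ball y r. ((z - y) \<bullet> ?n < - e * norm (z - y) \<longrightarrow> z \<in> \<Omega>) \<and>
          (e * norm (z - y) < (z - y) \<bullet> ?n \<longrightarrow> z \<notin> \<Omega>)"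
      proof (intro exI[of _ r] conjI ballI impI)
        fix z assume z: "z \<in> ball y r"
        have e0: "0 \<le> e * norm (z - y)" using e by simp
        show "z \<in> \<Omega>" if "(z - y) \<bullet> ?n < - e * norm (z - y)"
          using inside[OF z] that e0 by linarith
        show "z \<notin> \<Omega>" if "e * norm (z - y) < (z - y) \<bullet> ?n"
          using outside[OF z] that e0 by linarith
      qed (rule r)
    qed
    have "y \<notin> \<Omega>"
    proof
      assume "y \<in> \<Omega>"
      then obtain e where e: "e > 0" "ball y e \<subseteq> \<Omega>" using open_domain open_contains_ball by blast
      define d where "d = min r e / 2"
      have d: "0 < d" "d < r" "d < e" using r e by (auto simp: d_def)
      let ?z = "y + d *\<^sub>R ?n"
      have "norm (d *\<^sub>R ?n) = d" using d \<sigma> by (simp add: norm_axis_1 abs_mult)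
      then have "?z \<in> ball y r" "?z \<in> ball y e" using d by (auto simp: dist_norm)
      moreover have "(?z - y) \<bullet> ?n > 0" using d \<sigma> unfolding inner by (simp add: yi \<sigma>_def split: if_splits)
      ultimately show False using outside e(2) by blast
    qed
    then show "y \<in> frontier \<Omega>"
      using cells_subset_closure[OF Q] facet_point_in[OF f] open_domain by (auto simp: frontier_def interior_open)
  qed
qed

text \<open>A frontier point lies in some closed cell, but in no open cell, so at least one
  coordinate sits at a face level.\<close>

lemma frontier_cases:
  assumes "x \<in> frontier \<Omega>"
  obtains a i s where "cube a h \<in> \<Q>" "x \<in> cube a h" "s = a $ i \<or> s = a $ i + h" "x $ i = s"
proof -
  have "x \<in> closure \<Omega>" "x \<notin> \<Omega>" using assms open_domain by (auto simp: frontier_def interior_open)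
  then have "x \<in> \<Union>\<Q>" using domain_subset_cells closed_Union_cells[of \<Q>] by (meson closure_minimal order.refl subsetD)
  then obtain a where a: "cube a h \<in> \<Q>" "x \<in> cube a h" using cellE by blast
  have "x \<notin> box a (a + vec h)" using box_subset_domain[OF a(1)] \<open>x \<notin> \<Omega>\<close> by blast
  then obtain i where "\<not> (a $ i < x $ i \<and> x $ i < a $ i + h)" by (auto simp: mem_box_cart)
  moreover have "a $ i \<le> x $ i" "x $ i \<le> a $ i + h" using a(2) by (auto simp: cube_cbox)
  ultimately have "x $ i = a $ i \<or> x $ i = a $ i + h" by linarith
  then show ?thesis using that[of a "x $ i" i] a by blast
qed

end

subsection \<open>Raviart--Thomas fields on a mesh\<close>

text \<open>Completeness of Lebesgue measure. It allows integrands containing \<phi> or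
  \<open>g\<close> to be exchanged for their polynomial versions on the cells.\<close>

lemma lebesgue_measurable_AE_eq:
  fixes f k :: "'a::euclidean_space \<Rightarrow> 'b::topological_space"
  assumes f: "f \<in> borel_measurable lebesgue" and e: "AE x in lebesgue. f x = k x"
  shows "k \<in> borel_measurable lebesgue"
proof (rule measurableI)
  fix A :: "'b set" assume A: "A \<in> sets borel"
  obtain N where N: "{x. f x \<noteq> k x} \<subseteq> N" "N \<in> null_sets lebesgue"
    using e by (auto simp: eventually_ae_filter)
  have eq: "k -` A \<inter> space lebesgue = (f -` A \<inter> space lebesgue - N) \<union> (k -` A \<inter> N)"
  proof (rule set_eqI)
    fix x
    show "x \<in> k -` A \<inter> space lebesgue \<longleftrightarrow> x \<in> (f -` A \<inter> space lebesgue - N) \<union> (k -` A \<inter> N)"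
      using N(1) by (cases "f x = k x") auto
  qed
  have "k -` A \<inter> N \<in> sets lebesgue"
    using N(2) by (meson Int_lower2 negligible_iff_null_sets negligible_imp_sets negligible_subset)
  then show "k -` A \<inter> space lebesgue \<in> sets lebesgue"
    unfolding eq by (intro sets.Un sets.Diff measurable_sets[OF f A] null_setsD2[OF N(2)])
qed auto

lemma lebesgue_integral_AE_eq:
  fixes f k :: "'a::euclidean_space \<Rightarrow> real"
  assumes f: "f \<in> borel_measurable lebesgue" and e: "AE x in lebesgue. f x = k x"
  shows "(LINT x|lebesgue. k x) = (LINT x|lebesgue. f x)" "integrable lebesgue k \<longleftrightarrow> integrable lebesgue f"
proof -
  have k: "k \<in> borel_measurable lebesgue" by (rule lebesgue_measurable_AE_eq[OF f e])
  have e': "AE x in lebesgue. k x = f x" using e by (auto elim: eventually_mono)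
  show "(LINT x|lebesgue. k x) = (LINT x|lebesgue. f x)" by (rule integral_cong_AE[OF k f e'])
  show "integrable lebesgue k \<longleftrightarrow> integrable lebesgue f" by (rule integrable_cong_AE[OF k f e'])
qed

lemma integrable_mult_AE_bounded:
  fixes u k :: "'a::euclidean_space \<Rightarrow> real"
  assumes "integrable lebesgue u" "k \<in> borel_measurable lebesgue" "AE x in lebesgue. \<bar>k x\<bar> \<le> B"
  shows "integrable lebesgue (\<lambda>x. u x * k x)"
proof (rule Bochner_Integration.integrable_bound)
  show "integrable lebesgue (\<lambda>x. B * u x)" using assms(1) by simp
  show "(\<lambda>x. u x * k x) \<in> borel_measurable lebesgue"
    by (rule borel_measurable_times[OF borel_measurable_integrable[OF assms(1)] assms(2)])
  show "AE x in lebesgue. norm (u x * k x) \<le> norm (B * u x)"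
    using assms(3)
  proof eventually_elim
    case (elim x)
    then have "\<bar>k x\<bar> * \<bar>u x\<bar> \<le> \<bar>B\<bar> * \<bar>u x\<bar>" by (intro mult_right_mono) auto
    then show ?case by (simp add: abs_mult mult.commute)
  qed
qed

lemma integrable_mult_bounded:
  fixes u k :: "'a::euclidean_space \<Rightarrow> real"
  assumes "integrable lebesgue u" "k \<in> borel_measurable lebesgue" "\<And>x. \<bar>k x\<bar> \<le> B"
  shows "integrable lebesgue (\<lambda>x. u x * k x)"
  using assms by (intro integrable_mult_AE_bounded[of _ _ B]) auto

lemma C1c_outside: "\<psi> \<in> C1c \<Omega> \<Longrightarrow> x \<notin> \<Omega> \<Longrightarrow> \<psi> x = 0"
  using closure_subset[of "{x. \<psi> x \<noteq> 0}"] unfolding C1c_def by blast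

lemma C1c_deriv_outside:
  fixes \<psi> :: "real^'n \<Rightarrow> 'b::euclidean_space"
  assumes "\<psi> \<in> C1c \<Omega>" "x \<notin> \<Omega>"
  shows "frechet_derivative \<psi> (at x) = (\<lambda>v. 0)"
proof -
  have "closure {x. \<psi> x \<noteq> 0} \<subseteq> \<Omega>" using assms(1) by (simp add: C1c_def)
  then have x: "x \<in> - closure {x. \<psi> x \<noteq> 0}" using assms(2) by blast
  have "open (- closure {x. \<psi> x \<noteq> 0})" by (rule open_Compl[OF closed_closure])
  from eventually_nhds_in_open[OF this x] have "\<forall>\<^sub>F y in nhds x. y \<in> - closure {x. \<psi> x \<noteq> 0}" .
  then have "\<forall>\<^sub>F y in nhds x. \<psi> y = 0"
    using closure_subset[of "{x. \<psi> x \<noteq> 0}"] by (auto elim!: eventually_mono)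
  then have e: "\<forall>\<^sub>F y in at x. 0 = \<psi> y" "\<psi> x = 0"
    by (auto simp: eventually_nhds_conv_at elim: eventually_mono)
  have "(\<psi> has_derivative (\<lambda>v. 0)) (at x)"
    by (rule has_derivative_transform_eventually[OF _ e(1)]) (use e(2) in auto)
  then show ?thesis by (metis frechet_derivative_at)
qed

lemma C1c_mono: "\<Omega> \<subseteq> \<Omega>' \<Longrightarrow> C1c \<Omega> \<subseteq> C1c \<Omega>'"
  unfolding C1c_def by blast

lemma C1c_integrable:
  fixes \<psi> :: "real^'n \<Rightarrow> real"
  assumes "\<psi> \<in> C1c \<Omega>"
  shows "integrable lebesgue \<psi>" "integrable lebesgue (\<lambda>x. frechet_derivative \<psi> (at x) v)"
proof -
  define K where "K = closure {x. \<psi> x \<noteq> 0}"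
  have K: "compact K" using assms by (auto simp: C1c_def K_def)
  have C: "C1 \<psi> (\<lambda>x. frechet_derivative \<psi> (at x))" by (rule C1c_imp_C1[OF assms])
  have z: "\<psi> x = 0" if "x \<notin> K" for x
    using that closure_subset[of "{x. \<psi> x \<noteq> 0}"] unfolding K_def by blast
  show "integrable lebesgue (\<lambda>x. frechet_derivative \<psi> (at x) v)"
    by (rule integral_directional_derivative_eq_0(1)[OF C K z])
  have "bounded (\<psi> ` K)" using C1D(4)[OF C] K by (intro compact_imp_bounded compact_continuous_image)
  then obtain b where "\<And>x. x \<in> K \<Longrightarrow> \<bar>\<psi> x\<bar> \<le> b" by (auto simp: bounded_iff)
  then show "integrable lebesgue \<psi>"
    using z by (intro integrable_lebesgue_bounded_support[OF continuous_imp_measurable_lebesgue[OF C1D(4)[OF C]] compact_imp_bounded[OF K]]) auto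
qed

lemma C1c_bounded:
  fixes \<psi> :: "real^'n \<Rightarrow> real"
  assumes "\<psi> \<in> C1c \<Omega>"
  obtains B where "\<And>x. \<bar>\<psi> x\<bar> \<le> B" "\<And>x i. \<bar>frechet_derivative \<psi> (at x) (axis i 1)\<bar> \<le> B"
proof -
  define K where "K = closure {x. \<psi> x \<noteq> 0}"
  have K: "compact K" using assms by (auto simp: C1c_def K_def)
  have CK: "\<psi> \<in> C1c K" using assms by (auto simp: C1c_def K_def)
  have C: "C1 \<psi> (\<lambda>x. frechet_derivative \<psi> (at x))" by (rule C1c_imp_C1[OF assms])
  define f where "f x = \<bar>\<psi> x\<bar> + (\<Sum>i\<in>UNIV. \<bar>frechet_derivative \<psi> (at x) (axis i 1)\<bar>)" for x
  have "continuous_on K f"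
    unfolding f_def[abs_def] by (intro continuous_intros C1D(4)[OF C] continuous_on_subset[OF C1D(2)[OF C]]) auto
  then have "bounded (f ` K)" using K by (intro compact_imp_bounded compact_continuous_image)
  then obtain b where b: "\<And>x. x \<in> K \<Longrightarrow> \<bar>f x\<bar> \<le> b" by (auto simp: bounded_iff)
  have fb: "\<bar>f x\<bar> \<le> \<bar>b\<bar>" for x
  proof (cases "x \<in> K")
    case False
    then have "f x = 0" unfolding f_def using C1c_outside[OF CK] C1c_deriv_outside[OF CK] by simp
    then show ?thesis by simp
  qed (use b in force)
  show ?thesis
  proof
    fix x
    have "0 \<le> (\<Sum>i\<in>UNIV. \<bar>frechet_derivative \<psi> (at x) (axis i 1)\<bar>)" by (intro sum_nonneg) auto
    then show "\<bar>\<psi> x\<bar> \<le> \<bar>b\<bar>" using fb[of x] unfolding f_def by linarith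
    fix i
    have "\<bar>frechet_derivative \<psi> (at x) (axis i 1)\<bar> \<le> (\<Sum>i\<in>UNIV. \<bar>frechet_derivative \<psi> (at x) (axis i 1)\<bar>)"
      by (rule member_le_sum) auto
    then show "\<bar>frechet_derivative \<psi> (at x) (axis i 1)\<bar> \<le> \<bar>b\<bar>" using fb[of x] unfolding f_def by linarith
  qed
qed

lemma linear_axis_expansion:
  fixes D :: "real^'n \<Rightarrow> real"
  assumes "bounded_linear D"
  shows "D v = (\<Sum>i\<in>UNIV. v $ i * D (axis i 1))"
proof -
  interpret D: bounded_linear D by fact
  have "D v = D (\<Sum>i\<in>UNIV. v $ i *\<^sub>R axis i 1)"
    using basis_expansion[of v] by (simp add: scalar_mult_eq_scaleR)
  then show ?thesis by (simp add: D.sum D.scaleR)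
qed

lemma AE_lebesgue_on_iff:
  "S \<in> sets lebesgue \<Longrightarrow> (AE x in lebesgue_on S. P x) \<longleftrightarrow> (AE x in lebesgue. x \<in> S \<longrightarrow> P x)"
  by (subst AE_restrict_space_iff) auto

lemma C1_rt0_poly: "C1 (\<lambda>x. rt0_poly a c x $ i) (\<lambda>x v. c $ i * v $ i)"
proof -
  have "C1 (\<lambda>x. a $ i + c $ i * x $ i) (\<lambda>x v. 0 + c $ i * v $ i)"
    by (intro C1_add C1_const C1_cmult C1_coord)
  then show ?thesis by (simp add: rt0_poly_def)
qed

text \<open>One competitor in the supremum \<open>TVh\<close>. The divergence \<open>g\<close> is a
  parameter because a weak divergence is determined only up to null sets; \<open>g_AE\<close>
  recovers its values.\<close>

locale rt0_field = tiled_domain \<Omega> h \<Q> for \<Omega> :: "(real^'n) set" and h \<Q> +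
  fixes \<phi> :: "real^'n \<Rightarrow> real^'n" and g :: "real^'n \<Rightarrow> real"
  assumes RT: "\<phi> \<in> RT0_0 \<Omega> \<Q>" and bound: "AE x in lebesgue_on \<Omega>. norm (\<phi> x) \<le> 1"
    and div: "has_L2_weak_divergence \<Omega> \<phi> g"
begin

lemma domain_measurable [measurable, simp]: "\<Omega> \<in> sets lebesgue"
  using open_domain by auto

lemma cube_measurable [simp]: "cube a h \<in> sets lebesgue" by (simp add: cube_eq)

definition coef :: "real^'n \<Rightarrow> (real^'n) \<times> (real^'n)" where
  "coef a = (SOME z. coincides_on (cube a h) \<phi> (rt0_poly (fst z) (snd z)))"

definition p :: "real^'n \<Rightarrow> real^'n \<Rightarrow> real^'n" where
  "p a = rt0_poly (fst (coef a)) (snd (coef a))"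

definition d :: "real^'n \<Rightarrow> real" where
  "d a = (\<Sum>i\<in>UNIV. snd (coef a) $ i)"

lemma p_coincides: "cube a h \<in> \<Q> \<Longrightarrow> coincides_on (cube a h) \<phi> (p a)"
proof -
  assume "cube a h \<in> \<Q>"
  then have "\<exists>A C. coincides_on (cube a h) \<phi> (rt0_poly A C)"
    using RT by (auto simp: RT0_0_def RT0_def)
  then have "\<exists>z. coincides_on (cube a h) \<phi> (rt0_poly (fst z) (snd z))" by auto
  from someI_ex[OF this] show ?thesis unfolding p_def coef_def .
qed

lemma p_AE: "cube a h \<in> \<Q> \<Longrightarrow> AE x in lebesgue. x \<in> cube a h \<longrightarrow> \<phi> x = p a x"
  using p_coincides[of a] by (simp add: coincides_on_def AE_lebesgue_on_iff)

lemma C1_p: "C1 (\<lambda>x. p a x $ i) (\<lambda>x v. snd (coef a) $ i * v $ i)"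
  unfolding p_def by (rule C1_rt0_poly)

lemma p_cont: "continuous_on S (p a)"
  unfolding p_def rt0_poly_def[abs_def] by (intro continuous_intros)

text \<open>The bound on \<phi> holds only almost everywhere, but \<open>p a\<close> is continuous:
  the set of violations in the open cell is open and null, hence empty, and taking the closure
  reaches the faces.\<close>

lemma p_bound:
  assumes "cube a h \<in> \<Q>" "x \<in> cube a h"
  shows "norm (p a x) \<le> 1"
proof -
  let ?b = "a + vec h"
  have op: "open {x \<in> box a ?b. 1 < norm (p a x)}"
  proof -
    have *: "open {x. 1 < norm (p a x)}" by (intro open_Collect_less continuous_intros p_cont)
    show ?thesis using open_Int[OF open_box *, of a ?b] by (simp add: Int_def)
  qed
  have ae: "AE x in lebesgue. x \<in> \<Omega> \<longrightarrow> norm (\<phi> x) \<le> 1"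
    using bound by (simp add: AE_lebesgue_on_iff)
  have "AE x in lebesgue. \<not> (x \<in> box a ?b \<and> 1 < norm (p a x))"
    using ae p_AE[OF assms(1)]
  proof eventually_elim
    case (elim x)
    then show ?case using box_subset_domain[OF assms(1)] box_subset_cbox[of a ?b] unfolding cube_eq by auto
  qed
  then obtain N where N: "{x. x \<in> box a ?b \<and> 1 < norm (p a x)} \<subseteq> N" "N \<in> null_sets lebesgue"
    by (auto simp: eventually_ae_filter)
  have "{x \<in> box a ?b. 1 < norm (p a x)} = {}"
    by (rule open_subset_lebesgue_null_empty[OF op _ N(2)]) (use N(1) in auto)
  then have "box a ?b \<subseteq> {x. norm (p a x) \<le> 1}" by (auto simp: not_less)
  moreover have "closed {x. norm (p a x) \<le> 1}" by (intro closed_Collect_le continuous_intros p_cont)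
  ultimately have "closure (box a ?b) \<subseteq> {x. norm (p a x) \<le> 1}" by (rule closure_minimal)
  moreover have "a + vec (h / 2) \<in> box a ?b" using h_pos by (simp add: mem_box_cart)
  then have "closure (box a ?b) = cube a h" unfolding cube_eq by (intro closure_box) blast
  ultimately show ?thesis using assms(2) by blast
qed

text \<open>An inverse inequality: between the opposite corners \<open>a\<close> and
  \<open>a + vec h\<close> component \<open>i\<close> changes by \<open>h\<close> times its slope,
  while both values lie in \<open>[-1, 1]\<close>. Summed over \<open>i\<close> it bounds the
  divergence.\<close>

lemma coef_bound: assumes "cube a h \<in> \<Q>" shows "\<bar>snd (coef a) $ i\<bar> \<le> 2 / h"
proof -
  have "a \<in> cube a h" "a + vec h \<in> cube a h" using h_pos by (auto simp: cube_cbox)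
  then have "\<bar>p a a $ i\<bar> \<le> 1" "\<bar>p a (a + vec h) $ i\<bar> \<le> 1"
    using p_bound[OF assms] component_le_norm_cart order.trans by blast+
  moreover have "p a (a + vec h) $ i - p a a $ i = snd (coef a) $ i * h"
    by (simp add: p_def rt0_poly_def algebra_simps)
  ultimately have "\<bar>snd (coef a) $ i * h\<bar> \<le> 2" by linarith
  then show ?thesis using h_pos by (simp add: abs_mult field_simps)
qed

lemma d_bound: assumes "cube a h \<in> \<Q>" shows "\<bar>d a\<bar> \<le> 2 * real CARD('n) / h"
proof -
  have "\<bar>d a\<bar> \<le> (\<Sum>i\<in>(UNIV::'n set). 2 / h)"
    unfolding d_def by (rule order.trans[OF sum_abs]) (intro sum_mono coef_bound assms)
  then show ?thesis by (simp add: mult.commute)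
qed

text \<open>Component \<open>i\<close> of an RT0 polynomial depends on \<open>x $ i\<close> alone,
  so vanishing at one point of the facet, its centre \<open>y\<close>, means vanishing on the whole
  hyperplane.\<close>

lemma p_boundary:
  assumes B: "boundary_facet a i s"
  shows "p a x $ i = snd (coef a) $ i * (x $ i - s)"
proof -
  define y where "y = upd (a + vec (h / 2)) i s"
  have Q: "cube a h \<in> \<Q>" using B by (simp add: boundary_facet_def)
  have f: "facet_point a i s y"
    using B h_pos by (auto simp: boundary_facet_def facet_point_def y_def)
  obtain \<sigma> where \<sigma>: "\<sigma> \<noteq> 0" "outer_unit_normal \<Omega> y (\<sigma> *\<^sub>R axis i 1)" "y \<in> frontier \<Omega>"
    by (rule boundary_facet_normal[OF B f])
  have "p a y \<bullet> (\<sigma> *\<^sub>R axis i 1) = 0"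
    using RT p_coincides[OF Q] Q facet_point_in[OF f] \<sigma>(2,3) unfolding RT0_0_def p_def by blast
  then have "p a y $ i = 0" using \<sigma>(1) by (simp add: inner_axis)
  then show ?thesis by (simp add: p_def rt0_poly_def y_def algebra_simps)
qed

lemma integrable_domain_const: "integrable lebesgue (\<lambda>x. c * indicator \<Omega> x :: real)"
  using bounded_set_imp_lmeasurable[OF bounded_domain domain_measurable]
  by (intro integrable_mult_right integrable_real_indicator) (simp_all add: fmeasurable_def)

lemma g_measurable: "(\<lambda>x. indicator \<Omega> x * g x) \<in> borel_measurable lebesgue"
  and g_integrable: "integrable lebesgue (\<lambda>x. indicator \<Omega> x * g x)"
proof -
  have g: "g \<in> borel_measurable (lebesgue_on \<Omega>)" "integrable (lebesgue_on \<Omega>) (\<lambda>x. (norm (g x))\<^sup>2)"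
    using div by (auto simp: has_L2_weak_divergence_def L2_def)
  show m: "(\<lambda>x. indicator \<Omega> x * g x) \<in> borel_measurable lebesgue"
    using g(1) by (subst (asm) borel_measurable_restrict_space_iff) (auto simp: )
  have "integrable lebesgue (\<lambda>x. indicator \<Omega> x *\<^sub>R (norm (g x))\<^sup>2)"
    using g(2) by (subst (asm) integrable_restrict_space) auto
  then have i: "integrable lebesgue (\<lambda>x. 1 * indicator \<Omega> x + indicator \<Omega> x *\<^sub>R (norm (g x))\<^sup>2)"
    by (intro Bochner_Integration.integrable_add integrable_domain_const)
  show "integrable lebesgue (\<lambda>x. indicator \<Omega> x * g x)"
  proof (rule Bochner_Integration.integrable_bound[OF i m], rule AE_I2)
    fix x
    have "\<bar>g x\<bar> \<le> 1 + (g x)\<^sup>2"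
    proof -
      have "0 \<le> (\<bar>g x\<bar> - 1)\<^sup>2" by simp
      then have "2 * \<bar>g x\<bar> \<le> 1 + (g x)\<^sup>2" by (simp add: power2_eq_square algebra_simps)
      then show ?thesis by linarith
    qed
    then show "norm (indicator \<Omega> x * g x) \<le> norm (1 * indicator \<Omega> x + indicator \<Omega> x *\<^sub>R (norm (g x))\<^sup>2)"
      by (auto simp: indicator_def)
  qed
qed

lemma weak_divergence:
  assumes "\<psi> \<in> C1c \<Omega>"
  shows "(LINT x|lebesgue. indicator \<Omega> x * frechet_derivative \<psi> (at x) (\<phi> x)) = - (LINT x|lebesgue. indicator \<Omega> x * g x * \<psi> x)"
  using div assms by (auto simp: has_L2_weak_divergence_def integral_restrict_space mult.assoc)

text \<open>Test functions supported inside the cell see only the polynomial, so integration by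
  parts identifies \<open>g\<close> with the classical divergence, the sum of the slopes.\<close>

lemma g_AE: assumes Q: "cube a h \<in> \<Q>" shows "AE x in lebesgue. x \<in> cube a h \<longrightarrow> g x = d a"
proof -
  let ?b = "a + vec h"
  define u where "u x = indicator \<Omega> x * g x - d a * indicator \<Omega> x" for x
  have u: "integrable lebesgue u"
    unfolding u_def by (intro Bochner_Integration.integrable_diff g_integrable integrable_domain_const)
  have sub: "box a ?b \<subseteq> \<Omega>" by (rule box_subset_domain[OF Q])
  have "AE x in lebesgue. x \<in> cbox a ?b \<longrightarrow> u x = 0"
  proof (rule AE_eq_0_if_orthogonal_C1c[OF u])
    fix \<psi> :: "real^'n \<Rightarrow> real" assume \<psi>: "\<psi> \<in> C1c (box a ?b)"
    then have \<psi>\<Omega>: "\<psi> \<in> C1c \<Omega>" using C1c_mono[OF sub] by blast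
    let ?D = "\<lambda>x. frechet_derivative \<psi> (at x)"
    have C: "C1 \<psi> ?D" by (rule C1c_imp_C1[OF \<psi>])
    define K where "K = closure {x. \<psi> x \<noteq> 0}"
    have K: "compact K" using \<psi> by (auto simp: C1c_def K_def)
    have z: "\<psi> x = 0" if "x \<notin> K" for x
      using that closure_subset[of "{x. \<psi> x \<noteq> 0}"] unfolding K_def by blast
    have I: "integrable lebesgue (\<lambda>x. \<psi> x * (snd (coef a) $ i * axis i 1 $ i) + ?D x (axis i 1) * p a x $ i)"
      "(LINT x|lebesgue. \<psi> x * (snd (coef a) $ i * axis i 1 $ i) + ?D x (axis i 1) * p a x $ i) = 0" for i
      using integral_directional_derivative_eq_0[OF C1_mult[OF C C1_p] K, of a i "axis i 1"] z by auto
    let ?S = "\<lambda>x. \<Sum>i\<in>UNIV. \<psi> x * (snd (coef a) $ i * axis i 1 $ i) + ?D x (axis i 1) * p a x $ i"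
    have S: "integrable lebesgue ?S" by (rule Bochner_Integration.integrable_sum, rule I)
    have S0: "(LINT x|lebesgue. ?S x) = 0" using I by (subst Bochner_Integration.integral_sum) auto
    have *: "AE x in lebesgue. ?S x - d a * \<psi> x = indicator \<Omega> x * ?D x (\<phi> x)"
        using p_AE[OF Q]
      proof eventually_elim
        case (elim x)
        show ?case
        proof (cases "x \<in> box a ?b")
          case True
          then have "x \<in> \<Omega>" "\<phi> x = p a x" using sub elim box_subset_cbox[of a ?b] unfolding cube_eq by auto
          then show ?thesis
            by (simp add: linear_axis_expansion[OF C1D(3)[OF C], of _ "p a x"] d_def sum.distrib sum_distrib_left sum_distrib_right mult.commute)
        next
          case False
          then show ?thesis using C1c_outside[OF \<psi>] C1c_deriv_outside[OF \<psi>] by simp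
        qed
      qed
    have i\<psi>: "integrable lebesgue (\<lambda>x. d a * \<psi> x)" using C1c_integrable(1)[OF \<psi>] by simp
    have ig: "integrable lebesgue (\<lambda>x. indicator \<Omega> x * g x * \<psi> x)"
    proof -
      obtain B where "\<And>x. \<bar>\<psi> x\<bar> \<le> B" using C1c_bounded[OF \<psi>] by metis
      then show ?thesis
        by (rule integrable_mult_bounded[OF g_integrable borel_measurable_integrable[OF C1c_integrable(1)[OF \<psi>]]])
    qed
    have "(LINT x|lebesgue. indicator \<Omega> x * ?D x (\<phi> x)) = (LINT x|lebesgue. ?S x - d a * \<psi> x)"
      by (rule lebesgue_integral_AE_eq(1)[OF _ *]) (intro borel_measurable_integrable Bochner_Integration.integrable_diff S i\<psi>)
    also have "\<dots> = - (LINT x|lebesgue. d a * \<psi> x)"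
      by (subst Bochner_Integration.integral_diff[OF S i\<psi>]) (simp only: S0 diff_0)
    finally have 1: "(LINT x|lebesgue. indicator \<Omega> x * g x * \<psi> x) - (LINT x|lebesgue. d a * \<psi> x) = 0"
      using weak_divergence[OF \<psi>\<Omega>] by simp
    have "u x * \<psi> x = indicator \<Omega> x * g x * \<psi> x - d a * \<psi> x" for x
      using C1c_outside[OF \<psi>\<Omega>, of x] by (auto simp: u_def algebra_simps indicator_def)
    then show "(LINT x|lebesgue. u x * \<psi> x) = 0"
      using 1 by (simp only: Bochner_Integration.integral_diff[OF ig i\<psi>])
  qed
  then show ?thesis
    using AE_box_of_cbox[of a ?b]
  proof eventually_elim
    case (elim x)
    then show ?case using sub by (auto simp: u_def cube_eq)
  qed
qed

end

subsection \<open>Mollification\<close>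

text \<open>Not normalised: the total mass depends on the dimension, so it is kept as
  \<open>mollifier_mass\<close> and divided out where needed.\<close>

definition mollifier :: "real \<Rightarrow> 'a::euclidean_space \<Rightarrow> real" where
  "mollifier \<delta> z = posq (\<delta>\<^sup>2 - z \<bullet> z)"

definition mollifier' :: "real \<Rightarrow> 'a::euclidean_space \<Rightarrow> 'a \<Rightarrow> real" where
  "mollifier' \<delta> z v = (2 * max 0 (\<delta>\<^sup>2 - z \<bullet> z)) * (- (2 * (z \<bullet> v)))"

lemma C1_mollifier: "C1 (mollifier \<delta>) (mollifier' \<delta>)"
  unfolding C1_def
proof (intro conjI allI)
  fix z :: 'a
  have "((\<lambda>z. \<delta>\<^sup>2 - z \<bullet> z) has_derivative (\<lambda>v. - (2 * (z \<bullet> v)))) (at z)"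
    by (auto intro!: derivative_eq_intros simp: inner_commute)
  from has_derivative_compose[OF this, of posq "(*) (2 * max 0 (\<delta>\<^sup>2 - z \<bullet> z))"] posq_deriv
  show "(mollifier \<delta> has_derivative mollifier' \<delta> z) (at z)"
    by (simp add: mollifier_def[abs_def] mollifier'_def[abs_def] has_field_derivative_def)
next
  fix v :: 'a
  show "continuous_on UNIV (\<lambda>z. mollifier' \<delta> z v)"
    unfolding mollifier'_def by (intro continuous_intros)
qed

lemma mollifier_nonneg: "mollifier \<delta> z \<ge> 0"
  by (simp add: mollifier_def posq_def)

lemma mollifier_even: "mollifier \<delta> (x - y) = mollifier \<delta> (y - x)"
  by (simp add: mollifier_def inner_diff_left inner_diff_right inner_commute add.commute)

lemma mollifier_support: "\<delta> > 0 \<Longrightarrow> norm z \<ge> \<delta> \<Longrightarrow> mollifier \<delta> z = 0"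
proof -
  assume "\<delta> > 0" "norm z \<ge> \<delta>"
  then have "\<delta>\<^sup>2 \<le> (norm z)\<^sup>2" by (intro power_mono) auto
  then show ?thesis by (simp add: mollifier_def posq_def power2_norm_eq_inner)
qed

lemma mollifier_cont: "continuous_on S (mollifier \<delta>)"
  by (rule C1D(4)[OF C1_mollifier])

lemma mollifier_integrable:
  assumes "\<delta> > 0" shows "integrable lebesgue (\<lambda>y::'a::euclidean_space. mollifier \<delta> (x - y))"
proof (rule integrable_lebesgue_bounded_support[of _ "ball x \<delta>" "\<delta> ^ 4"])
  show "(\<lambda>y. mollifier \<delta> (x - y)) \<in> borel_measurable lebesgue"
    by (intro continuous_imp_measurable_lebesgue continuous_on_compose2[OF mollifier_cont] continuous_intros) auto
  fix y
  show "mollifier \<delta> (x - y) = 0" if "y \<notin> ball x \<delta>"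
    using that assms by (intro mollifier_support) (auto simp: dist_norm)
  have "(max 0 (\<delta>\<^sup>2 - (x - y) \<bullet> (x - y)))\<^sup>2 \<le> (\<delta>\<^sup>2)\<^sup>2" by (intro power_mono) auto
  then show "\<bar>mollifier \<delta> (x - y)\<bar> \<le> \<delta> ^ 4" by (simp add: mollifier_def posq_def)
qed auto

definition mollifier_mass :: "'a::euclidean_space itself \<Rightarrow> real \<Rightarrow> real" where
  "mollifier_mass _ \<delta> = (LINT z::'a|lebesgue. mollifier \<delta> z)"

lemma mollifier_integral: "(LINT y|lebesgue. mollifier \<delta> (x - y)) = mollifier_mass TYPE('a) \<delta>" for x :: "'a::euclidean_space"
  using lebesgue_integral_shift[OF mollifier_cont, of \<delta> "- x"]
  by (simp add: mollifier_even[of \<delta> x] mollifier_mass_def)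

lemma mollifier_mass_pos: assumes "\<delta> > 0" shows "mollifier_mass TYPE('a::euclidean_space) \<delta> > 0"
proof -
  have i: "integrable lebesgue (\<lambda>y::'a. mollifier \<delta> y)"
    using mollifier_integrable[OF assms, of "0::'a"] by (simp only: mollifier_even[of \<delta> 0] diff_zero)
  have "mollifier_mass TYPE('a) \<delta> \<noteq> 0"
  proof
    assume "mollifier_mass TYPE('a) \<delta> = 0"
    then have "AE y in lebesgue. mollifier \<delta> (y::'a) = 0"
      using i by (subst (asm) mollifier_mass_def, subst (asm) integral_nonneg_eq_0_iff_AE) (auto simp: mollifier_nonneg)
    then obtain N where N: "{y::'a. mollifier \<delta> y \<noteq> 0} \<subseteq> N" "N \<in> null_sets lebesgue"
      by (auto simp: eventually_ae_filter)
    have "open {y::'a. mollifier \<delta> y \<noteq> 0}"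
      by (intro open_Collect_neq mollifier_cont continuous_intros)
    then have "{y::'a. mollifier \<delta> y \<noteq> 0} = {}"
      by (rule open_subset_lebesgue_null_empty[OF _ N])
    then have "mollifier \<delta> (0::'a) = 0" by blast
    then show False using assms by (simp add: mollifier_def posq_def)
  qed
  moreover have "mollifier_mass TYPE('a) \<delta> \<ge> 0"
    unfolding mollifier_mass_def by (intro Bochner_Integration.integral_nonneg mollifier_nonneg)
  ultimately show ?thesis by simp
qed

lemma cube_inj: "0 < h \<Longrightarrow> cube a h = cube b h \<Longrightarrow> a = b"
proof -
  assume h: "0 < h" and e: "cube a h = cube b h"
  have "a \<in> cube a h" "b \<in> cube b h" using h by (simp_all add: cube_cbox)
  then have "a \<in> cube b h" "b \<in> cube a h" using e by simp_all
  then show ?thesis unfolding cube_cbox vec_eq_iff by (meson antisym)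
qed

section \<open>Integration over the cells\<close>

context tiled_domain begin

definition corners :: "(real^'n) set" where "corners = {a. cube a h \<in> \<Q>}"

lemma finite_corners: "finite corners"
proof -
  have "inj_on (\<lambda>a. cube a h) corners" using cube_inj[OF h_pos] by (auto simp: inj_on_def)
  moreover have "(\<lambda>a. cube a h) ` corners \<subseteq> \<Q>" by (auto simp: corners_def)
  ultimately show ?thesis using finite_cells by (meson finite_imageD finite_subset)
qed

lemma cell_unique:
  assumes "a \<in> corners" "b \<in> corners" "x \<in> box a (a + vec h)" "x \<in> box b (b + vec h)"
  shows "a = b"
proof (rule ccontr)
  assume "a \<noteq> b"
  then have "cube a h \<noteq> cube b h" using cube_inj[OF h_pos] by blast
  then show False
    using interior_disjoint[of "cube a h" "cube b h"] assms unfolding corners_def interior_cube by blast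
qed

lemma AE_unique_cell:
  "AE x in lebesgue. (x \<in> \<Omega> \<and> (\<exists>a\<in>corners. x \<in> box a (a + vec h) \<and> (\<forall>b\<in>corners. x \<in> cube b h \<longrightarrow> b = a))) \<or>
     (x \<notin> \<Omega> \<and> (\<forall>b\<in>corners. x \<notin> cube b h))"
proof -
  have "AE x in lebesgue. \<forall>b\<in>corners. x \<in> cube b h \<longrightarrow> x \<in> box b (b + vec h)"
    using AE_box_of_cbox by (intro AE_finite_allI finite_corners) (simp add: cube_eq)
  then show ?thesis
    using AE_in_cell
  proof eventually_elim
    case (elim x)
    show ?case
    proof (cases "x \<in> \<Omega>")
      case True
      then obtain a where "a \<in> corners" "x \<in> box a (a + vec h)" using elim(2) by (auto simp: corners_def)
      then show ?thesis using elim(1) cell_unique True by blast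
    next
      case False
      then show ?thesis using elim by (auto simp: corners_def)
    qed
  qed
qed

lemma sum_over_cells:
  assumes "\<And>a. a \<in> corners \<Longrightarrow> AE x in lebesgue. x \<in> cube a h \<longrightarrow> f x = k a x" "\<And>x. x \<notin> \<Omega> \<Longrightarrow> f x = (0::real)"
  shows "AE x in lebesgue. (\<Sum>a\<in>corners. indicator (cube a h) x * k a x) = f x"
proof -
  have "AE x in lebesgue. \<forall>a\<in>corners. x \<in> cube a h \<longrightarrow> f x = k a x"
    by (intro AE_finite_allI finite_corners assms)
  then show ?thesis
    using AE_unique_cell
  proof eventually_elim
    case (elim x)
    show ?case
    proof (cases "x \<in> \<Omega>")
      case True
      then obtain a where a: "a \<in> corners" "x \<in> box a (a + vec h)" "\<And>b. b \<in> corners \<Longrightarrow> x \<in> cube b h \<Longrightarrow> b = a"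
        using elim(2) by blast
      have x: "x \<in> cube a h" using a(2) box_subset_cbox unfolding cube_eq by blast
      have "(\<Sum>a\<in>corners. indicator (cube a h) x * k a x) = (\<Sum>b\<in>{a}. indicator (cube b h) x * k b x)"
        using a finite_corners by (intro sum.mono_neutral_right) (auto simp: indicator_def)
      then show ?thesis using elim(1) a(1) x by simp
    next
      case False
      then have "\<forall>b\<in>corners. x \<notin> cube b h" using elim(2) by blast
      then show ?thesis using assms(2)[OF False] by simp
    qed
  qed
qed

text \<open>A function that is cellwise continuous up to null sets is reduced to integrals of
  continuous functions over compact boxes. This settles integrability of expressions in \<phi> and
  opens the way to \<open>C1_param\<close>.\<close>

lemma integral_over_cells:
  fixes f :: "real^'n \<Rightarrow> real"
  assumes k: "\<And>a. a \<in> corners \<Longrightarrow> continuous_on (cube a h) (k a)"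
    and ae: "\<And>a. a \<in> corners \<Longrightarrow> AE x in lebesgue. x \<in> cube a h \<longrightarrow> f x = k a x"
    and out: "\<And>x. x \<notin> \<Omega> \<Longrightarrow> f x = 0"
  shows "integrable lebesgue f" "(LINT x|lebesgue. f x) = (\<Sum>a\<in>corners. integral (cube a h) (k a))"
proof -
  let ?S = "\<lambda>x. \<Sum>a\<in>corners. indicator (cube a h) x * k a x"
  have ai: "k a absolutely_integrable_on cube a h" if "a \<in> corners" for a
    using k[OF that] unfolding cube_eq by (rule absolutely_integrable_continuous)
  have i: "integrable lebesgue (\<lambda>x. indicator (cube a h) x * k a x)" if "a \<in> corners" for a
    using ai[OF that] by (simp add: set_integrable_def)
  have l: "(LINT x|lebesgue. indicator (cube a h) x * k a x) = integral (cube a h) (k a)" if "a \<in> corners" for a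
    using set_lebesgue_integral_eq_integral(2)[OF ai[OF that]] by (simp add: set_lebesgue_integral_def)
  have S: "integrable lebesgue ?S" by (intro Bochner_Integration.integrable_sum i)
  note e = lebesgue_integral_AE_eq[OF borel_measurable_integrable[OF S] sum_over_cells[OF ae out]]
  show "integrable lebesgue f" using e(2) S by blast
  show "(LINT x|lebesgue. f x) = (\<Sum>a\<in>corners. integral (cube a h) (k a))"
    using e(1) i l by (simp add: Bochner_Integration.integral_sum)
qed

end

context rt0_field begin

lemma test_integrand_integrable:
  fixes \<psi> :: "real^'n \<Rightarrow> real"
  assumes "C1 \<psi> D" "continuous_on UNIV k"
  shows "integrable lebesgue (\<lambda>x. k x * (indicator \<Omega> x * D x (\<phi> x)))"
proof (rule integral_over_cells(1)[where k="\<lambda>a x. k x * (\<Sum>i\<in>UNIV. p a x $ i * D x (axis i 1))"])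
  fix a assume a: "a \<in> corners"
  then have Q: "cube a h \<in> \<Q>" by (simp add: corners_def)
  show "continuous_on (cube a h) (\<lambda>x. k x * (\<Sum>i\<in>UNIV. p a x $ i * D x (axis i 1)))"
    by (intro continuous_intros C1D(4)[OF C1_p] continuous_on_subset[OF C1D(2)[OF assms(1)]] continuous_on_subset[OF assms(2)]) auto
  show "AE x in lebesgue. x \<in> cube a h \<longrightarrow> k x * (indicator \<Omega> x * D x (\<phi> x)) = k x * (\<Sum>i\<in>UNIV. p a x $ i * D x (axis i 1))"
    using p_AE[OF Q] AE_box_of_cbox[of a "a + vec h"]
  proof eventually_elim
    case (elim x)
    show ?case
    proof
      assume x: "x \<in> cube a h"
      then have "x \<in> \<Omega>" using elim(2) box_subset_domain[OF Q] unfolding cube_eq by blast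
      moreover have "\<phi> x = p a x" using elim(1) x Q by blast
      ultimately show "k x * (indicator \<Omega> x * D x (\<phi> x)) = k x * (\<Sum>i\<in>UNIV. p a x $ i * D x (axis i 1))"
        by (simp add: linear_axis_expansion[OF C1D(3)[OF assms(1)], of _ "p a x"])
    qed
  qed
qed simp


text \<open>The mollification of \<open>\<eta> \<phi>\<close> is a test field for \<open>TV\<close>, and its divergence is the mollification
  of \<open>g \<eta> + D\<eta> \<phi>\<close>, which is continuous in the interior of each cell.\<close>

lemma cutoff_le_TV:
  fixes \<eta> :: "real^'n \<Rightarrow> real" and w :: "real^'n \<Rightarrow> real"
  assumes \<eta>: "\<eta> \<in> C1c \<Omega>" "\<And>x. 0 \<le> \<eta> x" "\<And>x. \<eta> x \<le> 1"
    and w: "w \<in> borel_measurable (lebesgue_on \<Omega>)" "AE x in lebesgue_on \<Omega>. \<bar>w x\<bar> \<le> M"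
  shows "ereal (LINT x|lebesgue_on \<Omega>. w x * (g x * \<eta> x + frechet_derivative \<eta> (at x) (\<phi> x))) \<le> TV \<Omega> w"
proof -
  define D where "D x = frechet_derivative \<eta> (at x)" for x
  have C\<eta>: "C1 \<eta> D" unfolding D_def[abs_def] by (rule C1c_imp_C1[OF \<eta>(1)])
  \<comment> \<open>\<open>G\<close> is the weak divergence of \<open>\<eta> \<phi>\<close>, and
    \<open>Gt a\<close> its continuous representative on the cell at \<open>a\<close>.\<close>
  define G where "G x = indicator \<Omega> x * (g x * \<eta> x + D x (\<phi> x))" for x
  define Gt where "Gt a x = d a * \<eta> x + (\<Sum>i\<in>UNIV. p a x $ i * D x (axis i 1))" for a x
  obtain B0 where B0: "\<And>x. \<bar>\<eta> x\<bar> \<le> B0" "\<And>x i. \<bar>D x (axis i 1)\<bar> \<le> B0"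
    using C1c_bounded[OF \<eta>(1)] unfolding D_def by metis
  define B where "B = 2 * real CARD('n) / h * B0 + real CARD('n) * B0"
  have Q: "a \<in> corners \<Longrightarrow> cube a h \<in> \<Q>" for a by (simp add: corners_def)
  have B0_nonneg: "0 \<le> B0" using B0(1)[of 0] by linarith
  have GtB: "\<bar>Gt a x\<bar> \<le> B" if a: "a \<in> corners" "x \<in> cube a h" for a x
  proof -
    have "\<bar>d a * \<eta> x\<bar> \<le> 2 * real CARD('n) / h * B0"
      unfolding abs_mult using h_pos by (intro mult_mono d_bound Q a B0) auto
    moreover have "\<bar>\<Sum>i\<in>UNIV. p a x $ i * D x (axis i 1)\<bar> \<le> (\<Sum>i\<in>(UNIV::'n set). 1 * B0)"
    proof (rule order.trans[OF sum_abs], rule sum_mono)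
      fix i
      have "\<bar>p a x $ i\<bar> \<le> 1" using component_le_norm_cart[of "p a x" i] p_bound[OF Q[OF a(1)] a(2)] by linarith
      then show "\<bar>p a x $ i * D x (axis i 1)\<bar> \<le> 1 * B0"
        unfolding abs_mult by (intro mult_mono B0) auto
    qed
    ultimately show ?thesis unfolding Gt_def B_def by simp
  qed
  have Gtc: "continuous_on UNIV (Gt a)" for a
    unfolding Gt_def[abs_def] by (intro continuous_intros C1D(4)[OF C1_p] C1D(4)[OF C\<eta>] C1D(2)[OF C\<eta>])
  have GGt: "AE x in lebesgue. x \<in> cube a h \<longrightarrow> G x = Gt a x" if a: "a \<in> corners" for a
    using p_AE[OF Q[OF a]] AE_box_of_cbox[of a "a + vec h"] g_AE[OF Q[OF a]]
  proof eventually_elim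
    case (elim x)
    show ?case
    proof
      assume x: "x \<in> cube a h"
      then have "x \<in> \<Omega>" using elim(2) box_subset_domain[OF Q[OF a]] unfolding cube_eq by blast
      then show "G x = Gt a x" using elim(1,3) x
        by (simp add: G_def Gt_def linear_axis_expansion[OF C1D(3)[OF C\<eta>], of _ "p a x"])
    qed
  qed
  have Gout: "x \<notin> \<Omega> \<Longrightarrow> G x = 0" for x by (simp add: G_def)
  have iG: "integrable lebesgue G"
    by (rule integral_over_cells(1)[OF continuous_on_subset[OF Gtc] GGt Gout]) auto
  have GB: "AE x in lebesgue. \<bar>G x\<bar> \<le> B"
  proof -
    have B: "0 \<le> B" unfolding B_def using B0_nonneg h_pos by simp
    have "AE x in lebesgue. \<forall>a\<in>corners. x \<in> cube a h \<longrightarrow> G x = Gt a x"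
      by (intro AE_finite_allI finite_corners GGt)
    then show ?thesis using AE_unique_cell
    proof eventually_elim
      case (elim x)
      show ?case
      proof (cases "x \<in> \<Omega>")
        case True
        then obtain a where a: "a \<in> corners" "x \<in> box a (a + vec h)" using elim(2) by blast
        have "x \<in> cube a h" using a(2) box_subset_cbox unfolding cube_eq by blast
        then show ?thesis using elim(1) a(1) GtB by simp
      qed (simp add: Gout B)
    qed
  qed
  \<comment> \<open>The unnormalised mollification of the components of
    \<open>\<eta> \<phi>\<close>, written cell by cell with continuous integrands so that
    \<open>C1_param\<close> can differentiate it.\<close>
  define F where "F \<delta> i x = (\<Sum>a\<in>corners. integral (cube a h) (\<lambda>y. mollifier \<delta> (x - y) * (\<eta> y * p a y $ i)))" for \<delta> i x
  define F' where "F' \<delta> i x v = (\<Sum>a\<in>corners. integral (cube a h) (\<lambda>y. mollifier' \<delta> (x - y) v * (\<eta> y * p a y $ i)))" for \<delta> i x v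
  have CF: "C1 (F \<delta> i) (F' \<delta> i)" for \<delta> i
    unfolding F_def[abs_def] F'_def[abs_def] cube_eq
  proof (intro C1_sum C1_param)
    fix a x t :: "real^'n"
    have "((\<lambda>x. x - t) has_derivative (\<lambda>v. v)) (at x)" by (auto intro!: derivative_eq_intros)
    from has_derivative_compose[OF this C1D(1)[OF C1_mollifier]]
    show "((\<lambda>x. mollifier \<delta> (x - t) * (\<eta> t * p a t $ i)) has_derivative (\<lambda>v. mollifier' \<delta> (x - t) v * (\<eta> t * p a t $ i))) (at x)"
      by (rule has_derivative_mult_left)
  next
    fix a v :: "real^'n"
    have "continuous_on S (\<lambda>z. mollifier' \<delta> (fst z - snd z) v * (\<eta> (snd z) * p a (snd z) $ i))" for S
      by (intro continuous_intros continuous_on_compose2[OF C1D(2)[OF C1_mollifier]]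
          continuous_on_compose2[OF C1D(4)[OF C\<eta>, of UNIV]] continuous_on_compose2[OF C1D(4)[OF C1_p, of UNIV]]) auto
    then show "continuous_on (UNIV \<times> cbox a (a + vec h)) (\<lambda>(x, t). mollifier' \<delta> (x - t) v * (\<eta> t * p a t $ i))"
      by (simp add: split_beta)
  next
    fix a x :: "real^'n"
    show "continuous_on (cbox a (a + vec h)) (\<lambda>y. mollifier \<delta> (x - y) * (\<eta> y * p a y $ i))"
      by (intro continuous_intros continuous_on_compose2[OF mollifier_cont[of UNIV]] C1D(4)[OF C\<eta>] C1D(4)[OF C1_p]) auto
  qed
  have \<eta>out: "x \<notin> \<Omega> \<Longrightarrow> \<eta> x = 0" for x using C1c_outside[OF \<eta>(1)] .
  have pAE: "AE y in lebesgue. y \<in> cube a h \<longrightarrow> k y * (\<eta> y * \<phi> y $ i) = k y * (\<eta> y * p a y $ i)"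
    if "a \<in> corners" for a i and k :: "real^'n \<Rightarrow> real"
    using p_AE[OF Q[OF that]] by eventually_elim auto
  have conv_int: "integrable lebesgue (\<lambda>y. k y * (\<eta> y * \<phi> y $ i))"
    "(LINT y|lebesgue. k y * (\<eta> y * \<phi> y $ i)) = (\<Sum>a\<in>corners. integral (cube a h) (\<lambda>y. k y * (\<eta> y * p a y $ i)))"
    if k: "continuous_on UNIV k" for k :: "real^'n \<Rightarrow> real" and i
  proof -
    have c: "continuous_on (cube a h) (\<lambda>y. k y * (\<eta> y * p a y $ i))" for a
      by (intro continuous_intros continuous_on_subset[OF k] C1D(4)[OF C\<eta>] C1D(4)[OF C1_p]) auto
    have o: "y \<notin> \<Omega> \<Longrightarrow> k y * (\<eta> y * \<phi> y $ i) = 0" for y by (simp add: \<eta>out)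
    show "integrable lebesgue (\<lambda>y. k y * (\<eta> y * \<phi> y $ i))"
      by (rule integral_over_cells(1)[OF c pAE o])
    show "(LINT y|lebesgue. k y * (\<eta> y * \<phi> y $ i)) = (\<Sum>a\<in>corners. integral (cube a h) (\<lambda>y. k y * (\<eta> y * p a y $ i)))"
      by (rule integral_over_cells(2)[OF c pAE o])
  qed
  have cm: "continuous_on UNIV (\<lambda>y. mollifier \<delta> (x - y))" for \<delta> and x :: "real^'n"
    by (intro continuous_on_compose2[OF mollifier_cont[of UNIV]] continuous_intros) auto
  have cm': "continuous_on UNIV (\<lambda>y. mollifier' \<delta> (x - y) v)" for \<delta> and x v :: "real^'n"
    by (intro continuous_on_compose2[OF C1D(2)[OF C1_mollifier]] continuous_intros) auto
  have F_eq: "F \<delta> i x = (LINT y|lebesgue. mollifier \<delta> (x - y) * (\<eta> y * \<phi> y $ i))" for \<delta> i x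
    unfolding F_def by (rule conv_int(2)[OF cm, symmetric])
  have F'_eq: "F' \<delta> i x v = (LINT y|lebesgue. mollifier' \<delta> (x - y) v * (\<eta> y * \<phi> y $ i))" for \<delta> i x v
    unfolding F'_def by (rule conv_int(2)[OF cm', symmetric])
  have bm: "bounded_linear (mollifier' \<delta> z)" for \<delta> and z :: "real^'n" by (rule C1D(3)[OF C1_mollifier])
  \<comment> \<open>The derivative is moved from the mollifier in \<open>x\<close> to a test
    function in \<open>y\<close>: \<open>mollifier \<delta> (x - y) * \<eta> y\<close> is admissible
    in the weak divergence for every \<delta>, because \<eta> already has compact support in
    \<Omega>.\<close>
  have divF: "(\<Sum>i\<in>UNIV. F' \<delta> i x (axis i 1)) = (LINT y|lebesgue. mollifier \<delta> (x - y) * G y)" for \<delta> x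
  proof -
    define \<psi> where "\<psi> y = mollifier \<delta> (x - y) * \<eta> y" for y
    define D\<psi> where "D\<psi> y v = mollifier \<delta> (x - y) * D y v + (- mollifier' \<delta> (x - y) v) * \<eta> y" for y v
    have Cm: "C1 (\<lambda>y. mollifier \<delta> (x - y)) (\<lambda>y v. - mollifier' \<delta> (x - y) v)"
      unfolding C1_def
    proof (intro conjI allI)
      fix y v :: "real^'n"
      have "((\<lambda>y. x - y) has_derivative (\<lambda>v. - v)) (at y)" by (auto intro!: derivative_eq_intros)
      from has_derivative_compose[OF this C1D(1)[OF C1_mollifier]]
      show "((\<lambda>y. mollifier \<delta> (x - y)) has_derivative (\<lambda>v. - mollifier' \<delta> (x - y) v)) (at y)"
        by (simp add: mollifier'_def)
      show "continuous_on UNIV (\<lambda>y. - mollifier' \<delta> (x - y) v)" by (intro continuous_intros cm')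
    qed
    have C\<psi>: "C1 \<psi> D\<psi>" unfolding \<psi>_def[abs_def] D\<psi>_def[abs_def] by (rule C1_mult[OF Cm C\<eta>])
    have \<psi>c: "\<psi> \<in> C1c \<Omega>"
    proof (rule C1_imp_C1c[OF C\<psi>])
      show "compact (closure {x. \<eta> x \<noteq> 0})" "closure {x. \<eta> x \<noteq> 0} \<subseteq> \<Omega>" using \<eta>(1) by (auto simp: C1c_def)
      show "\<psi> y = 0" if "y \<notin> closure {x. \<eta> x \<noteq> 0}" for y
        using that closure_subset[of "{x. \<eta> x \<noteq> 0}"] by (auto simp: \<psi>_def)
    qed
    have i1: "integrable lebesgue (\<lambda>y. mollifier \<delta> (x - y) * (indicator \<Omega> y * D y (\<phi> y)))"
      by (rule test_integrand_integrable[OF C\<eta> cm])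
    have i2': "integrable lebesgue (\<lambda>y. mollifier' \<delta> (x - y) (axis i 1) * (\<eta> y * \<phi> y $ i))" for i
      by (rule conv_int(1)[OF cm'])
    have s: "(\<Sum>i\<in>UNIV. mollifier' \<delta> (x - y) (axis i 1) * (\<eta> y * \<phi> y $ i)) = \<eta> y * mollifier' \<delta> (x - y) (\<phi> y)" for y
      by (simp add: linear_axis_expansion[OF bm, of _ _ "\<phi> y"] sum_distrib_left mult_ac)
    have i2: "integrable lebesgue (\<lambda>y. \<eta> y * mollifier' \<delta> (x - y) (\<phi> y))"
      unfolding s[symmetric] by (intro Bochner_Integration.integrable_sum i2')
    obtain B1 where B1: "\<And>y. \<bar>\<psi> y\<bar> \<le> B1" using C1c_bounded[OF \<psi>c] by metis
    have i3: "integrable lebesgue (\<lambda>y. indicator \<Omega> y * g y * \<psi> y)"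
      by (rule integrable_mult_bounded[OF g_integrable continuous_imp_measurable_lebesgue[OF C1D(4)[OF C\<psi>]] B1])
    have "(\<Sum>i\<in>UNIV. F' \<delta> i x (axis i 1)) = (LINT y|lebesgue. \<eta> y * mollifier' \<delta> (x - y) (\<phi> y))"
      unfolding F'_eq s[symmetric] by (rule Bochner_Integration.integral_sum[symmetric]) (rule i2')
    also have "\<dots> = (LINT y|lebesgue. mollifier \<delta> (x - y) * (indicator \<Omega> y * D y (\<phi> y))) - (LINT y|lebesgue. indicator \<Omega> y * D\<psi> y (\<phi> y))"
    proof -
      have "indicator \<Omega> y * D\<psi> y (\<phi> y) = mollifier \<delta> (x - y) * (indicator \<Omega> y * D y (\<phi> y)) - \<eta> y * mollifier' \<delta> (x - y) (\<phi> y)" for y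
        using \<eta>out[of y] by (auto simp: D\<psi>_def algebra_simps indicator_def)
      then show ?thesis by (simp only: Bochner_Integration.integral_diff[OF i1 i2])
    qed
    also have "(LINT y|lebesgue. indicator \<Omega> y * D\<psi> y (\<phi> y)) = - (LINT y|lebesgue. indicator \<Omega> y * g y * \<psi> y)"
      using weak_divergence[OF \<psi>c] unfolding C1_frechet[OF C\<psi>] .
    also have "(LINT y|lebesgue. mollifier \<delta> (x - y) * (indicator \<Omega> y * D y (\<phi> y))) - - (LINT y|lebesgue. indicator \<Omega> y * g y * \<psi> y)
      = (LINT y|lebesgue. mollifier \<delta> (x - y) * (indicator \<Omega> y * D y (\<phi> y)) + indicator \<Omega> y * g y * \<psi> y)"
      by (simp add: Bochner_Integration.integral_add[OF i1 i3])
    also have "\<dots> = (LINT y|lebesgue. mollifier \<delta> (x - y) * G y)"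
      by (intro Bochner_Integration.integral_cong refl) (simp add: G_def \<psi>_def algebra_simps)
    finally show ?thesis .
  qed
  let ?c = "mollifier_mass TYPE(real^'n)"
  define H where "H n x = (LINT y|lebesgue. mollifier (ep n) (x - y) * G y) / ?c (ep n)" for n x
  have cpos: "?c (ep n) > 0" for n by (rule mollifier_mass_pos[OF ep(1)])
  have mi: "integrable lebesgue (\<lambda>y. mollifier (ep n) (x - y))" for n and x :: "real^'n" by (rule mollifier_integrable[OF ep(1)])
  have iMG: "integrable lebesgue (\<lambda>y. mollifier (ep n) (x - y) * G y)" for n x
  proof (rule Bochner_Integration.integrable_bound[of _ "\<lambda>y. B * mollifier (ep n) (x - y)"])
    show "integrable lebesgue (\<lambda>y. B * mollifier (ep n) (x - y))" using mi by (intro integrable_mult_right)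
    show "(\<lambda>y. mollifier (ep n) (x - y) * G y) \<in> borel_measurable lebesgue"
      by (rule borel_measurable_times[OF borel_measurable_integrable[OF mi] borel_measurable_integrable[OF iG]])
    show "AE y in lebesgue. norm (mollifier (ep n) (x - y) * G y) \<le> norm (B * mollifier (ep n) (x - y))"
      using GB
    proof eventually_elim
      case (elim y)
      have "mollifier (ep n) (x - y) * \<bar>G y\<bar> \<le> mollifier (ep n) (x - y) * \<bar>B\<bar>"
        using elim by (intro mult_left_mono mollifier_nonneg) auto
      then show ?case by (simp add: abs_mult mollifier_nonneg mult.commute)
    qed
  qed
  \<comment> \<open>\<open>H n x\<close> is a weighted mean of \<open>G\<close> over the ball of
    radius \<open>ep n\<close>. With \<open>z = 0\<close> this yields a uniform bound, with
    \<open>z = Gt a x\<close> convergence inside the cells.\<close>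
  have est: "\<bar>H n x - z\<bar> \<le> e" if "AE y in lebesgue. norm (x - y) < ep n \<longrightarrow> \<bar>G y - z\<bar> \<le> e" for n x z e
  proof -
    have iz: "integrable lebesgue (\<lambda>y. mollifier (ep n) (x - y) * z)" using mi by (intro integrable_mult_left)
    have "(LINT y|lebesgue. mollifier (ep n) (x - y) * G y) - ?c (ep n) * z = (LINT y|lebesgue. mollifier (ep n) (x - y) * G y - mollifier (ep n) (x - y) * z)"
      by (simp add: Bochner_Integration.integral_diff[OF iMG iz] mollifier_integral)
    also have "\<bar>\<dots>\<bar> \<le> (LINT y|lebesgue. \<bar>mollifier (ep n) (x - y) * G y - mollifier (ep n) (x - y) * z\<bar>)"
      by (rule integral_abs_bound)
    also have "\<dots> \<le> (LINT y|lebesgue. mollifier (ep n) (x - y) * e)"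
    proof (rule integral_mono_AE)
      show "integrable lebesgue (\<lambda>y. \<bar>mollifier (ep n) (x - y) * G y - mollifier (ep n) (x - y) * z\<bar>)"
        by (intro integrable_abs Bochner_Integration.integrable_diff iMG iz)
      show "integrable lebesgue (\<lambda>y. mollifier (ep n) (x - y) * e)" using mi by (intro integrable_mult_left)
      show "AE y in lebesgue. \<bar>mollifier (ep n) (x - y) * G y - mollifier (ep n) (x - y) * z\<bar> \<le> mollifier (ep n) (x - y) * e"
        using that
      proof eventually_elim
        case (elim y)
        show ?case
        proof (cases "norm (x - y) < ep n")
          case True
          have "mollifier (ep n) (x - y) * \<bar>G y - z\<bar> \<le> mollifier (ep n) (x - y) * e"
            using elim True by (intro mult_left_mono mollifier_nonneg) auto
          then show ?thesis by (simp add: abs_mult mollifier_nonneg flip: right_diff_distrib)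
        next
          case False
          then show ?thesis using mollifier_support[OF ep(1), of n "x - y"] by simp
        qed
      qed
    qed
    finally have "\<bar>(LINT y|lebesgue. mollifier (ep n) (x - y) * G y) - ?c (ep n) * z\<bar> \<le> ?c (ep n) * e"
      by (simp add: mollifier_integral)
    moreover have "(LINT y|lebesgue. mollifier (ep n) (x - y) * G y) = ?c (ep n) * H n x"
      using cpos[of n] by (simp add: H_def)
    ultimately have "?c (ep n) * \<bar>H n x - z\<bar> \<le> ?c (ep n) * e"
      using cpos[of n] by (simp add: abs_mult flip: right_diff_distrib)
    then show ?thesis using cpos[of n] by simp
  qed
  define \<Phi> where "\<Phi> n x = (\<chi> i. (1 / ?c (ep n)) * F (ep n) i x)" for n x
  have C\<Phi>i: "C1 (\<lambda>x. (1 / ?c (ep n)) * F (ep n) i x) (\<lambda>x v. (1 / ?c (ep n)) * F' (ep n) i x v)" for n i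
    by (intro C1_cmult CF)
  have C\<Phi>: "C1 (\<Phi> n) (\<lambda>x v. \<chi> i. (1 / ?c (ep n)) * F' (ep n) i x v)" for n
    unfolding \<Phi>_def[abs_def] by (rule C1_vec[OF C\<Phi>i])
  have div\<Phi>: "divergence (\<Phi> n) x = H n x" for n x
    unfolding \<Phi>_def[abs_def] divergence_vec[OF C\<Phi>i] H_def divF[symmetric] by (simp add: sum_divide_distrib)
  \<comment> \<open>Pairing with \<open>z = \<Phi> n x\<close> itself preserves the Euclidean bound
    1; separate estimates of the components would lose a factor depending on the dimension.\<close>
  have \<Phi>1: "norm (\<Phi> n x) \<le> 1" for n x
  proof (cases "\<Phi> n x = 0")
    case False
    define z where "z = \<Phi> n x"
    have "?c (ep n) * (z \<bullet> z) = (\<Sum>i\<in>UNIV. z $ i * F (ep n) i x)"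
      using cpos[of n] by (simp add: inner_vec_def z_def \<Phi>_def sum_distrib_left)
    also have "\<dots> = (LINT y|lebesgue. (\<Sum>i\<in>UNIV. z $ i * (mollifier (ep n) (x - y) * (\<eta> y * \<phi> y $ i))))"
      unfolding F_eq by (subst Bochner_Integration.integral_sum) (auto intro!: integrable_mult_right conv_int(1)[OF cm])
    also have "\<dots> \<le> (LINT y|lebesgue. mollifier (ep n) (x - y) * norm z)"
    proof (rule integral_mono_AE)
      show "integrable lebesgue (\<lambda>y. \<Sum>i\<in>UNIV. z $ i * (mollifier (ep n) (x - y) * (\<eta> y * \<phi> y $ i)))"
        by (intro Bochner_Integration.integrable_sum integrable_mult_right conv_int(1)[OF cm])
      show "integrable lebesgue (\<lambda>y. mollifier (ep n) (x - y) * norm z)" using mi by (intro integrable_mult_left)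
      have "AE y in lebesgue. y \<in> \<Omega> \<longrightarrow> norm (\<phi> y) \<le> 1" using bound by (simp add: AE_lebesgue_on_iff)
      then show "AE y in lebesgue. (\<Sum>i\<in>UNIV. z $ i * (mollifier (ep n) (x - y) * (\<eta> y * \<phi> y $ i))) \<le> mollifier (ep n) (x - y) * norm z"
      proof eventually_elim
        case (elim y)
        have s: "(\<Sum>i\<in>UNIV. z $ i * (mollifier (ep n) (x - y) * (\<eta> y * \<phi> y $ i))) = mollifier (ep n) (x - y) * (\<eta> y * (z \<bullet> \<phi> y))"
          by (simp add: inner_vec_def sum_distrib_left mult_ac)
        have "\<eta> y * (z \<bullet> \<phi> y) \<le> norm z"
        proof (cases "y \<in> \<Omega>")
          case True
          have "z \<bullet> \<phi> y \<le> norm z * norm (\<phi> y)" by (rule norm_cauchy_schwarz)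
          also have "\<dots> \<le> norm z" using elim True by (simp add: mult_left_le)
          finally have "\<eta> y * (z \<bullet> \<phi> y) \<le> \<eta> y * norm z" by (rule mult_left_mono) (rule \<eta>(2))
          also have "\<dots> \<le> 1 * norm z" by (intro mult_right_mono \<eta>(3)) auto
          finally show ?thesis by simp
        qed (simp add: \<eta>out)
        then show ?case unfolding s by (intro mult_left_mono mollifier_nonneg)
      qed
    qed
    also have "\<dots> = ?c (ep n) * norm z" by (simp add: mollifier_integral)
    finally have "norm z * norm z \<le> norm z" using cpos[of n] by (simp add: power2_norm_eq_inner[symmetric] power2_eq_square)
    then show ?thesis using False by (simp add: z_def)
  qed simp
  define K where "K = closure {x. \<eta> x \<noteq> 0}"
  have K: "compact K" "K \<subseteq> \<Omega>" using \<eta>(1) by (auto simp: C1c_def K_def)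
  \<comment> \<open>The support of \<eta> has positive distance from the complement of \<Omega>, so
    mollification with a smaller radius stays inside.\<close>
  obtain r where r: "r > 0" "\<And>x y. x \<in> K \<Longrightarrow> y \<in> - \<Omega> \<Longrightarrow> r \<le> dist x y"
  proof -
    have "K \<inter> - \<Omega> = {}" using K(2) by blast
    then show ?thesis using separate_compact_closed[OF K(1), of "- \<Omega>"] open_domain that by (metis closed_Compl)
  qed
  have \<Phi>c: "\<Phi> n \<in> C1c \<Omega>" if "ep n < r" for n
  proof (rule C1_imp_C1c[OF C\<Phi>])
    let ?K = "{x + y | x y. x \<in> K \<and> y \<in> cball 0 (ep n)}"
    show "compact ?K" by (rule compact_sums[OF K(1) compact_cball])
    show "?K \<subseteq> \<Omega>"
    proof
      fix z assume "z \<in> ?K"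
      then obtain x y where z: "z = x + y" "x \<in> K" "norm y \<le> ep n" by auto
      then have "dist x z < r" using that by (simp add: dist_norm)
      then show "z \<in> \<Omega>" using r(2)[OF z(2), of z] by force
    qed
    fix x assume x: "x \<notin> ?K"
    have "mollifier (ep n) (x - y) * (\<eta> y * \<phi> y $ i) = 0" for y i
    proof (cases "y \<in> K")
      case True
      have "norm (x - y) > ep n"
      proof (rule ccontr)
        assume "\<not> norm (x - y) > ep n"
        then have "x = y + (x - y) \<and> y \<in> K \<and> x - y \<in> cball 0 (ep n)" using True by simp
        then show False using x by blast
      qed
      then show ?thesis using mollifier_support[OF ep(1), of n "x - y"] by simp
    next
      case False
      then have "\<eta> y = 0" using closure_subset[of "{x. \<eta> x \<noteq> 0}"] by (auto simp: K_def)
      then show ?thesis by simp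
    qed
    then have "F (ep n) i x = 0" for i unfolding F_eq by (simp only: Bochner_Integration.integral_zero)
    then show "\<Phi> n x = 0" by (simp add: \<Phi>_def vec_eq_iff)
  qed
  define W where "W x = indicator \<Omega> x * w x" for x
  have Wm: "W \<in> borel_measurable lebesgue"
    using w(1) unfolding W_def by (subst (asm) borel_measurable_restrict_space_iff) auto
  have WM: "AE x in lebesgue. \<bar>W x\<bar> \<le> \<bar>M\<bar> * indicator \<Omega> x"
  proof -
    have "AE x in lebesgue. x \<in> \<Omega> \<longrightarrow> \<bar>w x\<bar> \<le> M" using w(2) by (simp add: AE_lebesgue_on_iff)
    then show ?thesis by eventually_elim (auto simp: W_def indicator_def)
  qed
  have HB: "\<bar>H n x\<bar> \<le> B" for n x
  proof -
    have "AE y in lebesgue. norm (x - y) < ep n \<longrightarrow> \<bar>G y - 0\<bar> \<le> B"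
      using GB by eventually_elim simp
    from est[OF this] show ?thesis by simp
  qed
  have Hm: "H n \<in> borel_measurable lebesgue" for n
  proof -
    have "continuous_on UNIV (\<lambda>x. (\<Sum>i\<in>UNIV. F' (ep n) i x (axis i 1)) / ?c (ep n))"
      using cpos[of n] by (intro continuous_intros C1D(2)[OF CF]) auto
    then show ?thesis unfolding H_def[abs_def] divF[symmetric] by (rule continuous_imp_measurable_lebesgue)
  qed
  have "(\<lambda>n. LINT x|lebesgue. W x * H n x) \<longlonglongrightarrow> (LINT x|lebesgue. W x * G x)"
  proof (rule integral_dominated_convergence[where w="\<lambda>x. (\<bar>M\<bar> * B) * indicator \<Omega> x"])
    show "(\<lambda>x. W x * G x) \<in> borel_measurable lebesgue"
      by (rule borel_measurable_times[OF Wm borel_measurable_integrable[OF iG]])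
    show "(\<lambda>x. W x * H n x) \<in> borel_measurable lebesgue" for n by (rule borel_measurable_times[OF Wm Hm])
    show "integrable lebesgue (\<lambda>x. (\<bar>M\<bar> * B) * indicator \<Omega> x)" by (rule integrable_domain_const)
    show "AE x in lebesgue. norm (W x * H n x) \<le> \<bar>M\<bar> * B * indicator \<Omega> x" for n
      using WM
    proof eventually_elim
      case (elim x)
      have "\<bar>W x\<bar> * \<bar>H n x\<bar> \<le> (\<bar>M\<bar> * indicator \<Omega> x) * B" by (intro mult_mono elim HB) auto
      then show ?case by (simp add: abs_mult mult_ac)
    qed
    have "AE x in lebesgue. \<forall>a\<in>corners. x \<in> cube a h \<longrightarrow> G x = Gt a x"
      by (intro AE_finite_allI finite_corners GGt)
    then show "AE x in lebesgue. (\<lambda>n. W x * H n x) \<longlonglongrightarrow> W x * G x"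
      using AE_unique_cell
    proof eventually_elim
      case (elim x)
      show ?case
      proof (cases "x \<in> \<Omega>")
        case True
        then obtain a where a: "a \<in> corners" "x \<in> box a (a + vec h)" using elim(2) by blast
        have xc: "x \<in> cube a h" using a(2) box_subset_cbox unfolding cube_eq by blast
        \<comment> \<open>Points in open cells suffice, since the faces are null; near such a point
          \<open>G\<close> agrees almost everywhere with the continuous \<open>Gt a\<close>.\<close>
        have "(\<lambda>n. H n x) \<longlonglongrightarrow> Gt a x"
        proof (rule LIMSEQ_I)
          fix e :: real assume e: "e > 0"
          obtain r1 where r1: "r1 > 0" "ball x r1 \<subseteq> box a (a + vec h)"
            using a(2) open_box open_contains_ball by blast
          obtain r2 where r2: "r2 > 0" "\<And>y. dist y x < r2 \<Longrightarrow> dist (Gt a y) (Gt a x) < e / 2"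
            using Gtc[of a, unfolded continuous_on_iff, rule_format, of x "e / 2"] e by auto
          have "\<forall>\<^sub>F n in sequentially. ep n < min r1 r2"
            using order_tendstoD(2)[OF ep(3), of "min r1 r2"] r1 r2 by simp
          then obtain N where N: "\<And>n. n \<ge> N \<Longrightarrow> ep n < min r1 r2" by (auto simp: eventually_sequentially)
          have "norm (H n x - Gt a x) < e" if "n \<ge> N" for n
          proof -
            have "\<bar>H n x - Gt a x\<bar> \<le> e / 2"
            proof (rule est)
              show "AE y in lebesgue. norm (x - y) < ep n \<longrightarrow> \<bar>G y - Gt a x\<bar> \<le> e / 2"
                using GGt[OF a(1)]
              proof eventually_elim
                case (elim y)
                show ?case
                proof
                  assume y: "norm (x - y) < ep n"
                  then have "dist x y < r1" "dist y x < r2" using N[OF that] by (auto simp: dist_norm norm_minus_commute)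
                  then have "y \<in> cube a h" "\<bar>Gt a y - Gt a x\<bar> < e / 2"
                    using r1(2) r2(2)[of y] box_subset_cbox[of a "a + vec h"] unfolding cube_eq by (auto simp: dist_real_def)
                  then show "\<bar>G y - Gt a x\<bar> \<le> e / 2" using elim by simp
                qed
              qed
            qed
            then show ?thesis using e by simp
          qed
          then show "\<exists>N. \<forall>n\<ge>N. norm (H n x - Gt a x) < e" by blast
        qed
        then have "(\<lambda>n. W x * H n x) \<longlonglongrightarrow> W x * Gt a x" by (intro tendsto_intros)
        then show ?thesis using elim(1) a(1) xc by simp
      qed (simp add: W_def)
    qed
  qed
  then have lim: "(\<lambda>n. ereal (LINT x|lebesgue. W x * H n x)) \<longlonglongrightarrow> ereal (LINT x|lebesgue. W x * G x)"
    by (rule tendsto_ereal)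
  have "\<forall>\<^sub>F n in sequentially. ereal (LINT x|lebesgue. W x * H n x) \<le> TV \<Omega> w"
    using order_tendstoD(2)[OF ep(3) r(1)]
  proof eventually_elim
    case (elim n)
    have "(LINT x|lebesgue. W x * H n x) = (LINT x|lebesgue_on \<Omega>. w x * divergence (\<Phi> n) x)"
      by (simp add: integral_restrict_space W_def div\<Phi> mult.assoc)
    then show ?case unfolding TV_def using \<Phi>c[OF elim] \<Phi>1 by (auto intro!: SUP_upper2)
  qed
  from tendsto_upperbound[OF lim this] have "ereal (LINT x|lebesgue. W x * G x) \<le> TV \<Omega> w" by simp
  also have "(LINT x|lebesgue. W x * G x) = (LINT x|lebesgue_on \<Omega>. w x * (g x * \<eta> x + frechet_derivative \<eta> (at x) (\<phi> x)))"
    by (simp add: integral_restrict_space) (auto intro!: Bochner_Integration.integral_cong simp: W_def G_def D_def indicator_def)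
  finally show ?thesis .
qed

end

subsection \<open>Cutoffs near the boundary\<close>

text \<open>The union bound for products; it lets the costs of many cutoffs add up.\<close>

lemma one_minus_prod_le:
  fixes f :: "'i \<Rightarrow> real"
  assumes "finite I" "\<And>i. i \<in> I \<Longrightarrow> 0 \<le> f i \<and> f i \<le> 1"
  shows "1 - (\<Prod>i\<in>I. f i) \<le> (\<Sum>i\<in>I. 1 - f i)"
  using assms
proof (induction rule: finite_induct)
  case (insert i I)
  have "(1 - f i) * (1 - (\<Prod>i\<in>I. f i)) \<ge> 0"
    using insert by (intro mult_nonneg_nonneg) (auto intro!: prod_le_1)
  then have "1 - f i * (\<Prod>i\<in>I. f i) \<le> (1 - f i) + (1 - (\<Prod>i\<in>I. f i))" by (simp add: algebra_simps)
  then show ?case using insert by auto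
qed simp

lemma measure_cbox_cart:
  fixes l u :: "real^'n"
  assumes "\<And>k. l $ k \<le> u $ k"
  shows "measure lebesgue (cbox l u) = (\<Prod>k\<in>UNIV. u $ k - l $ k)"
proof -
  have "cbox l u \<noteq> {}" using assms by (auto simp: interval_ne_empty_cart)
  then show ?thesis using content_cbox_cart[of l u] by (simp add: measure_completion)
qed

lemma measure_slab:
  fixes i :: "'n::finite"
  assumes "R \<ge> 0" "t \<ge> 0"
  shows "measure lebesgue (cbox (upd (- vec R) i (s - t)) (upd (vec R) i (s + t))) = 2 * t * (2 * R) ^ (CARD('n) - 1)"
proof -
  have "measure lebesgue (cbox (upd (- vec R) i (s - t)) (upd (vec R) i (s + t)))
      = (\<Prod>k\<in>UNIV. upd (vec R) i (s + t) $ k - upd (- vec R) i (s - t) $ k)"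
    using assms by (intro measure_cbox_cart) auto
  also have "\<dots> = 2 * t * (\<Prod>k\<in>UNIV - {i}. 2 * R)"
    by (subst prod.remove[of _ i]) (auto intro!: arg_cong2[where f="(*)"] prod.cong)
  also have "\<dots> = 2 * t * (2 * R) ^ (CARD('n) - 1)" by (simp add: card_Diff_singleton)
  finally show ?thesis .
qed

lemma measure_slab2:
  fixes i j :: "'n::finite"
  assumes "R \<ge> 0" "t \<ge> 0" "i \<noteq> j"
  shows "measure lebesgue (cbox (upd (upd (- vec R) i (s - t)) j (s' - t)) (upd (upd (vec R) i (s + t)) j (s' + t)))
    = 2 * t * (2 * t * (2 * R) ^ (CARD('n) - 2))"
proof -
  have "measure lebesgue (cbox (upd (upd (- vec R) i (s - t)) j (s' - t)) (upd (upd (vec R) i (s + t)) j (s' + t)))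
      = (\<Prod>k\<in>UNIV. upd (upd (vec R) i (s + t)) j (s' + t) $ k - upd (upd (- vec R) i (s - t)) j (s' - t) $ k)"
    using assms by (intro measure_cbox_cart) auto
  also have "\<dots> = 2 * t * (2 * t * (\<Prod>k\<in>UNIV - {j} - {i}. 2 * R))"
    using assms(3)
    by (subst prod.remove[of _ j], simp, simp, subst prod.remove[of _ i])
      (auto intro!: arg_cong2[where f="(*)"] prod.cong)
  also have "(\<Prod>k\<in>UNIV - {j} - {i}. 2 * R) = (2 * R) ^ (CARD('n) - 2)"
    using assms(3) by (simp add: card_Diff_singleton numeral_2_eq_2)
  finally show ?thesis .
qed

lemma integral_le_const_on_cbox:
  fixes f :: "'a::euclidean_space \<Rightarrow> real"
  assumes "integrable lebesgue f" "AE x in lebesgue. f x \<le> b * indicator (cbox l u) x"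
  shows "(LINT x|lebesgue. f x) \<le> b * measure lebesgue (cbox l u)"
proof -
  have f: "emeasure lebesgue (cbox l u) < \<infinity>"
    using bounded_set_imp_lmeasurable[of "cbox l u"] by (auto simp: fmeasurable_def)
  have "(LINT x|lebesgue. f x) \<le> (LINT x|lebesgue. b * indicator (cbox l u) x)"
    by (rule integral_mono_AE[OF assms(1) _ assms(2)])
      (intro integrable_mult_right integrable_real_indicator f, simp)
  also have "\<dots> = b * measure lebesgue (cbox l u)" by simp
  finally show ?thesis .
qed

context tiled_domain begin

lemma domain_in_cbox: obtains R where "R \<ge> 0" "\<And>x k. x \<in> \<Omega> \<Longrightarrow> \<bar>x $ k\<bar> \<le> R"
proof -
  obtain R where R: "\<And>x. x \<in> \<Omega> \<Longrightarrow> norm x \<le> R" using bounded_domain by (auto simp: bounded_iff)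
  show ?thesis
  proof (rule that[of "\<bar>R\<bar>"])
    show "\<bar>x $ k\<bar> \<le> \<bar>R\<bar>" if "x \<in> \<Omega>" for x k
      using R[OF that] component_le_norm_cart[of x k] by linarith
  qed simp
qed

text \<open>The product of cutoffs lives on the whole space and need not vanish outside \<Omega>.
  Since it vanishes on a neighbourhood of the frontier, it can be set to zero outside without losing
  \<open>C1\<close>.\<close>

lemma C1c_restrict:
  fixes f :: "real^'n \<Rightarrow> real"
  assumes f: "C1 f D" and N: "open N" "frontier \<Omega> \<subseteq> N" "\<And>x. x \<in> N \<Longrightarrow> f x = 0"
  shows "(\<lambda>x. if x \<in> \<Omega> then f x else 0) \<in> C1c \<Omega>"
    "\<And>x. x \<in> \<Omega> \<Longrightarrow> frechet_derivative (\<lambda>x. if x \<in> \<Omega> then f x else 0) (at x) = D x"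
proof -
  let ?f = "\<lambda>x. if x \<in> \<Omega> then f x else 0"
  define E where "E x v = (if x \<in> \<Omega> then D x v else 0)" for x v
  have D0: "D x v = 0" if "x \<in> N" for x v
  proof -
    have "\<forall>\<^sub>F y in nhds x. y \<in> N" by (rule eventually_nhds_in_open[OF N(1) that])
    then have "\<forall>\<^sub>F y in at x. f y = 0" by (auto simp: eventually_nhds_conv_at N(3) elim: eventually_mono)
    then have "((\<lambda>y. 0) has_derivative D x) (at x)"
      by (rule has_derivative_transform_eventually[OF C1D(1)[OF f]]) (use N(3)[OF that] in auto)
    then have "D x = (\<lambda>v. 0)" by (rule has_derivative_unique) (rule has_derivative_const)
    then show ?thesis by simp
  qed
  define V where "V = N \<union> - closure \<Omega>"
  have V: "open V" unfolding V_def using N(1) by (intro open_Un open_Compl) auto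
  have cover: "x \<in> \<Omega> \<or> x \<in> V" for x
    using N(2) open_domain by (auto simp: V_def frontier_def interior_open)
  have V0: "?f x = 0" "E x v = 0" if "x \<in> V" for x v
    using that N(3) D0 closure_subset[of \<Omega>] by (auto simp: V_def E_def)
  have Ex: "E x = (if x \<in> \<Omega> then D x else (\<lambda>v. 0))" for x by (auto simp: E_def)
  have CE: "C1 ?f E"
    unfolding C1_def
  proof (intro conjI allI)
    fix x
    show "(?f has_derivative E x) (at x)"
    proof (cases "x \<in> \<Omega>")
      case True
      have "\<forall>\<^sub>F y in nhds x. y \<in> \<Omega>" by (rule eventually_nhds_in_open[OF open_domain True])
      then have e: "\<forall>\<^sub>F y in at x. f y = ?f y" by (auto simp: eventually_nhds_conv_at elim: eventually_mono)
      have "(?f has_derivative D x) (at x)"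
        by (rule has_derivative_transform_eventually[OF C1D(1)[OF f] e]) (use True in auto)
      then show ?thesis using True by (simp add: Ex)
    next
      case False
      then have x: "x \<in> V" using cover by blast
      have "\<forall>\<^sub>F y in nhds x. y \<in> V" by (rule eventually_nhds_in_open[OF V x])
      then have "\<forall>\<^sub>F y in at x. y \<in> V" by (simp add: eventually_nhds_conv_at)
      then have e: "\<forall>\<^sub>F y in at x. 0 = ?f y" by (rule eventually_mono) (rule V0(1)[symmetric])
      have "(?f has_derivative (\<lambda>v. 0)) (at x)"
        by (rule has_derivative_transform_eventually[OF has_derivative_const e]) (use V0(1)[OF x] in auto)
      then show ?thesis using False by (simp add: Ex)
    qed
  next
    fix v
    have "continuous_on (\<Omega> \<union> V) (\<lambda>x. E x v)"
    proof (rule continuous_on_open_Un[OF open_domain V])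
      show "continuous_on \<Omega> (\<lambda>x. E x v)"
        using continuous_on_subset[OF C1D(2)[OF f, of v]] by (rule continuous_on_eq) (auto simp: E_def)
      show "continuous_on V (\<lambda>x. E x v)"
        by (rule continuous_on_eq[of _ "\<lambda>x. 0"]) (auto simp: V0)
    qed
    moreover have "\<Omega> \<union> V = UNIV" using cover by blast
    ultimately show "continuous_on UNIV (\<lambda>x. E x v)" by simp
  qed
  show "?f \<in> C1c \<Omega>"
  proof (rule C1_imp_C1c[OF CE])
    have "compact (closure \<Omega>)" using bounded_domain by (simp add: compact_closure)
    then show "compact (closure \<Omega> \<inter> - N)" using N(1) by (intro compact_Int_closed) auto
    show "closure \<Omega> \<inter> - N \<subseteq> \<Omega>" using N(2) open_domain by (auto simp: frontier_def interior_open)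
    show "?f x = 0" if "x \<notin> closure \<Omega> \<inter> - N" for x
      using that N(3) closure_subset[of \<Omega>] by auto
  qed
  show "frechet_derivative ?f (at x) = D x" if "x \<in> \<Omega>" for x
    using that by (simp add: C1_frechet[OF CE] E_def[abs_def])
qed

end

section \<open>Cutoffs at edges and facets and their costs\<close>

definition ridge :: "real \<Rightarrow> real \<Rightarrow> real \<Rightarrow> real" where
  "ridge s e = bump (s - 3 * e) (s + 3 * e) e"

definition ridge' :: "real \<Rightarrow> real \<Rightarrow> real \<Rightarrow> real" where
  "ridge' s e = bump' (s - 3 * e) (s + 3 * e) e"

text \<open>The offset \<open>3 * e\<close> in the definition puts the plateau of
  \<open>bump\<close> at distance at most \<open>e\<close> from \<open>s\<close> and its support
  within \<open>2 * e\<close>.\<close>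

lemma ridge:
  assumes "e > 0"
  shows "0 \<le> ridge s e t" "ridge s e t \<le> 1" "\<bar>t - s\<bar> > 2 * e \<Longrightarrow> ridge s e t = 0" "\<bar>t - s\<bar> > 2 * e \<Longrightarrow> ridge' s e t = 0"
    "\<bar>t - s\<bar> \<le> e \<Longrightarrow> ridge s e t = 1" "\<bar>ridge' s e t\<bar> \<le> 4 / e"
  using bump_bounds[of "s - 3 * e" "s + 3 * e" e t] bump_zero[OF assms, of t "s - 3 * e" "s + 3 * e"]
    bump_one[OF assms, of "s - 3 * e" t "s + 3 * e"] bump'_bound[OF assms, of "s - 3 * e" "s + 3 * e" t]
  by (auto simp: ridge_def ridge'_def abs_if split: if_splits)

lemma C1_ridge: "C1 (\<lambda>x::real^'n. ridge s e (x $ i)) (\<lambda>x v. ridge' s e (x $ i) * v $ i)"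
  unfolding ridge_def ridge'_def by (rule C1_bump)

context rt0_field begin

text \<open>Up to a constant, the integral of \<open>cost f D\<close> bounds the change of \<open>\<integral> w g\<close> when \<open>\<phi>\<close> is
  multiplied by the cutoff \<open>f\<close> with derivative \<open>D\<close>.\<close>

definition cost :: "(real^'n \<Rightarrow> real) \<Rightarrow> (real^'n \<Rightarrow> real^'n \<Rightarrow> real) \<Rightarrow> real^'n \<Rightarrow> real" where
  "cost f D x = indicator \<Omega> x * (\<bar>D x (\<phi> x)\<bar> + (1 - f x))"

lemma cost_integrable:
  assumes "C1 f D" shows "integrable lebesgue (cost f D)"
proof -
  have 1: "integrable lebesgue (\<lambda>x. \<bar>1 * (indicator \<Omega> x * D x (\<phi> x))\<bar>)"
    by (intro integrable_abs test_integrand_integrable[OF assms] continuous_intros)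
  have 2: "integrable lebesgue (\<lambda>x. indicator \<Omega> x * (1 - f x))"
  proof (rule integral_over_cells(1)[where k="\<lambda>a x. 1 - f x"])
    fix a assume "a \<in> corners"
    then have Q: "cube a h \<in> \<Q>" by (simp add: corners_def)
    show "continuous_on (cube a h) (\<lambda>x. 1 - f x)" by (intro continuous_intros C1D(4)[OF assms])
    show "AE x in lebesgue. x \<in> cube a h \<longrightarrow> indicator \<Omega> x * (1 - f x) = 1 - f x"
      using AE_box_of_cbox[of a "a + vec h"]
      by eventually_elim (use box_subset_domain[OF Q] in \<open>auto simp: cube_eq\<close>)
  qed simp
  have "cost f D x = \<bar>1 * (indicator \<Omega> x * D x (\<phi> x))\<bar> + indicator \<Omega> x * (1 - f x)" for x
    by (simp add: cost_def abs_mult algebra_simps)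
  then show ?thesis using Bochner_Integration.integrable_add[OF 1 2] by presburger
qed

text \<open>In the product rule the remaining factors lie in \<open>[0, 1]\<close>, so the cost is
  subadditive under products and each edge and facet can be treated alone.\<close>

lemma cost_prod_le:
  assumes "finite I" "\<And>i. i \<in> I \<Longrightarrow> C1 (f i) (D i)" "\<And>i x. i \<in> I \<Longrightarrow> 0 \<le> f i x \<and> f i x \<le> 1"
  shows "(LINT x|lebesgue. cost (\<lambda>x. \<Prod>i\<in>I. f i x) (\<lambda>x v. \<Sum>i\<in>I. D i x v * (\<Prod>j\<in>I - {i}. f j x)) x)
    \<le> (\<Sum>i\<in>I. LINT x|lebesgue. cost (f i) (D i) x)"
proof -
  have "(LINT x|lebesgue. cost (\<lambda>x. \<Prod>i\<in>I. f i x) (\<lambda>x v. \<Sum>i\<in>I. D i x v * (\<Prod>j\<in>I - {i}. f j x)) x)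
     \<le> (LINT x|lebesgue. (\<Sum>i\<in>I. cost (f i) (D i) x))"
  proof (rule integral_mono)
    show "integrable lebesgue (cost (\<lambda>x. \<Prod>i\<in>I. f i x) (\<lambda>x v. \<Sum>i\<in>I. D i x v * (\<Prod>j\<in>I - {i}. f j x)))"
      by (intro cost_integrable C1_prod assms)
    show "integrable lebesgue (\<lambda>x. \<Sum>i\<in>I. cost (f i) (D i) x)"
      by (intro Bochner_Integration.integrable_sum cost_integrable assms)
    fix x
    have "\<bar>\<Sum>i\<in>I. D i x (\<phi> x) * (\<Prod>j\<in>I - {i}. f j x)\<bar> \<le> (\<Sum>i\<in>I. \<bar>D i x (\<phi> x)\<bar>)"
    proof (rule order.trans[OF sum_abs], rule sum_mono)
      fix i assume "i \<in> I"
      have "0 \<le> (\<Prod>j\<in>I - {i}. f j x)" "(\<Prod>j\<in>I - {i}. f j x) \<le> 1"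
        using assms(3) by (auto intro!: prod_nonneg prod_le_1)
      then show "\<bar>D i x (\<phi> x) * (\<Prod>j\<in>I - {i}. f j x)\<bar> \<le> \<bar>D i x (\<phi> x)\<bar>"
        by (simp add: abs_mult mult_left_le)
    qed
    moreover have "1 - (\<Prod>i\<in>I. f i x) \<le> (\<Sum>i\<in>I. 1 - f i x)"
      by (rule one_minus_prod_le[OF assms(1,3)])
    ultimately have "\<bar>\<Sum>i\<in>I. D i x (\<phi> x) * (\<Prod>j\<in>I - {i}. f j x)\<bar> + (1 - (\<Prod>i\<in>I. f i x)) \<le> (\<Sum>i\<in>I. \<bar>D i x (\<phi> x)\<bar> + (1 - f i x))"
      by (simp add: sum.distrib)
    then show "cost (\<lambda>x. \<Prod>i\<in>I. f i x) (\<lambda>x v. \<Sum>i\<in>I. D i x v * (\<Prod>j\<in>I - {i}. f j x)) x \<le> (\<Sum>i\<in>I. cost (f i) (D i) x)"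
      unfolding cost_def sum_distrib_left[symmetric] by (intro mult_left_mono) auto
  qed
  also have "\<dots> = (\<Sum>i\<in>I. LINT x|lebesgue. cost (f i) (D i) x)"
    by (intro Bochner_Integration.integral_sum cost_integrable assms)
  finally show ?thesis .
qed

lemma AE_phi_bound: "AE x in lebesgue. x \<in> \<Omega> \<longrightarrow> (\<forall>k. \<bar>\<phi> x $ k\<bar> \<le> 1)"
proof -
  have "AE x in lebesgue. x \<in> \<Omega> \<longrightarrow> norm (\<phi> x) \<le> 1" using bound by (simp add: AE_lebesgue_on_iff)
  then show ?thesis
    by eventually_elim (use component_le_norm_cart order.trans in blast)
qed

definition edge_cut :: "'n \<times> 'n \<times> real \<times> real \<Rightarrow> real \<Rightarrow> real^'n \<Rightarrow> real" where
  "edge_cut = (\<lambda>(i, j, s, t) e x. 1 - ridge s e (x $ i) * ridge t e (x $ j))"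

definition edge_cut' :: "'n \<times> 'n \<times> real \<times> real \<Rightarrow> real \<Rightarrow> real^'n \<Rightarrow> real^'n \<Rightarrow> real" where
  "edge_cut' = (\<lambda>(i, j, s, t) e x v. 0 - (ridge s e (x $ i) * (ridge' t e (x $ j) * v $ j) + (ridge' s e (x $ i) * v $ i) * ridge t e (x $ j)))"

lemma C1_edge_cut: "C1 (edge_cut z e) (edge_cut' z e)"
proof (cases z)
  case (fields i j s t)
  show ?thesis
    unfolding fields edge_cut_def edge_cut'_def prod.case by (intro C1_diff C1_const C1_mult C1_ridge)
qed

lemma edge_cut_bounds: "e > 0 \<Longrightarrow> 0 \<le> edge_cut z e x \<and> edge_cut z e x \<le> 1"
  by (cases z) (auto simp: edge_cut_def ridge intro!: mult_le_one mult_nonneg_nonneg)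

text \<open>The intersection of two coordinate hyperplanes has codimension two, so a cutoff of
  width \<open>e\<close> costs \<open>O(1/e)\<close> on a set of measure \<open>O(e\<^sup>2)\<close>.\<close>

lemma edge_cut_cost:
  assumes ij: "i \<noteq> j" and \<kappa>: "\<kappa> > 0"
  shows "\<forall>\<^sub>F e in at_right 0. (LINT x|lebesgue. cost (edge_cut (i, j, s, t) e) (edge_cut' (i, j, s, t) e) x) \<le> \<kappa>"
proof -
  obtain R where R: "R \<ge> 0" "\<And>x k. x \<in> \<Omega> \<Longrightarrow> \<bar>x $ k\<bar> \<le> R" by (rule domain_in_cbox, rule that)
  \<comment> \<open>Size of the cross section. A tube of half-width \<open>2 * e\<close> in two
    directions has measure \<open>16 * e * e * c\<close>, and the cost density is at most
    \<open>8 / e + 1\<close>; the product is the expression that tends to zero.\<close>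
  define c where "c = (2 * R) ^ (CARD('n) - 2)"
  have "((\<lambda>e. (8 + e) * (16 * e * c)) \<longlongrightarrow> (8 + 0) * (16 * 0 * c)) (at_right 0)" by (intro tendsto_intros)
  then have "\<forall>\<^sub>F e in at_right 0. (8 + e) * (16 * e * c) < \<kappa>" using \<kappa> by (intro order_tendstoD(2)) auto
  then show ?thesis
    using eventually_at_right_less[of "0::real"]
  proof eventually_elim
    case (elim e)
    note e = \<open>0 < e\<close>
    let ?l = "upd (upd (- vec R) i (s - 2 * e)) j (t - 2 * e)" and ?u = "upd (upd (vec R) i (s + 2 * e)) j (t + 2 * e)"
    have "(LINT x|lebesgue. cost (edge_cut (i, j, s, t) e) (edge_cut' (i, j, s, t) e) x) \<le> (8 / e + 1) * measure lebesgue (cbox ?l ?u)"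
    proof (rule integral_le_const_on_cbox[OF cost_integrable[OF C1_edge_cut]])
      show "AE x in lebesgue. cost (edge_cut (i, j, s, t) e) (edge_cut' (i, j, s, t) e) x \<le> (8 / e + 1) * indicator (cbox ?l ?u) x"
        using AE_phi_bound
      proof eventually_elim
        case (elim x)
        show ?case
        proof (cases "x \<in> \<Omega>")
          case True
          show ?thesis
          proof (cases "x \<in> cbox ?l ?u")
            case inside: True
            have "\<bar>ridge s e (x $ i) * (ridge' t e (x $ j) * \<phi> x $ j)\<bar> \<le> 1 * (4 / e * 1)"
              unfolding abs_mult using elim True e by (intro mult_mono) (auto simp: ridge)
            moreover have "\<bar>(ridge' s e (x $ i) * \<phi> x $ i) * ridge t e (x $ j)\<bar> \<le> (4 / e * 1) * 1"
              unfolding abs_mult using elim True e by (intro mult_mono) (auto simp: ridge)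
            ultimately have "\<bar>edge_cut' (i, j, s, t) e x (\<phi> x)\<bar> \<le> 8 / e" by (simp add: edge_cut'_def)
            then show ?thesis using True inside edge_cut_bounds[OF e, of "(i, j, s, t)" x] by (simp add: cost_def)
          next
            case False
            have "- R \<le> x $ k \<and> x $ k \<le> R" for k using R(2)[OF True, of k] by auto
            then have "\<bar>x $ i - s\<bar> > 2 * e \<or> \<bar>x $ j - t\<bar> > 2 * e"
              using False by (auto simp: mem_box_cart abs_if split: if_splits)
            then have "edge_cut' (i, j, s, t) e x (\<phi> x) = 0" "edge_cut (i, j, s, t) e x = 1"
              using e by (auto simp: edge_cut'_def edge_cut_def ridge)
            then show ?thesis using False by (simp add: cost_def)
          qed
        qed (use e in \<open>simp add: cost_def\<close>)
      qed
    qed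
    also have "\<dots> = (8 / e + 1) * (2 * (2 * e) * (2 * (2 * e) * c))"
      using measure_slab2[OF R(1) _ ij, of "2 * e" s t] e by (simp add: c_def)
    also have "\<dots> = (8 + e) * (16 * e * c)" using e by (simp add: field_simps)
    finally show ?case using elim by simp
  qed
qed

text \<open>Tangentially the cutoff acts fully from distance \<open>e / 2\<close> to the rim of the
  facet and has faded out at \<open>e / 4\<close>. It thus stays away from the rim, where other
  cells may touch, and still overlaps the zone of width \<open>e\<close> in which
  \<open>edge_cut\<close> takes over.\<close>

definition facet_cut :: "real \<Rightarrow> (real^'n) \<times> 'n \<times> real \<Rightarrow> real \<Rightarrow> real^'n \<Rightarrow> real" where
  "facet_cut e = (\<lambda>(a, i, s) \<delta> x. 1 - ridge s \<delta> (x $ i) * (\<Prod>j\<in>UNIV - {i}. bump (a $ j) (a $ j + h) (e / 4) (x $ j)))"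

definition facet_cut' :: "real \<Rightarrow> (real^'n) \<times> 'n \<times> real \<Rightarrow> real \<Rightarrow> real^'n \<Rightarrow> real^'n \<Rightarrow> real" where
  "facet_cut' e = (\<lambda>(a, i, s) \<delta> x v. 0 - (ridge s \<delta> (x $ i) *
      (\<Sum>j\<in>UNIV - {i}. bump' (a $ j) (a $ j + h) (e / 4) (x $ j) * v $ j * (\<Prod>k\<in>UNIV - {i} - {j}. bump (a $ k) (a $ k + h) (e / 4) (x $ k)))
      + (ridge' s \<delta> (x $ i) * v $ i) * (\<Prod>j\<in>UNIV - {i}. bump (a $ j) (a $ j + h) (e / 4) (x $ j))))"

lemma C1_facet_cut: "C1 (facet_cut e z \<delta>) (facet_cut' e z \<delta>)"
proof (cases z)
  case (fields a i s)
  show ?thesis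
    unfolding fields facet_cut_def facet_cut'_def prod.case
    by (intro C1_diff C1_const C1_mult C1_ridge C1_prod C1_bump)
qed

lemma bump_prod_bounds: "0 \<le> (\<Prod>j\<in>J. bump (a j) (b j) e (x j))" "(\<Prod>j\<in>J. bump (a j) (b j) e (x j)) \<le> 1"
  by (auto intro!: prod_nonneg prod_le_1 bump_bounds)

lemma facet_cut_bounds: "\<delta> > 0 \<Longrightarrow> 0 \<le> facet_cut e z \<delta> x \<and> facet_cut e z \<delta> x \<le> 1"
  by (cases z) (auto simp: facet_cut_def ridge bump_prod_bounds intro!: mult_le_one mult_nonneg_nonneg)

text \<open>The normal component of \<open>\<phi>\<close> vanishes on the facet and hence is \<open>O(\<delta>)\<close> where the normal
  derivative of the cutoff is \<open>O(1/\<delta>)\<close>; the tangential derivatives do not depend on \<open>\<delta>\<close>.\<close>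

lemma facet_cut_cost:
  assumes B: "boundary_facet a i s" and e: "e > 0" and \<kappa>: "\<kappa> > 0"
  shows "\<forall>\<^sub>F \<delta> in at_right 0. (LINT x|lebesgue. cost (facet_cut e (a, i, s) \<delta>) (facet_cut' e (a, i, s) \<delta>) x) \<le> \<kappa>"
proof -
  obtain R where R: "R \<ge> 0" "\<And>x k. x \<in> \<Omega> \<Longrightarrow> \<bar>x $ k\<bar> \<le> R" by (rule domain_in_cbox, rule that)
  have Q: "cube a h \<in> \<Q>" and s: "s = a $ i \<or> s = a $ i + h" using B by (auto simp: boundary_facet_def)
  \<comment> \<open>The compact core of the facet that carries the tangential bumps. No other cell
    meets it, so there is a gap \<open>d0\<close>; once \<open>2 * \<delta> < d0\<close>, the part
    of \<Omega> where the cutoff differs from 1 lies in the cell at \<open>a\<close>.\<close>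
  let ?A = "cbox (upd (a + vec (e / 4)) i s) (upd (a + vec (h - e / 4)) i s)"
  have "?A \<inter> \<Union>(\<Q> - {cube a h}) = {}"
  proof -
    have "y \<notin> Q'" if y: "y \<in> ?A" and Q': "Q' \<in> \<Q> - {cube a h}" for y Q'
    proof -
      have j: "a $ j < y $ j \<and> y $ j < a $ j + h" if "j \<noteq> i" for j
      proof -
        have "a $ j + e / 4 \<le> y $ j" "y $ j \<le> a $ j + (h - e / 4)" using y that by (auto simp: mem_box_cart dest!: spec[of _ j])
        then show ?thesis using e by linarith
      qed
      have "y $ i = s" using y by (auto simp: mem_box_cart dest!: spec[of _ i])
      with j have "facet_point a i s y" using Q s by (simp add: facet_point_def)
      then show ?thesis using B Q' by (auto simp: boundary_facet_def)
    qed
    then show ?thesis by blast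
  qed
  then obtain d0 where d0: "d0 > 0" "\<And>x y. x \<in> ?A \<Longrightarrow> y \<in> \<Union>(\<Q> - {cube a h}) \<Longrightarrow> d0 \<le> dist x y"
    using separate_compact_closed[OF compact_cbox closed_Union_cells[of "\<Q> - {cube a h}"]] by (metis Diff_subset)
  define c where "c = (2 * R) ^ (CARD('n) - 1)"
  \<comment> \<open>Each tangential slope is at most \<open>16 / e\<close>, from bumps of width
    \<open>e / 4\<close>. The normal part is a slope \<open>4 / \<delta>\<close> times a normal
    component of at most \<open>2 / h\<close> times \<open>2 * \<delta>\<close>, giving
    \<open>16 / h\<close>. The final 1 bounds one minus the cutoff.\<close>
  define L where "L = real CARD('n) * (16 / e) + 16 / h + 1"
  have L: "L \<ge> 0" unfolding L_def using e h_pos by simp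
  have "((\<lambda>\<delta>. L * (4 * \<delta> * c)) \<longlongrightarrow> L * (4 * 0 * c)) (at_right 0)" by (intro tendsto_intros)
  then have "\<forall>\<^sub>F \<delta> in at_right 0. L * (4 * \<delta> * c) < \<kappa>" using \<kappa> by (intro order_tendstoD(2)) auto
  moreover have "((\<lambda>\<delta>. 2 * \<delta>) \<longlongrightarrow> 2 * 0) (at_right (0::real))" by (intro tendsto_intros)
  then have "\<forall>\<^sub>F \<delta> in at_right 0. 2 * \<delta> < d0" using d0(1) by (intro order_tendstoD(2)) auto
  ultimately show ?thesis
    using eventually_at_right_less[of "0::real"]
  proof eventually_elim
    case (elim \<delta>)
    note \<delta> = \<open>0 < \<delta>\<close> \<open>2 * \<delta> < d0\<close>
    let ?l = "upd (- vec R) i (s - 2 * \<delta>)" and ?u = "upd (vec R) i (s + 2 * \<delta>)"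
    have "(LINT x|lebesgue. cost (facet_cut e (a, i, s) \<delta>) (facet_cut' e (a, i, s) \<delta>) x) \<le> L * measure lebesgue (cbox ?l ?u)"
    proof (rule integral_le_const_on_cbox[OF cost_integrable[OF C1_facet_cut]])
      show "AE x in lebesgue. cost (facet_cut e (a, i, s) \<delta>) (facet_cut' e (a, i, s) \<delta>) x \<le> L * indicator (cbox ?l ?u) x"
        using AE_phi_bound p_AE[OF Q]
      proof eventually_elim
        case (elim x)
        let ?b = "\<Prod>j\<in>UNIV - {i}. bump (a $ j) (a $ j + h) (e / 4) (x $ j)"
        let ?T = "\<Sum>j\<in>UNIV - {i}. bump' (a $ j) (a $ j + h) (e / 4) (x $ j) * \<phi> x $ j * (\<Prod>k\<in>UNIV - {i} - {j}. bump (a $ k) (a $ k + h) (e / 4) (x $ k))"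
        show ?case
        proof (cases "x \<in> \<Omega>")
          case True
          show ?thesis
          proof (cases "x \<in> cbox ?l ?u")
            case inside: True
            have xi: "\<bar>x $ i - s\<bar> \<le> 2 * \<delta>" using inside by (auto simp: mem_box_cart abs_if dest!: spec[of _ i])
            have "\<bar>?T\<bar> \<le> (\<Sum>j\<in>UNIV - {i}. 16 / e)"
            proof (rule order.trans[OF sum_abs], rule sum_mono)
              fix j
              have "\<bar>bump' (a $ j) (a $ j + h) (e / 4) (x $ j)\<bar> * \<bar>\<phi> x $ j\<bar> * \<bar>\<Prod>k\<in>UNIV - {i} - {j}. bump (a $ k) (a $ k + h) (e / 4) (x $ k)\<bar>
                \<le> (4 / (e / 4)) * 1 * 1"
                using elim True e by (intro mult_mono bump'_bound) (auto simp: bump_prod_bounds abs_of_nonneg)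
              then show "\<bar>bump' (a $ j) (a $ j + h) (e / 4) (x $ j) * \<phi> x $ j * (\<Prod>k\<in>UNIV - {i} - {j}. bump (a $ k) (a $ k + h) (e / 4) (x $ k))\<bar> \<le> 16 / e"
                by (simp add: abs_mult)
            qed
            also have "\<dots> \<le> real CARD('n) * (16 / e)"
              using e by (auto intro!: divide_right_mono mult_right_mono simp: card_Diff_singleton)
            finally have T: "\<bar>?T\<bar> \<le> real CARD('n) * (16 / e)" .
            have "\<bar>ridge s \<delta> (x $ i) * ?T\<bar> \<le> 1 * (real CARD('n) * (16 / e))"
              unfolding abs_mult using \<delta> T by (intro mult_mono) (auto simp: ridge)
            moreover have "\<bar>(ridge' s \<delta> (x $ i) * \<phi> x $ i) * ?b\<bar> \<le> 16 / h"
            proof (cases "?b = 0")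
              case True
              then show ?thesis using h_pos by (simp only: mult_zero_right abs_zero) simp
            next
              case False
              have bj: "bump (a $ j) (a $ j + h) (e / 4) (x $ j) \<noteq> 0" if "j \<noteq> i" for j
                using False that by (auto simp: prod_zero_iff)
              have xj: "a $ j + e / 4 \<le> x $ j \<and> x $ j \<le> a $ j + (h - e / 4)" if "j \<noteq> i" for j
                using bj[OF that] bump_zero(1)[of "e / 4" "x $ j" "a $ j" "a $ j + h"] e by argo
              have "upd x i s \<in> ?A" using xj by (auto simp: mem_box_cart)
              moreover have "dist (upd x i s) x < d0"
              proof -
                have "upd x i s - x = (s - x $ i) *\<^sub>R axis i 1" by (simp add: upd_eq)
                then show ?thesis using xi \<delta> by (simp add: dist_norm norm_axis_1)
              qed
              ultimately have "x \<notin> \<Union>(\<Q> - {cube a h})" using d0(2) by force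
              then have "x \<in> cube a h" using True domain_subset_cells by blast
              then have "\<phi> x = p a x" using elim by blast
              then have "\<bar>\<phi> x $ i\<bar> \<le> 2 / h * (2 * \<delta>)"
                unfolding p_boundary[OF B] abs_mult
                using coef_bound[OF Q] xi h_pos by (simp only: p_boundary[OF B] abs_mult) (intro mult_mono; simp)
              then have "\<bar>ridge' s \<delta> (x $ i)\<bar> * \<bar>\<phi> x $ i\<bar> * \<bar>?b\<bar> \<le> (4 / \<delta>) * (2 / h * (2 * \<delta>)) * 1"
                using \<delta> h_pos by (intro mult_mono ridge(6)) (auto simp: bump_prod_bounds abs_of_nonneg)
              then show ?thesis using \<delta> by (simp add: abs_mult)
            qed
            ultimately have "\<bar>facet_cut' e (a, i, s) \<delta> x (\<phi> x)\<bar> \<le> real CARD('n) * (16 / e) + 16 / h"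
              unfolding facet_cut'_def prod.case by linarith
            then show ?thesis using True inside facet_cut_bounds[OF \<delta>(1), of e "(a, i, s)" x] by (simp add: cost_def L_def)
          next
            case False
            have "- R \<le> x $ k \<and> x $ k \<le> R" for k using R(2)[OF True, of k] by auto
            then have "\<bar>x $ i - s\<bar> > 2 * \<delta>"
              using False by (auto simp: mem_box_cart abs_if split: if_splits)
            then have "facet_cut' e (a, i, s) \<delta> x (\<phi> x) = 0" "facet_cut e (a, i, s) \<delta> x = 1"
              using \<delta> by (auto simp: facet_cut'_def facet_cut_def ridge)
            then show ?thesis using False by (simp add: cost_def)
          qed
        qed (use L in \<open>simp add: cost_def\<close>)
      qed
    qed
    also have "\<dots> = L * (4 * \<delta> * c)"
      using measure_slab[OF R(1), of "2 * \<delta>" i s] \<delta> by (simp add: c_def)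
    finally show ?case using elim by simp
  qed
qed

end

subsection \<open>The total variation bounds\<close>

context rt0_field begin

text \<open>Edge cutoffs remove the skeleton where facets meet and the normal may be undefined;
  facet cutoffs remove what is left of the frontier.\<close>

lemma cutoff_exists:
  assumes "\<kappa> > 0"
  obtains \<eta> where "\<eta> \<in> C1c \<Omega>" "\<And>x. 0 \<le> \<eta> x" "\<And>x. \<eta> x \<le> 1"
    "integrable lebesgue (cost \<eta> (\<lambda>x. frechet_derivative \<eta> (at x)))"
    "(LINT x|lebesgue. cost \<eta> (\<lambda>x. frechet_derivative \<eta> (at x)) x) \<le> \<kappa>"
proof -
  \<comment> \<open>All levels of cell faces. The edge cutoffs use complete intersections of two
    coordinate hyperplanes at such levels, including those that run through the interior of
    \<Omega>: they are finitely many and each can be made cheap.\<close>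
  define Z where "Z = (\<lambda>(a, k). a $ k) ` (corners \<times> (UNIV::'n set)) \<union> (\<lambda>(a, k). a $ k + h) ` (corners \<times> (UNIV::'n set))"
  have Z: "finite Z" using finite_corners by (simp add: Z_def)
  have inZ: "a $ k \<in> Z \<and> a $ k + h \<in> Z" if "cube a h \<in> \<Q>" for a k
    using that by (force simp: Z_def corners_def)
  define I where "I = {(i::'n, j::'n, s, t). i \<noteq> j \<and> s \<in> Z \<and> t \<in> Z}"
  have I: "finite I"
    by (rule finite_subset[of _ "UNIV \<times> UNIV \<times> Z \<times> Z"]) (use Z in \<open>auto simp: I_def\<close>)
  define J where "J = {(a, i, s). boundary_facet a i s}"
  have J: "finite J"
  proof (rule finite_subset[of _ "corners \<times> UNIV \<times> Z"])
    show "J \<subseteq> corners \<times> UNIV \<times> Z" using inZ by (auto simp: J_def boundary_facet_def corners_def)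
  qed (use Z finite_corners in auto)
  define \<kappa>' where "\<kappa>' = \<kappa> / (real (card I) + real (card J) + 1)"
  have \<kappa>': "\<kappa>' > 0" unfolding \<kappa>'_def using assms by (intro divide_pos_pos) auto
  have "\<forall>\<^sub>F e in at_right 0. \<forall>z\<in>I. (LINT x|lebesgue. cost (edge_cut z e) (edge_cut' z e) x) \<le> \<kappa>'"
    using edge_cut_cost[OF _ \<kappa>'] by (intro eventually_ball_finite[OF I]) (auto simp: I_def)
  then have "\<forall>\<^sub>F e in at_right 0. 0 < e \<and> (\<forall>z\<in>I. (LINT x|lebesgue. cost (edge_cut z e) (edge_cut' z e) x) \<le> \<kappa>')"
    using eventually_at_right_less[of "0::real"] by eventually_elim auto
  then obtain e where e: "0 < e" "\<And>z. z \<in> I \<Longrightarrow> (LINT x|lebesgue. cost (edge_cut z e) (edge_cut' z e) x) \<le> \<kappa>'"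
    using eventually_happens[of _ "at_right (0::real)"] trivial_limit_at_right_real by blast
  have "\<forall>\<^sub>F \<delta> in at_right 0. \<forall>z\<in>J. (LINT x|lebesgue. cost (facet_cut e z \<delta>) (facet_cut' e z \<delta>) x) \<le> \<kappa>'"
    using facet_cut_cost[OF _ e(1) \<kappa>'] by (intro eventually_ball_finite[OF J]) (auto simp: J_def)
  then have "\<forall>\<^sub>F \<delta> in at_right 0. 0 < \<delta> \<and> (\<forall>z\<in>J. (LINT x|lebesgue. cost (facet_cut e z \<delta>) (facet_cut' e z \<delta>) x) \<le> \<kappa>')"
    using eventually_at_right_less[of "0::real"] by eventually_elim auto
  \<comment> \<open>The width \<delta> is chosen after \<open>e\<close>: the tangential cost density
    of a facet cutoff grows like \<open>1 / e\<close> and is beaten only by the thinness of its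
    support.\<close>
  then obtain \<delta> where \<delta>: "0 < \<delta>" "\<And>z. z \<in> J \<Longrightarrow> (LINT x|lebesgue. cost (facet_cut e z \<delta>) (facet_cut' e z \<delta>) x) \<le> \<kappa>'"
    using eventually_happens[of _ "at_right (0::real)"] trivial_limit_at_right_real by blast
  define f where "f = case_sum (\<lambda>z. edge_cut z e) (\<lambda>z. facet_cut e z \<delta>)"
  define D where "D = case_sum (\<lambda>z. edge_cut' z e) (\<lambda>z. facet_cut' e z \<delta>)"
  let ?S = "I <+> J"
  have S: "finite ?S" using I J by simp
  have fD: "C1 (f k) (D k)" for k
    by (cases k) (auto simp: f_def D_def C1_edge_cut C1_facet_cut)
  have fb: "0 \<le> f k x \<and> f k x \<le> 1" for k x
    using edge_cut_bounds[OF e(1)] facet_cut_bounds[OF \<delta>(1)] by (cases k) (auto simp: f_def)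
  define F where "F x = (\<Prod>k\<in>?S. f k x)" for x
  define DF where "DF x v = (\<Sum>i\<in>?S. D i x v * (\<Prod>j\<in>?S - {i}. f j x))" for x v
  have CF: "C1 F DF" unfolding F_def[abs_def] DF_def[abs_def] by (intro C1_prod fD)
  have F1: "0 \<le> F x" "F x \<le> 1" for x using fb by (auto simp: F_def intro!: prod_nonneg prod_le_1)
  have "(LINT x|lebesgue. cost F DF x) \<le> (\<Sum>k\<in>?S. LINT x|lebesgue. cost (f k) (D k) x)"
    unfolding F_def[abs_def] DF_def[abs_def] by (rule cost_prod_le[OF S fD fb])
  also have "\<dots> = (\<Sum>z\<in>I. LINT x|lebesgue. cost (edge_cut z e) (edge_cut' z e) x) + (\<Sum>z\<in>J. LINT x|lebesgue. cost (facet_cut e z \<delta>) (facet_cut' e z \<delta>) x)"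
    by (subst sum.Plus[OF I J]) (simp add: f_def D_def)
  also have "\<dots> \<le> (\<Sum>z\<in>I. \<kappa>') + (\<Sum>z\<in>J. \<kappa>')"
    by (intro add_mono sum_mono e \<delta>)
  also have "\<dots> = (real (card I) + real (card J)) * \<kappa>'" by (simp add: algebra_simps)
  also have "\<dots> \<le> \<kappa>"
  proof -
    have "(real (card I) + real (card J)) * \<kappa>' \<le> (real (card I) + real (card J) + 1) * \<kappa>'"
      using \<kappa>' by (intro mult_right_mono) auto
    also have "\<dots> = \<kappa>" by (simp add: \<kappa>'_def add_nonneg_eq_0_iff)
    finally show ?thesis .
  qed
  finally have cF: "(LINT x|lebesgue. cost F DF x) \<le> \<kappa>" .
  have zero: "F x = 0" if "k \<in> ?S" "f k x = 0" for k x
    unfolding F_def using S that by (intro prod_zero) auto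
  define N where "N = interior {x. F x = 0}"
  have N: "open N" "\<And>x. x \<in> N \<Longrightarrow> F x = 0" unfolding N_def using interior_subset by auto
  have frN: "frontier \<Omega> \<subseteq> N"
  proof
    fix x assume x: "x \<in> frontier \<Omega>"
    obtain a i s where a: "cube a h \<in> \<Q>" "x \<in> cube a h" and s: "s = a $ i \<or> s = a $ i + h" and xi: "x $ i = s"
      by (rule frontier_cases[OF x]) blast
    have sZ: "s \<in> Z" using s inZ[OF a(1)] by auto
    \<comment> \<open>If a second coordinate is within \<open>e\<close> of a face level, an edge
      cutoff vanishes around \<open>x\<close>. Otherwise \<open>x\<close> is relatively interior to
      a facet, which is a boundary facet because \<open>x\<close> is not in \<Omega>.\<close>
    show "x \<in> N"
    proof (cases "\<exists>j t. j \<noteq> i \<and> (t = a $ j \<or> t = a $ j + h) \<and> \<bar>x $ j - t\<bar> < e")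
      case True
      then obtain j t where j: "j \<noteq> i" "t = a $ j \<or> t = a $ j + h" "\<bar>x $ j - t\<bar> < e" by blast
      have tZ: "t \<in> Z" using j(2) inZ[OF a(1)] by auto
      have k: "Inl (i, j, s, t) \<in> ?S" using j(1) sZ tZ by (auto simp: I_def)
      let ?U = "{y. \<bar>y $ i - s\<bar> < e} \<inter> {y. \<bar>y $ j - t\<bar> < e}"
      have "open ?U" by (intro open_Int open_Collect_less continuous_intros)
      moreover have "x \<in> ?U" using xi j e(1) by simp
      moreover have "?U \<subseteq> {x. F x = 0}"
      proof
        fix y assume "y \<in> ?U"
        then have "f (Inl (i, j, s, t)) y = 0" using e(1) by (simp add: f_def edge_cut_def ridge)
        then show "y \<in> {x. F x = 0}" using zero[OF k] by simp
      qed
      ultimately show ?thesis unfolding N_def by (rule interiorI)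
    next
      case False
      have xj: "a $ j + e \<le> x $ j \<and> x $ j \<le> a $ j + h - e" if "j \<noteq> i" for j
      proof -
        have "\<bar>x $ j - a $ j\<bar> \<ge> e" "\<bar>x $ j - (a $ j + h)\<bar> \<ge> e" using False that by (auto simp: not_less)
        moreover have "a $ j \<le> x $ j" "x $ j \<le> a $ j + h" using a(2) by (auto simp: cube_cbox)
        ultimately show ?thesis by linarith
      qed
      have fp: "facet_point a i s x"
        unfolding facet_point_def
      proof (intro conjI allI impI)
        fix j assume "j \<noteq> i"
        from xj[OF this] e(1) show "a $ j < x $ j" "x $ j < a $ j + h" by linarith+
      qed (use a s xi in auto)
      have "x \<notin> \<Omega>" using x open_domain by (simp add: frontier_def interior_open)
      then have k: "Inr (a, i, s) \<in> ?S" using boundary_facetI[OF fp] by (auto simp: J_def)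
      let ?U = "box (upd (a + vec (e / 2)) i (s - \<delta>)) (upd (a + vec (h - e / 2)) i (s + \<delta>))"
      have "x \<in> ?U"
        unfolding mem_box_cart
      proof
        fix j
        show "upd (a + vec (e / 2)) i (s - \<delta>) $ j < x $ j \<and> x $ j < upd (a + vec (h - e / 2)) i (s + \<delta>) $ j"
          using xj[of j] xi \<delta>(1) e(1) by (cases "j = i") auto
      qed
      moreover have "?U \<subseteq> {x. F x = 0}"
      proof
        fix y assume y: "y \<in> ?U"
        have yi: "\<bar>y $ i - s\<bar> \<le> \<delta>" using y by (auto simp: mem_box_cart dest!: spec[of _ i])
        have "bump (a $ j) (a $ j + h) (e / 4) (y $ j) = 1" if "j \<noteq> i" for j
        proof (rule bump_one(1))
          show "a $ j + 2 * (e / 4) \<le> y $ j" "y $ j \<le> a $ j + h - 2 * (e / 4)"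
            using y that by (auto simp: mem_box_cart dest!: spec[of _ j])
        qed (use e in simp)
        then have "f (Inr (a, i, s)) y = 0" using ridge(5)[OF \<delta>(1) yi] by (simp add: f_def facet_cut_def)
        then show "y \<in> {x. F x = 0}" using zero[OF k] by simp
      qed
      ultimately show ?thesis unfolding N_def by (intro interiorI[OF open_box])
    qed
  qed
  let ?\<eta> = "\<lambda>x. if x \<in> \<Omega> then F x else 0"
  note R = C1c_restrict[OF CF N(1) frN N(2)]
  have c: "cost ?\<eta> (\<lambda>x. frechet_derivative ?\<eta> (at x)) x = cost F DF x" for x
    using R(2)[of x] by (cases "x \<in> \<Omega>") (simp_all add: cost_def)
  show ?thesis
    by (rule that[of ?\<eta>]) (use R(1) F1 cF cost_integrable[OF CF] in \<open>auto simp: c[abs_def]\<close>)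
qed

lemma AE_g_bound: "AE x in lebesgue. x \<in> \<Omega> \<longrightarrow> \<bar>g x\<bar> \<le> 2 * real CARD('n) / h"
proof -
  have "AE x in lebesgue. \<forall>a\<in>corners. x \<in> cube a h \<longrightarrow> g x = d a"
    using g_AE by (intro AE_finite_allI finite_corners) (simp add: corners_def)
  then show ?thesis
    using AE_unique_cell
  proof eventually_elim
    case (elim x)
    show ?case
    proof
      assume "x \<in> \<Omega>"
      then obtain a where a: "a \<in> corners" "x \<in> box a (a + vec h)" using elim(2) by blast
      then have "g x = d a" using elim(1) box_subset_cbox unfolding cube_eq by blast
      then show "\<bar>g x\<bar> \<le> 2 * real CARD('n) / h" using a(1) d_bound by (simp add: corners_def)
    qed
  qed
qed

text \<open>Inserting \<eta> changes the integrand by \<open>w\<close> times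
  \<open>g (1 - \<eta>)\<close> minus the derivative of \<eta> along \<phi>. The bounds on
  \<open>w\<close> and \<open>g\<close> dominate this by a multiple of \<open>cost\<close>, which
  can be made arbitrarily small.\<close>

lemma integral_divergence_le_TV:
  assumes w: "w \<in> borel_measurable (lebesgue_on \<Omega>)" "AE x in lebesgue_on \<Omega>. \<bar>w x\<bar> \<le> M"
    and T: "TV \<Omega> w \<le> ereal T"
  shows "(LINT x|lebesgue_on \<Omega>. w x * g x) \<le> T"
proof (rule field_le_epsilon)
  fix \<epsilon> :: real assume \<epsilon>: "\<epsilon> > 0"
  \<comment> \<open>Covers both the bound on \<open>w g\<close> and the one on \<open>w\<close>; the
    final 1 permits division by \<open>L\<close> when \<open>M = 0\<close>.\<close>
  define L where "L = \<bar>M\<bar> * (2 * real CARD('n) / h + 1) + 1"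
  have L: "L > 0" unfolding L_def using h_pos by (intro add_nonneg_pos mult_nonneg_nonneg) auto
  obtain \<eta> where \<eta>: "\<eta> \<in> C1c \<Omega>" "\<And>x. 0 \<le> \<eta> x" "\<And>x. \<eta> x \<le> 1"
    and ic: "integrable lebesgue (cost \<eta> (\<lambda>x. frechet_derivative \<eta> (at x)))"
    and c: "(LINT x|lebesgue. cost \<eta> (\<lambda>x. frechet_derivative \<eta> (at x)) x) \<le> \<epsilon> / L"
    by (rule cutoff_exists[of "\<epsilon> / L"]) (use \<epsilon> L in auto)
  let ?D = "\<lambda>x. frechet_derivative \<eta> (at x)"
  define W where "W x = indicator \<Omega> x * w x" for x
  have Wm: "W \<in> borel_measurable lebesgue"
    using w(1) unfolding W_def by (subst (asm) borel_measurable_restrict_space_iff) auto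
  have WM: "AE x in lebesgue. \<bar>W x\<bar> \<le> \<bar>M\<bar>"
  proof -
    have "AE x in lebesgue. x \<in> \<Omega> \<longrightarrow> \<bar>w x\<bar> \<le> M" using w(2) by (simp add: AE_lebesgue_on_iff)
    then show ?thesis by eventually_elim (auto simp: W_def indicator_def)
  qed
  have C: "C1 \<eta> ?D" by (rule C1c_imp_C1[OF \<eta>(1)])
  have i1: "integrable lebesgue (\<lambda>x. (indicator \<Omega> x * g x) * W x)"
    by (rule integrable_mult_AE_bounded[OF g_integrable Wm WM])
  have i2: "integrable lebesgue (\<lambda>x. ((indicator \<Omega> x * g x) * W x) * \<eta> x)"
    by (rule integrable_mult_bounded[OF i1 continuous_imp_measurable_lebesgue[OF C1D(4)[OF C]], of 1]) (use \<eta> in auto)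
  have i3: "integrable lebesgue (\<lambda>x. (1 * (indicator \<Omega> x * ?D x (\<phi> x))) * W x)"
    by (intro integrable_mult_AE_bounded[OF _ Wm WM] test_integrand_integrable[OF C] continuous_intros)
  have "(LINT x|lebesgue_on \<Omega>. w x * g x) - (LINT x|lebesgue_on \<Omega>. w x * (g x * \<eta> x + ?D x (\<phi> x)))
     = (LINT x|lebesgue. (indicator \<Omega> x * g x) * W x) - (LINT x|lebesgue. ((indicator \<Omega> x * g x) * W x) * \<eta> x + (1 * (indicator \<Omega> x * ?D x (\<phi> x))) * W x)"
    by (simp add: integral_restrict_space W_def)
      (intro arg_cong2[where f="(-)"] Bochner_Integration.integral_cong refl; simp add: indicator_def algebra_simps)
  also have "\<dots> = (LINT x|lebesgue. (indicator \<Omega> x * g x) * W x - (((indicator \<Omega> x * g x) * W x) * \<eta> x + (1 * (indicator \<Omega> x * ?D x (\<phi> x))) * W x))"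
    by (rule Bochner_Integration.integral_diff[symmetric, OF i1 Bochner_Integration.integrable_add[OF i2 i3]])
  also have "\<dots> \<le> (LINT x|lebesgue. L * cost \<eta> ?D x)"
  proof (rule integral_mono_AE)
    show "integrable lebesgue (\<lambda>x. (indicator \<Omega> x * g x) * W x - (((indicator \<Omega> x * g x) * W x) * \<eta> x + (1 * (indicator \<Omega> x * ?D x (\<phi> x))) * W x))"
      by (intro Bochner_Integration.integrable_diff Bochner_Integration.integrable_add i1 i2 i3)
    show "integrable lebesgue (\<lambda>x. L * cost \<eta> ?D x)" using ic by simp
    show "AE x in lebesgue. (indicator \<Omega> x * g x) * W x - (((indicator \<Omega> x * g x) * W x) * \<eta> x + (1 * (indicator \<Omega> x * ?D x (\<phi> x))) * W x)
        \<le> L * cost \<eta> ?D x"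
      using WM AE_g_bound
    proof eventually_elim
      case (elim x)
      show ?case
      proof (cases "x \<in> \<Omega>")
        case True
        define G where "G = 2 * real CARD('n) / h"
        have G: "G \<ge> 0" unfolding G_def using h_pos by simp
        have e1: "\<bar>g x\<bar> \<le> G" using elim(2) True by (simp add: G_def)
        have "g x * W x * (1 - \<eta> x) \<le> \<bar>g x\<bar> * \<bar>W x\<bar> * (1 - \<eta> x)"
          using \<eta>(3)[of x] by (intro mult_right_mono) (auto simp: abs_mult[symmetric])
        also have "\<dots> \<le> G * \<bar>M\<bar> * (1 - \<eta> x)"
          using e1 elim(1) G \<eta>(3)[of x] by (intro mult_right_mono mult_mono) auto
        also have "\<dots> \<le> L * (1 - \<eta> x)"
          using \<eta>(3)[of x] unfolding L_def G_def[symmetric] by (intro mult_right_mono) (auto simp: algebra_simps)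
        finally have 1: "g x * W x * (1 - \<eta> x) \<le> L * (1 - \<eta> x)" .
        have "- (?D x (\<phi> x) * W x) \<le> \<bar>?D x (\<phi> x)\<bar> * \<bar>W x\<bar>" by (simp add: abs_mult[symmetric])
        also have "\<dots> \<le> \<bar>?D x (\<phi> x)\<bar> * L"
        proof (rule mult_left_mono)
          have "\<bar>M\<bar> \<le> L" unfolding L_def G_def[symmetric] using mult_nonneg_nonneg[OF abs_ge_zero[of M] G] by (simp add: algebra_simps)
          then show "\<bar>W x\<bar> \<le> L" using elim(1) by linarith
        qed simp
        finally have 2: "- (?D x (\<phi> x) * W x) \<le> L * \<bar>?D x (\<phi> x)\<bar>" by (simp add: mult.commute)
        show ?thesis using 1 2 True by (simp add: cost_def algebra_simps)
      qed (simp add: W_def cost_def)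
    qed
  qed
  also have "\<dots> = L * (LINT x|lebesgue. cost \<eta> ?D x)" by simp
  also have "\<dots> \<le> \<epsilon>" using c L by (simp add: field_simps)
  finally have "(LINT x|lebesgue_on \<Omega>. w x * g x) \<le> (LINT x|lebesgue_on \<Omega>. w x * (g x * \<eta> x + ?D x (\<phi> x))) + \<epsilon>" by simp
  moreover have "ereal (LINT x|lebesgue_on \<Omega>. w x * (g x * \<eta> x + ?D x (\<phi> x))) \<le> ereal T"
    using cutoff_le_TV[OF \<eta> w] T by (rule order.trans)
  ultimately show "(LINT x|lebesgue_on \<Omega>. w x * g x) \<le> T + \<epsilon>" by simp
qed

end

section \<open>The rounding error on a mesh\<close>

lemma C1_scaleR_const: "C1 f D \<Longrightarrow> C1 (\<lambda>x. c *\<^sub>R f x) (\<lambda>x v. c *\<^sub>R D x v)"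
  unfolding C1_def by (auto intro!: derivative_intros continuous_intros)

context tiled_domain begin

lemma domain_in_sets: "\<Omega> \<in> sets lebesgue"
  using open_domain by auto

lemma measure_cell: "measure lebesgue (cube (a :: real^'n) h) = h ^ CARD('n)"
  unfolding cube_eq using h_pos by (subst measure_cbox_cart) auto

text \<open>The Poincare fields of different cells have disjoint supports, so their sum is no larger
  than each of them; divided by the dimension times \<open>h\<close> it is one test field for
  \<open>TV\<close>, which handles all cells at once. The locale parameter \<open>h\<close> will be
  the size \<tau> of the input mesh.\<close>

lemma cell_deviation_le_TV:
  assumes w: "integrable (lebesgue_on \<Omega>) w" and T: "TV \<Omega> w \<le> ereal T"
  shows "(\<Sum>a\<in>corners. LINT x|lebesgue. \<bar>indicator \<Omega> x * w x - cell_mean w (cube a h)\<bar> * indicator (cube a h) x)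
    \<le> real CARD('n) * h * T"
proof -
  define W where "W x = indicator \<Omega> x * w x" for x
  define m where "m a = cell_mean w (cube a h)" for a
  let ?n = "real CARD('n)"
  have nh: "?n * h > 0" using h_pos by simp
  have iW: "integrable lebesgue W"
    using w domain_in_sets unfolding W_def by (subst (asm) integrable_restrict_space) auto
  have m0: "(LINT x|lebesgue. (W x - m a) * indicator (cube a h) x) = 0" if a: "a \<in> corners" for a
  proof -
    have Q: "cube a h \<in> \<Q>" using a by (simp add: corners_def)
    have Qm: "cube a h \<in> sets lebesgue" by (simp add: cube_eq)
    have iQ: "integrable lebesgue (\<lambda>x. indicator (cube a h) x :: real)"
      using bounded_set_imp_lmeasurable[of "cube a h"] Qm unfolding cube_eq
      by (intro integrable_real_indicator) (auto simp: fmeasurable_def)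
    have iWQ: "integrable lebesgue (\<lambda>x. W x * indicator (cube a h) x)"
      by (rule integrable_real_mult_indicator[OF Qm iW])
    have "(LINT x|lebesgue_on (cube a h). w x) = (LINT x|lebesgue. indicator (cube a h) x * w x)"
      using Qm by (simp add: integral_restrict_space)
    also have "\<dots> = (LINT x|lebesgue. W x * indicator (cube a h) x)"
    proof (rule lebesgue_integral_AE_eq(1)[OF borel_measurable_integrable[OF iWQ]])
      show "AE x in lebesgue. W x * indicator (cube a h) x = indicator (cube a h) x * w x"
        using AE_box_of_cbox[of a "a + vec h"]
        by eventually_elim (use box_subset_domain[OF Q] in \<open>auto simp: W_def indicator_def cube_eq\<close>)
    qed
    finally have "(LINT x|lebesgue. W x * indicator (cube a h) x) = m a * measure lebesgue (cube a h)"
      using h_pos by (simp add: m_def cell_mean_def measure_cell)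
    moreover have "(LINT x|lebesgue. (W x - m a) * indicator (cube a h) x)
        = (LINT x|lebesgue. W x * indicator (cube a h) x) - (LINT x|lebesgue. m a * indicator (cube a h) x)"
      by (subst Bochner_Integration.integral_diff[OF iWQ integrable_mult_right[OF iQ], symmetric]) (simp add: algebra_simps)
    ultimately show ?thesis using Qm by simp
  qed
  have "(\<Sum>a\<in>corners. LINT x|lebesgue. \<bar>W x - m a\<bar> * indicator (cube a h) x) \<le> ?n * h * T"
  proof (rule field_le_epsilon)
    fix \<epsilon> :: real assume \<epsilon>: "\<epsilon> > 0"
    define \<kappa> where "\<kappa> = \<epsilon> / (real (card corners) + 1)"
    have \<kappa>: "\<kappa> > 0" using \<epsilon> by (simp add: \<kappa>_def add_nonneg_pos)
    have "\<forall>a\<in>corners. \<exists>\<phi>. \<phi> \<in> C1c (box a (a + vec h)) \<and> (\<forall>x. norm (\<phi> x) \<le> ?n * h) \<and> (\<forall>x. \<bar>divergence \<phi> x\<bar> \<le> 2 + 16 * ?n) \<and>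
        (LINT x|lebesgue. \<bar>W x - m a\<bar> * indicator (cube a h) x) - \<kappa> \<le> (LINT x|lebesgue. W x * divergence \<phi> x)"
    proof
      fix a assume a: "a \<in> corners"
      show "\<exists>\<phi>. \<phi> \<in> C1c (box a (a + vec h)) \<and> (\<forall>x. norm (\<phi> x) \<le> ?n * h) \<and> (\<forall>x. \<bar>divergence \<phi> x\<bar> \<le> 2 + 16 * ?n) \<and>
        (LINT x|lebesgue. \<bar>W x - m a\<bar> * indicator (cube a h) x) - \<kappa> \<le> (LINT x|lebesgue. W x * divergence \<phi> x)"
        by (rule cube_poincare[OF iW h_pos \<kappa> m0[OF a]]) blast
    qed
    from bchoice[OF this] obtain \<phi> where \<phi>': "\<forall>a\<in>corners. \<phi> a \<in> C1c (box a (a + vec h)) \<and> (\<forall>x. norm (\<phi> a x) \<le> ?n * h) \<and> (\<forall>x. \<bar>divergence (\<phi> a) x\<bar> \<le> 2 + 16 * ?n) \<and>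
        (LINT x|lebesgue. \<bar>W x - m a\<bar> * indicator (cube a h) x) - \<kappa> \<le> (LINT x|lebesgue. W x * divergence (\<phi> a) x)"
      by (elim exE) (rule that)
    then have \<phi>: "\<And>a. a \<in> corners \<Longrightarrow> \<phi> a \<in> C1c (box a (a + vec h))" "\<And>a x. a \<in> corners \<Longrightarrow> norm (\<phi> a x) \<le> ?n * h"
      "\<And>a x. a \<in> corners \<Longrightarrow> \<bar>divergence (\<phi> a) x\<bar> \<le> 2 + 16 * ?n"
      "\<And>a. a \<in> corners \<Longrightarrow> (LINT x|lebesgue. \<bar>W x - m a\<bar> * indicator (cube a h) x) - \<kappa> \<le> (LINT x|lebesgue. W x * divergence (\<phi> a) x)"
      by (-, blast+)
    define c where "c = 1 / (?n * h)"
    define \<Phi> where "\<Phi> x = c *\<^sub>R (\<Sum>a\<in>corners. \<phi> a x)" for x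
    let ?D = "\<lambda>a x. frechet_derivative (\<phi> a) (at x)"
    have C: "C1 (\<phi> a) (?D a)" if "a \<in> corners" for a by (rule C1c_imp_C1[OF \<phi>(1)[OF that]])
    have C\<Phi>: "C1 \<Phi> (\<lambda>x v. c *\<^sub>R (\<Sum>a\<in>corners. ?D a x v))"
      unfolding \<Phi>_def[abs_def] by (intro C1_scaleR_const C1_sum C)
    have div: "divergence \<Phi> x = c * (\<Sum>a\<in>corners. divergence (\<phi> a) x)" for x
    proof -
      have "divergence \<Phi> x = (\<Sum>i\<in>UNIV. (c *\<^sub>R (\<Sum>a\<in>corners. ?D a x (axis i 1))) $ i)"
        by (rule divergence_C1[OF C\<Phi>])
      also have "\<dots> = c * (\<Sum>i\<in>UNIV. \<Sum>a\<in>corners. ?D a x (axis i 1) $ i)"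
        by (simp add: sum_distrib_left)
      also have "\<dots> = c * (\<Sum>a\<in>corners. divergence (\<phi> a) x)"
        unfolding divergence_def by (subst sum.swap) (rule refl)
      finally show ?thesis .
    qed
    have \<Phi>c: "\<Phi> \<in> C1c \<Omega>"
    proof (rule C1_imp_C1c[OF C\<Phi>])
      let ?K = "\<Union>a\<in>corners. closure {x. \<phi> a x \<noteq> 0}"
      show "compact ?K" using \<phi>(1) by (intro compact_UN finite_corners) (auto simp: C1c_def)
      show "?K \<subseteq> \<Omega>"
      proof
        fix x assume "x \<in> ?K"
        then obtain a where a: "a \<in> corners" "x \<in> closure {x. \<phi> a x \<noteq> 0}" by blast
        then have "x \<in> box a (a + vec h)" using \<phi>(1)[OF a(1)] by (auto simp: C1c_def)
        then show "x \<in> \<Omega>" using box_subset_domain a(1) by (auto simp: corners_def)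
      qed
      show "\<Phi> x = 0" if "x \<notin> ?K" for x
      proof -
        have "\<phi> a x = 0" if "a \<in> corners" for a
          using \<open>x \<notin> ?K\<close> that closure_subset[of "{x. \<phi> a x \<noteq> 0}"] by blast
        then show ?thesis by (simp add: \<Phi>_def)
      qed
    qed
    have \<Phi>1: "norm (\<Phi> x) \<le> 1" for x
    proof -
      have "norm (\<Sum>a\<in>corners. \<phi> a x) \<le> ?n * h"
      proof (cases "\<exists>a\<in>corners. x \<in> box a (a + vec h)")
        case True
        then obtain a where a: "a \<in> corners" "x \<in> box a (a + vec h)" by blast
        have "\<phi> b x = 0" if "b \<in> corners - {a}" for b
          using that a cell_unique[of a b x] C1c_outside[OF \<phi>(1), of b x] by blast
        then have "(\<Sum>b\<in>corners. \<phi> b x) = (\<Sum>b\<in>{a}. \<phi> b x)"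
          using a(1) finite_corners by (intro sum.mono_neutral_right) auto
        then show ?thesis using \<phi>(2)[OF a(1), of x] by simp
      next
        case False
        then have "\<phi> b x = 0" if "b \<in> corners" for b using C1c_outside[OF \<phi>(1)[OF that]] that by blast
        then show ?thesis using nh by simp
      qed
      then show ?thesis using nh by (simp add: \<Phi>_def c_def field_simps)
    qed
    have id: "integrable lebesgue (\<lambda>x. W x * divergence (\<phi> a) x)" if "a \<in> corners" for a
      by (rule integrable_mult_bounded[OF iW divergence_integral_0(2)[OF \<phi>(1)[OF that]] \<phi>(3)[OF that]])
    have "ereal (LINT x|lebesgue_on \<Omega>. w x * divergence \<Phi> x) \<le> ereal T"
      using T unfolding TV_def by (rule order.trans[rotated]) (intro SUP_upper, use \<Phi>c \<Phi>1 in blast)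
    then have "T \<ge> (LINT x|lebesgue_on \<Omega>. w x * divergence \<Phi> x)" by simp
    also have "(LINT x|lebesgue_on \<Omega>. w x * divergence \<Phi> x) = (LINT x|lebesgue. c * (\<Sum>a\<in>corners. W x * divergence (\<phi> a) x))"
      using domain_in_sets by (simp add: integral_restrict_space div W_def sum_distrib_left mult_ac)
    also have "\<dots> = c * (\<Sum>a\<in>corners. LINT x|lebesgue. W x * divergence (\<phi> a) x)"
      using id by (simp add: Bochner_Integration.integral_sum)
    finally have "(\<Sum>a\<in>corners. LINT x|lebesgue. W x * divergence (\<phi> a) x) \<le> ?n * h * T"
      using nh by (simp add: c_def field_simps)
    moreover have "(\<Sum>a\<in>corners. (LINT x|lebesgue. \<bar>W x - m a\<bar> * indicator (cube a h) x) - \<kappa>) \<le> (\<Sum>a\<in>corners. LINT x|lebesgue. W x * divergence (\<phi> a) x)"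
      by (intro sum_mono \<phi>(4))
    moreover have "real (card corners) * \<kappa> \<le> \<epsilon>" using \<epsilon> by (simp add: \<kappa>_def field_simps)
    ultimately show "(\<Sum>a\<in>corners. LINT x|lebesgue. \<bar>W x - m a\<bar> * indicator (cube a h) x) \<le> ?n * h * T + \<epsilon>"
      by (simp add: sum_subtractf)
  qed
  then show ?thesis by (simp add: W_def m_def)
qed

text \<open>\<open>Min\<close> only breaks ties: the set of minimisers is finite, and it is nonempty
  as soon as some \<open>v\<close> competes.\<close>

lemma rounded_value_optimal:
  assumes "finite W" "v \<in> cell_values W w Q"
  shows "\<bar>cell_mean w Q - real_of_int (rounded_value W w Q)\<bar> \<le> \<bar>cell_mean w Q - real_of_int v\<bar>"
proof -
  let ?f = "\<lambda>\<omega>. \<bar>cell_mean w Q - real_of_int \<omega>\<bar>"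
  let ?S = "{\<omega>. is_arg_min ?f (\<lambda>\<omega>. \<omega> \<in> cell_values W w Q) \<omega>}"
  have fin: "finite (cell_values W w Q)" using assms(1) by (simp add: cell_values_def)
  have "?S \<subseteq> cell_values W w Q" by (auto simp: is_arg_min_def)
  moreover have "?S \<noteq> {}"
  proof -
    obtain u where "u \<in> cell_values W w Q" "\<And>y. y \<in> cell_values W w Q \<Longrightarrow> ?f u \<le> ?f y"
      using fin assms(2) ex_min_if_finite[of "?f ` cell_values W w Q"] by (auto simp: not_less)
    then show ?thesis by (auto simp: is_arg_min_def not_less)
  qed
  ultimately have "Min ?S \<in> ?S" using fin by (intro Min_in) (auto intro: finite_subset)
  then have "rounded_value W w Q \<in> ?S" unfolding rounded_value_def .
  then show ?thesis using assms(2) unfolding is_arg_min_def mem_Collect_eq not_less by (meson linorder_not_less)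
qed

text \<open>Values taken only on null sets do not compete in the rounding. There are finitely many
  of them, so for almost every \<open>x\<close> in the cell the value \<open>w x\<close> itself is a
  competitor.\<close>

lemma AE_cell_value:
  assumes W: "finite W" and w: "w \<in> L1W W \<Omega>" and Q: "cube a h \<in> \<Q>"
  shows "AE x in lebesgue. x \<in> cube a h \<longrightarrow> (\<exists>v\<in>cell_values W w (cube a h). w x = real_of_int v)"
proof -
  have wm: "(\<lambda>x. indicator \<Omega> x * w x) \<in> borel_measurable lebesgue"
  proof -
    have "integrable (lebesgue_on \<Omega>) w" using w by (simp add: L1W_def L1_def)
    then have "integrable lebesgue (\<lambda>x. indicator \<Omega> x *\<^sub>R w x)"
      using domain_in_sets by (subst (asm) integrable_restrict_space) auto
    from borel_measurable_integrable[OF this] show ?thesis by simp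
  qed
  have "AE x in lebesgue. \<forall>v\<in>W. x \<in> cube a h \<longrightarrow> w x = real_of_int v \<longrightarrow> v \<in> cell_values W w (cube a h)"
  proof (rule AE_finite_allI[OF W])
    fix v assume v: "v \<in> W"
    show "AE x in lebesgue. x \<in> cube a h \<longrightarrow> w x = real_of_int v \<longrightarrow> v \<in> cell_values W w (cube a h)"
    proof (cases "v \<in> cell_values W w (cube a h)")
      case False
      let ?S = "{x \<in> cube a h. w x = real_of_int v}"
      \<comment> \<open>\<open>emeasure\<close> is 0 on non-measurable sets too, so this alone does
        not make \<open>?S\<close> null. Measurability of \<open>w\<close> is known on \<Omega>
        only; the rest of the cell is split off as a null set to show that \<open>?S\<close> is
        measurable.\<close>
      have e0: "emeasure lebesgue ?S = 0" using False v by (simp add: cell_values_def not_gr_zero)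
      have nQ: "cube a h - \<Omega> \<in> null_sets lebesgue"
        using null1 Q by (meson Diff_mono Union_upper negligible_iff_null_sets negligible_subset order.refl)
      have "?S = (cube a h \<inter> \<Omega> \<inter> {x. indicator \<Omega> x * w x = real_of_int v}) \<union> (?S \<inter> (cube a h - \<Omega>))"
        by (auto simp: indicator_def)
      moreover have "?S \<inter> (cube a h - \<Omega>) \<in> sets lebesgue"
        using nQ by (meson Int_lower2 negligible_iff_null_sets negligible_imp_sets negligible_subset)
      moreover have "{x. indicator \<Omega> x * w x = real_of_int v} \<in> sets lebesgue"
        using measurable_sets[OF wm, of "{real_of_int v}"] by (simp add: vimage_def)
      ultimately have "?S \<in> sets lebesgue"
        using domain_in_sets by (metis (no_types, lifting) cube_eq lmeasurable_cbox fmeasurableD sets.Int sets.Un)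
      with e0 have "?S \<in> null_sets lebesgue" by (simp add: null_sets_def)
      then show ?thesis by (rule AE_I') auto
    qed simp
  qed
  moreover have "AE x in lebesgue. x \<in> \<Omega> \<longrightarrow> w x \<in> real_of_int ` W"
    using w domain_in_sets by (simp add: L1W_def AE_lebesgue_on_iff)
  ultimately show ?thesis
    using AE_box_of_cbox[of a "a + vec h"]
  proof eventually_elim
    case (elim x)
    show ?case
    proof
      assume x: "x \<in> cube a h"
      then have "x \<in> \<Omega>" using elim(3) box_subset_domain[OF Q] unfolding cube_eq by blast
      then obtain v where "v \<in> W" "w x = real_of_int v" using elim(2) by auto
      then show "\<exists>v\<in>cell_values W w (cube a h). w x = real_of_int v" using elim(1) x by blast
    qed
  qed
qed

lemma rounding_on_cell:
  assumes "a \<in> corners" "x \<in> box a (a + vec h)"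
  shows "rounding W \<Q> w x = real_of_int (rounded_value W w (cube a h))"
proof -
  have Q: "cube a h \<in> \<Q>" using assms by (simp add: corners_def)
  have "real_of_int (rounded_value W w Q) * indicator (interior Q) x = 0" if Q': "Q \<in> \<Q> - {cube a h}" for Q
    using interior_disjoint[of "cube a h" Q] Q Q' assms(2) by (auto simp: interior_cube indicator_def)
  then have "rounding W \<Q> w x = (\<Sum>Q\<in>{cube a h}. real_of_int (rounded_value W w Q) * indicator (interior Q) x)"
    unfolding rounding_def using Q finite_cells by (intro sum.mono_neutral_right) auto
  then show ?thesis using assms(2) by (simp add: interior_cube)
qed

lemma rounding_measurable: "rounding W \<Q> w \<in> borel_measurable lebesgue"
  unfolding rounding_def[abs_def]
  by (intro borel_measurable_sum borel_measurable_times borel_measurable_indicator) auto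

text \<open>Since \<open>w x\<close> is among the competitors, the rounded value is no farther from
  the cell mean than \<open>w x\<close>, and the triangle inequality gives the factor 2.\<close>

lemma rounding_error:
  assumes W: "finite W" and w: "w \<in> L1W W \<Omega>" and T: "TV \<Omega> w \<le> ereal T"
  shows "integrable lebesgue (\<lambda>x. indicator \<Omega> x * (rounding W \<Q> w x - w x))"
    "(LINT x|lebesgue. \<bar>indicator \<Omega> x * (rounding W \<Q> w x - w x)\<bar>) \<le> 2 * real CARD('n) * h * T"
proof -
  have w1: "integrable (lebesgue_on \<Omega>) w" using w by (simp add: L1W_def L1_def)
  have iW: "integrable lebesgue (\<lambda>x. indicator \<Omega> x * w x)"
    using w1 domain_in_sets by (subst (asm) integrable_restrict_space) auto
  let ?m = "\<lambda>a. cell_mean w (cube a h)"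
  let ?d = "\<lambda>a x. \<bar>indicator \<Omega> x * w x - ?m a\<bar> * indicator (cube a h) x"
  have id: "integrable lebesgue (?d a)" for a
  proof -
    have Qm: "cube a h \<in> sets lebesgue" by (simp add: cube_eq)
    have iQ: "integrable lebesgue (\<lambda>x. ?m a * indicator (cube a h) x :: real)"
      using bounded_set_imp_lmeasurable[of "cube a h"] Qm unfolding cube_eq
      by (intro integrable_mult_right integrable_real_indicator) (auto simp: fmeasurable_def)
    have "?d a x = \<bar>(indicator \<Omega> x * w x) * indicator (cube a h) x - ?m a * indicator (cube a h) x\<bar>" for x
      by (simp add: indicator_def)
    then show ?thesis
      by (simp only:) (intro integrable_abs Bochner_Integration.integrable_diff integrable_real_mult_indicator[OF Qm iW] iQ)
  qed
  have i2: "integrable lebesgue (\<lambda>x. \<Sum>a\<in>corners. 2 * ?d a x)"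
    by (intro Bochner_Integration.integrable_sum integrable_mult_right id)
  have "AE x in lebesgue. \<forall>a\<in>corners. x \<in> cube a h \<longrightarrow> (\<exists>v\<in>cell_values W w (cube a h). w x = real_of_int v)"
    using AE_cell_value[OF W w] by (intro AE_finite_allI finite_corners) (simp add: corners_def)
  then have le: "AE x in lebesgue. \<bar>indicator \<Omega> x * (rounding W \<Q> w x - w x)\<bar> \<le> (\<Sum>a\<in>corners. 2 * ?d a x)"
    using AE_unique_cell
  proof eventually_elim
    case (elim x)
    show ?case
    proof (cases "x \<in> \<Omega>")
      case True
      then obtain a where a: "a \<in> corners" "x \<in> box a (a + vec h)" using elim(2) by blast
      have x: "x \<in> cube a h" using a(2) box_subset_cbox unfolding cube_eq by blast
      obtain v where v: "v \<in> cell_values W w (cube a h)" "w x = real_of_int v" using elim(1) a(1) x by blast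
      have "\<bar>rounding W \<Q> w x - w x\<bar> \<le> 2 * ?d a x"
        using rounded_value_optimal[OF W v(1)] True x unfolding rounding_on_cell[OF a] v(2)
        by (simp add: abs_if split: if_splits)
      also have "\<dots> \<le> (\<Sum>a\<in>corners. 2 * ?d a x)"
        by (rule member_le_sum[OF a(1) _ finite_corners]) simp
      finally show ?thesis using True by simp
    next
      case False
      then show ?thesis by (auto intro!: sum_nonneg)
    qed
  qed
  have m: "(\<lambda>x. indicator \<Omega> x * (rounding W \<Q> w x - w x)) \<in> borel_measurable lebesgue"
  proof -
    have "(\<lambda>x. indicator \<Omega> x * rounding W \<Q> w x - indicator \<Omega> x * w x) \<in> borel_measurable lebesgue"
      using domain_in_sets
      by (intro borel_measurable_diff borel_measurable_times borel_measurable_indicator rounding_measurable borel_measurable_integrable[OF iW])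
    then show ?thesis by (simp add: algebra_simps)
  qed
  show I: "integrable lebesgue (\<lambda>x. indicator \<Omega> x * (rounding W \<Q> w x - w x))"
  proof (rule Bochner_Integration.integrable_bound[OF i2 m])
    show "AE x in lebesgue. norm (indicator \<Omega> x * (rounding W \<Q> w x - w x)) \<le> norm (\<Sum>a\<in>corners. 2 * ?d a x)"
      using le by eventually_elim simp
  qed
  have "(LINT x|lebesgue. \<bar>indicator \<Omega> x * (rounding W \<Q> w x - w x)\<bar>) \<le> (LINT x|lebesgue. (\<Sum>a\<in>corners. 2 * ?d a x))"
    by (rule integral_mono_AE[OF integrable_abs[OF I] i2 le])
  also have "\<dots> = 2 * (\<Sum>a\<in>corners. LINT x|lebesgue. ?d a x)"
    using id by (simp add: Bochner_Integration.integral_sum sum_distrib_left)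
  also have "\<dots> \<le> 2 * (real CARD('n) * h * T)"
    by (intro mult_left_mono cell_deviation_le_TV[OF w1 T]) simp
  finally show "(LINT x|lebesgue. \<bar>indicator \<Omega> x * (rounding W \<Q> w x - w x)\<bar>) \<le> 2 * real CARD('n) * h * T" by simp
qed

end

text \<open>Two meshes act at once. With \<open>n\<close> the dimension, the input mesh supplies the
  rounding error \<open>2 * n * \<tau> * T\<close> and the TV mesh the divergence bound
  \<open>2 * n / h\<close>; their product is the excess over \<open>T\<close>.\<close>

lemma TVh_rounding_le:
  fixes \<Omega> :: "(real^'d) set"
  assumes dom: "bounded_lipschitz_domain \<Omega>" and W: "finite W" and w: "w \<in> L1W W \<Omega>"
    and mp: "admissible_mesh_pair \<Omega> h \<tau> \<Q> \<P>" and T: "TV \<Omega> w \<le> ereal T"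
  shows "TVh \<Omega> \<Q> (rounding W \<P> w) \<le> ereal (T + 4 * (real CARD('d))\<^sup>2 * T * (\<tau> / h))"
proof -
  have h: "h > 0" using mp by (simp add: admissible_mesh_pair_def)
  interpret P: tiled_domain \<Omega> \<tau> \<P>
    using dom mp by unfold_locales (simp_all add: admissible_mesh_pair_def)
  show ?thesis
    unfolding TVh_def
  proof (rule Sup_least, clarify)
    fix \<phi> g
    assume RT: "\<phi> \<in> RT0_0 \<Omega> \<Q>" and b: "esssup (lebesgue_on \<Omega>) (\<lambda>x. ereal (norm (\<phi> x))) \<le> 1"
      and div: "has_L2_weak_divergence \<Omega> \<phi> g"
    have "AE x in lebesgue_on \<Omega>. norm (\<phi> x) \<le> 1"
      using esssup_AE[of "\<lambda>x. ereal (norm (\<phi> x))" "lebesgue_on \<Omega>"]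
    proof eventually_elim
      case (elim x)
      then have "ereal (norm (\<phi> x)) \<le> 1" using b by (rule order.trans)
      then show ?case by simp
    qed
    then interpret F: rt0_field \<Omega> h \<Q> \<phi> g
      using dom mp RT div by unfold_locales (simp_all add: admissible_mesh_pair_def)
    let ?R = "rounding W \<P> w"
    have w1: "integrable (lebesgue_on \<Omega>) w" using w by (simp add: L1W_def L1_def)
    obtain M where M: "\<And>v. v \<in> W \<Longrightarrow> \<bar>real_of_int v\<bar> \<le> M"
      using finite_imp_bounded[of "real_of_int ` W"] W by (auto simp: bounded_iff)
    have wM: "AE x in lebesgue_on \<Omega>. \<bar>w x\<bar> \<le> M"
    proof -
      have "AE x in lebesgue_on \<Omega>. w x \<in> real_of_int ` W" using w by (simp add: L1W_def)
      then show ?thesis by eventually_elim (use M in auto)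
    qed
    have main: "(LINT x|lebesgue_on \<Omega>. w x * g x) \<le> T"
      by (rule F.integral_divergence_le_TV[OF borel_measurable_integrable[OF w1] wM T])
    let ?G = "2 * real CARD('d) / h"
    have gm: "(\<lambda>x. indicator \<Omega> x * g x) \<in> borel_measurable lebesgue" by (rule F.g_measurable)
    have gB: "AE x in lebesgue. \<bar>indicator \<Omega> x * g x\<bar> \<le> ?G"
      using F.AE_g_bound by eventually_elim (use h in \<open>auto simp: indicator_def\<close>)
    have iW: "integrable lebesgue (\<lambda>x. indicator \<Omega> x * w x)"
      using w1 P.domain_in_sets by (subst (asm) integrable_restrict_space) auto
    note E = P.rounding_error[OF W w T]
    have i1: "integrable lebesgue (\<lambda>x. (indicator \<Omega> x * w x) * (indicator \<Omega> x * g x))"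
      by (rule integrable_mult_AE_bounded[OF iW gm gB])
    have i2: "integrable lebesgue (\<lambda>x. (indicator \<Omega> x * (?R x - w x)) * (indicator \<Omega> x * g x))"
      by (rule integrable_mult_AE_bounded[OF E(1) gm gB])
    have "(LINT x|lebesgue_on \<Omega>. ?R x * g x) = (LINT x|lebesgue. (indicator \<Omega> x * w x) * (indicator \<Omega> x * g x) + (indicator \<Omega> x * (?R x - w x)) * (indicator \<Omega> x * g x))"
      using P.domain_in_sets
      by (simp add: integral_restrict_space) (intro Bochner_Integration.integral_cong refl, simp add: indicator_def algebra_simps)
    also have "\<dots> = (LINT x|lebesgue. (indicator \<Omega> x * w x) * (indicator \<Omega> x * g x)) + (LINT x|lebesgue. (indicator \<Omega> x * (?R x - w x)) * (indicator \<Omega> x * g x))"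
      by (rule Bochner_Integration.integral_add[OF i1 i2])
    also have "(LINT x|lebesgue. (indicator \<Omega> x * w x) * (indicator \<Omega> x * g x)) = (LINT x|lebesgue_on \<Omega>. w x * g x)"
      using P.domain_in_sets
      by (simp add: integral_restrict_space) (intro Bochner_Integration.integral_cong refl, simp add: indicator_def)
    also have "(LINT x|lebesgue. (indicator \<Omega> x * (?R x - w x)) * (indicator \<Omega> x * g x)) \<le> (LINT x|lebesgue. ?G * \<bar>indicator \<Omega> x * (?R x - w x)\<bar>)"
    proof (rule integral_mono_AE[OF i2])
      show "integrable lebesgue (\<lambda>x. ?G * \<bar>indicator \<Omega> x * (?R x - w x)\<bar>)"
        by (intro integrable_mult_right integrable_abs E(1))
      show "AE x in lebesgue. (indicator \<Omega> x * (?R x - w x)) * (indicator \<Omega> x * g x) \<le> ?G * \<bar>indicator \<Omega> x * (?R x - w x)\<bar>"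
        using gB
      proof eventually_elim
        case (elim x)
        have "(indicator \<Omega> x * (?R x - w x)) * (indicator \<Omega> x * g x) \<le> \<bar>indicator \<Omega> x * (?R x - w x)\<bar> * \<bar>indicator \<Omega> x * g x\<bar>"
          by (simp only: abs_mult[symmetric] abs_ge_self)
        also have "\<dots> \<le> \<bar>indicator \<Omega> x * (?R x - w x)\<bar> * ?G" by (intro mult_left_mono elim) simp
        finally show ?case by (simp only: mult.commute)
      qed
    qed
    also have "\<dots> = ?G * (LINT x|lebesgue. \<bar>indicator \<Omega> x * (?R x - w x)\<bar>)" by simp
    also have "\<dots> \<le> ?G * (2 * real CARD('d) * \<tau> * T)"
      using h by (intro mult_left_mono E(2)) simp
    finally have "(LINT x|lebesgue_on \<Omega>. ?R x * g x) \<le> T + ?G * (2 * real CARD('d) * \<tau> * T)" using main by simp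
    also have "\<dots> = T + 4 * (real CARD('d))\<^sup>2 * T * (\<tau> / h)" by (simp add: power2_eq_square)
    finally show "ereal (LINT x|lebesgue_on \<Omega>. ?R x * g x) \<le> ereal (T + 4 * (real CARD('d))\<^sup>2 * T * (\<tau> / h))" by simp
  qed
qed

theorem theorem2p14:
  fixes \<Omega> :: "(real^'d) set"
    and W :: "int set"
    and w :: "real^'d \<Rightarrow> real"
    and H :: "real set"
    and \<tau> :: "real \<Rightarrow> real"
    and \<Q> \<P> :: "real \<Rightarrow> (real^'d) set set"
  assumes "CARD('d) \<in> {1, 2, 3}"
    and "bounded_lipschitz_domain \<Omega>"
    and "finite_union_of_cubes \<Omega>"
    and "finite W" and "W \<noteq> {}"
    and "w \<in> L1W W \<Omega>"
    and "H \<subseteq> {0<..}" and "0 islimpt H"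
    and "\<And>h. h \<in> H \<Longrightarrow> admissible_mesh_pair \<Omega> h (\<tau> h) (\<Q> h) (\<P> h)"
    and "((\<lambda>h. \<tau> h / h) \<longlongrightarrow> 0) (at 0 within H)"
  shows "Limsup (at 0 within H) (\<lambda>h. TVh \<Omega> (\<Q> h) (rounding W (\<P> h) w)) \<le> TV \<Omega> w"
proof (cases "TV \<Omega> w")
  case (real T)
  let ?b = "\<lambda>h. T + 4 * (real CARD('d))\<^sup>2 * T * (\<tau> h / h)"
  have "\<forall>\<^sub>F h in at 0 within H. TVh \<Omega> (\<Q> h) (rounding W (\<P> h) w) \<le> ereal (?b h)"
    using TVh_rounding_le[OF assms(2,4,6) assms(9)] real by (auto simp: eventually_at_filter)
  then have "Limsup (at 0 within H) (\<lambda>h. TVh \<Omega> (\<Q> h) (rounding W (\<P> h) w)) \<le> Limsup (at 0 within H) (\<lambda>h. ereal (?b h))"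
    by (rule Limsup_mono)
  also have "\<dots> = ereal T"
  proof (rule lim_imp_Limsup)
    \<comment> \<open>\<open>Limsup\<close> equals the limit only along a nontrivial filter, which
      the accumulation of \<open>H\<close> at 0 provides.\<close>
    show "at 0 within H \<noteq> bot" using assms(8) by (simp add: trivial_limit_within)
    have "(?b \<longlongrightarrow> T + 4 * (real CARD('d))\<^sup>2 * T * 0) (at 0 within H)" by (intro tendsto_intros assms(10))
    then show "((\<lambda>h. ereal (?b h)) \<longlongrightarrow> ereal T) (at 0 within H)" by simp
  qed
  finally show ?thesis using real by simp
next
  case MInf
  \<comment> \<open>The zero field is admissible, so \<open>TV\<close> is nonnegative and this case
    is void.\<close>
  have "C1 (\<lambda>x. 0 :: real^'d) (\<lambda>x v. 0)" by (rule C1_const)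
  then have "(\<lambda>x. 0 :: real^'d) \<in> C1c \<Omega>" by (rule C1_imp_C1c[where K="{}"]) auto
  then have "ereal (LINT x|lebesgue_on \<Omega>. w x * divergence (\<lambda>x. 0 :: real^'d) x) \<le> TV \<Omega> w"
    unfolding TV_def by (intro SUP_upper) simp
  then show ?thesis using MInf by simp
qed simp

end
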